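(* Let $X$ and $Y$ be finite connected regular graphs, with spectra $\{\lambda_i\}$ and $\{\mu_k\}$ (the sets of distinct eigenvalues of their adjacency matrices). (a) If the spectra $\{\lambda_i\}$ and $\{\mu_k\}$ do not contain $0$ and satisfy $$\{\lambda_i/\lambda_j\}\cap\{\mu_k/\mu_l\}=\{1\},$$ then $A(X\times Y)=A(X)\otimes A(Y)$. (b) If the spectra satisfy $$\{\lambda_i-\lambda_j\}\cap\{\mu_k-\mu_l\}=\{0\},$$ then $A(X\square Y)=A(X)\otimes A(Y)$. Here the sets of ratios and differences run over all pairs of indices $(i,j)$, respectively $(k,l)$, and equality means isomorphism of Hopf $\mathbb C^*$-algebras.
   Context: Graphs are finite, simple and undirected. The direct product $X\times Y$ has vertex set $X\times Y$ and edges $(i,\alpha)\sim(j,\beta)$ iff $i\sim j$ and $\alpha\sim\beta$. The Cartesian product $X\square Y$ has vertex set $X\times Y$ and edges $(i,\alpha)\sim(j,\beta)$ iff ($i=j$ and $\alpha\sim\beta$) or ($i\sim j$ and $\alpha=\beta$). A Hopf $\mathbb C^*$-algebra is a unital $\mathbb C^*$-algebra $A$ with morphisms $\Delta:A\to A\otimes A$, $\varepsilon:A\to\mathbb C$, $S:A\to A^{op}$ satisfying the usual axioms of comultiplication, counit and antipode, and $S^2=\mathrm{id}$. The symbol $\otimes$ between $\mathbb C^*$-algebras denotes the maximal (universal) $\mathbb C^*$-tensor product. A magic unitary is a square matrix over a unital $\mathbb C^*$-algebra whose entries are projections and each of whose rows and columns consists of pairwise orthogonal projections with sum $1$. For a finite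 graph $X$ with vertex set $\{1,\dots,n\}$ and adjacency matrix $d$, $A(X)$ is the universal unital $\mathbb C^*$-algebra generated by elements $u_{ij}$ ($1\le i,j\le n$) subject to the relations making $u=(u_{ij})$ a magic unitary and $du=ud$; it is a Hopf $\mathbb C^*$-algebra with $\Delta(u_{ij})=\sum_k u_{ik}\otimes u_{kj}$, $\varepsilon(u_{ij})=\delta_{ij}$, $S(u_{ij})=u_{ji}$. *)

theory Defs
  imports "HOL-Analysis.Analysis" "HOL-Algebra.Module" "HOL-Algebra.Subrings"
begin

section \<open>Graphs\<close>

text \<open>A finite simple graph is a symmetric irreflexive relation on a finite type, its vertex set.\<close>

definition simple_graph :: "('a::finite \<Rightarrow> 'a \<Rightarrow> bool) \<Rightarrow> bool" where
  "simple_graph X \<longleftrightarrow> symp X \<and> irreflp X"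

definition connected_graph :: "('a::finite \<Rightarrow> 'a \<Rightarrow> bool) \<Rightarrow> bool" where
  "connected_graph X \<longleftrightarrow> (\<forall>i j. X\<^sup>*\<^sup>* i j)"

definition regular_graph :: "('a::finite \<Rightarrow> 'a \<Rightarrow> bool) \<Rightarrow> bool" where
  "regular_graph X \<longleftrightarrow> (\<exists>k. \<forall>i. card {j. X i j} = k)"

definition direct_product ::
    "('a \<Rightarrow> 'a \<Rightarrow> bool) \<Rightarrow> ('b \<Rightarrow> 'b \<Rightarrow> bool) \<Rightarrow> 'a \<times> 'b \<Rightarrow> 'a \<times> 'b \<Rightarrow> bool" where
  "direct_product X Y = (\<lambda>(i, \<alpha>) (j, \<beta>). X i j \<and> Y \<alpha> \<beta>)"

definition cartesian_product ::
    "('a \<Rightarrow> 'a \<Rightarrow> bool) \<Rightarrow> ('b \<Rightarrow> 'b \<Rightarrow> bool) \<Rightarrow> 'a \<times> 'b \<Rightarrow> 'a \<times> 'b \<Rightarrow> bool" where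
  "cartesian_product X Y = (\<lambda>(i, \<alpha>) (j, \<beta>). (i = j \<and> Y \<alpha> \<beta>) \<or> (X i j \<and> \<alpha> = \<beta>))"

definition adjacency :: "('a::finite \<Rightarrow> 'a \<Rightarrow> bool) \<Rightarrow> complex^'a^'a" where
  "adjacency X = (\<chi> i j. of_bool (X i j))"

definition spectrum :: "complex^'n^'n \<Rightarrow> complex set" where
  "spectrum M = {l. \<exists>v. v \<noteq> 0 \<and> M *v v = l *s v}"

abbreviation graph_spectrum :: "('a::finite \<Rightarrow> 'a \<Rightarrow> bool) \<Rightarrow> complex set" where
  "graph_spectrum X \<equiv> spectrum (adjacency X)"


section \<open>C*-algebras\<close>

record 'a star_alg = "(complex, 'a) module" +
  star :: "'a \<Rightarrow> 'a"

record 'a cstar = "'a star_alg" +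
  nrm :: "'a \<Rightarrow> real"

locale cstar_algebra = ring A for A :: "('a, 'm) cstar_scheme" (structure) +
  assumes smult_closed: "x \<in> carrier A \<Longrightarrow> c \<odot> x \<in> carrier A"
    and smult_add_left: "x \<in> carrier A \<Longrightarrow> (c + d) \<odot> x = c \<odot> x \<oplus> d \<odot> x"
    and smult_add_right: "x \<in> carrier A \<Longrightarrow> y \<in> carrier A \<Longrightarrow> c \<odot> (x \<oplus> y) = c \<odot> x \<oplus> c \<odot> y"
    and smult_smult: "x \<in> carrier A \<Longrightarrow> c \<odot> (d \<odot> x) = (c * d) \<odot> x"
    and smult_one: "x \<in> carrier A \<Longrightarrow> 1 \<odot> x = x"
    and smult_mult_left: "x \<in> carrier A \<Longrightarrow> y \<in> carrier A \<Longrightarrow> (c \<odot> x) \<otimes> y = c \<odot> (x \<otimes> y)"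
    and smult_mult_right: "x \<in> carrier A \<Longrightarrow> y \<in> carrier A \<Longrightarrow> x \<otimes> (c \<odot> y) = c \<odot> (x \<otimes> y)"
    and star_closed: "x \<in> carrier A \<Longrightarrow> star A x \<in> carrier A"
    and star_star: "x \<in> carrier A \<Longrightarrow> star A (star A x) = x"
    and star_add: "x \<in> carrier A \<Longrightarrow> y \<in> carrier A \<Longrightarrow> star A (x \<oplus> y) = star A x \<oplus> star A y"
    and star_smult: "x \<in> carrier A \<Longrightarrow> star A (c \<odot> x) = cnj c \<odot> star A x"
    and star_mult: "x \<in> carrier A \<Longrightarrow> y \<in> carrier A \<Longrightarrow> star A (x \<otimes> y) = star A y \<otimes> star A x"
    and nrm_nonneg: "x \<in> carrier A \<Longrightarrow> 0 \<le> nrm A x"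
    and nrm_eq_0: "x \<in> carrier A \<Longrightarrow> nrm A x = 0 \<longleftrightarrow> x = \<zero>"
    and nrm_add: "x \<in> carrier A \<Longrightarrow> y \<in> carrier A \<Longrightarrow> nrm A (x \<oplus> y) \<le> nrm A x + nrm A y"
    and nrm_smult: "x \<in> carrier A \<Longrightarrow> nrm A (c \<odot> x) = cmod c * nrm A x"
    and nrm_mult: "x \<in> carrier A \<Longrightarrow> y \<in> carrier A \<Longrightarrow> nrm A (x \<otimes> y) \<le> nrm A x * nrm A y"
    and nrm_star_mult: "x \<in> carrier A \<Longrightarrow> nrm A (star A x \<otimes> x) = (nrm A x)\<^sup>2"
    and complete: "(\<forall>n. s n \<in> carrier A) \<Longrightarrow>
        (\<forall>e>0. \<exists>N. \<forall>m\<ge>N. \<forall>n\<ge>N. nrm A (s m \<ominus> s n) < e) \<Longrightarrow>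
        \<exists>x\<in>carrier A. (\<lambda>n. nrm A (s n \<ominus> x)) \<longlonglongrightarrow> 0"

definition cstar_hom :: "('a, 'm) cstar_scheme \<Rightarrow> ('b, 'n) cstar_scheme \<Rightarrow> ('a \<Rightarrow> 'b) set" where
  "cstar_hom A B = {f \<in> ring_hom A B. \<forall>x\<in>carrier A.
      (\<forall>c. f (c \<odot>\<^bsub>A\<^esub> x) = c \<odot>\<^bsub>B\<^esub> f x) \<and> f (star A x) = star B (f x)}"

definition complex_cstar :: "complex cstar" where
  "complex_cstar = \<lparr>carrier = UNIV, mult = (*), one = 1, zero = 0, add = (+),
     smult = (*), star = cnj, nrm = cmod\<rparr>"

definition opposite :: "('a, 'm) cstar_scheme \<Rightarrow> ('a, 'm) cstar_scheme" where
  "opposite A = A\<lparr>mult := \<lambda>x y. y \<otimes>\<^bsub>A\<^esub> x\<rparr>"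


section \<open>Universal C*-algebras\<close>

text \<open>
  The free unital complex *-algebra on a set \<open>G\<close>. Its elements are the finitely supported
  functions on words in the letters \<open>g\<close>, encoded as \<open>(g, False)\<close>, and their formal adjoints,
  encoded as \<open>(g, True)\<close>; the product is the linear extension of concatenation.
\<close>

type_synonym 'g star_poly = "('g \<times> bool) list \<Rightarrow> complex"

definition free_star_alg :: "'g set \<Rightarrow> 'g star_poly star_alg" where
  "free_star_alg G =
     \<lparr>carrier = {f. finite {w. f w \<noteq> 0} \<and> (\<forall>w. f w \<noteq> 0 \<longrightarrow> fst ` set w \<subseteq> G)},
      mult = (\<lambda>f g w. \<Sum>k\<le>length w. f (take k w) * g (drop k w)),
      one = (\<lambda>w. of_bool (w = [])),
      zero = (\<lambda>w. 0),
      add = (\<lambda>f g w. f w + g w),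
      smult = (\<lambda>c f w. c * f w),
      star = (\<lambda>f w. cnj (f (rev (map (\<lambda>(g, b). (g, \<not> b)) w))))\<rparr>"

definition gen :: "'g \<Rightarrow> 'g star_poly" where
  "gen g = (\<lambda>w. of_bool (w = [(g, False)]))"

definition cstar_seminorm :: "('x, 'm) star_alg_scheme \<Rightarrow> ('x \<Rightarrow> real) \<Rightarrow> bool" where
  "cstar_seminorm F p \<longleftrightarrow>
     (\<forall>x\<in>carrier F. 0 \<le> p x \<and> p (star F x \<otimes>\<^bsub>F\<^esub> x) = (p x)\<^sup>2 \<and>
        (\<forall>c. p (c \<odot>\<^bsub>F\<^esub> x) = cmod c * p x) \<and>
        (\<forall>y\<in>carrier F. p (x \<oplus>\<^bsub>F\<^esub> y) \<le> p x + p y \<and> p (x \<otimes>\<^bsub>F\<^esub> y) \<le> p x * p y))"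

text \<open>
  A set \<open>R\<close> of pairs stands for the relations \<open>l = r\<close>, for \<open>(l, r) \<in> R\<close>. Representations in
  C*-algebras of a *-algebra subject to \<open>R\<close> correspond to C*-seminorms vanishing on \<open>l - r\<close>, so
  the supremum of these seminorms is the universal one. (It is finite only if the relations bound
  the generators, as they do in both uses below.)
\<close>

definition universal_seminorm ::
    "('x, 'm) star_alg_scheme \<Rightarrow> ('x \<times> 'x) set \<Rightarrow> 'x \<Rightarrow> real" where
  "universal_seminorm F R x =
     Sup {p x | p. cstar_seminorm F p \<and> (\<forall>(l, r)\<in>R. p (l \<ominus>\<^bsub>F\<^esub> r) = 0)}"

text \<open>Hausdorff completion: Cauchy sequences modulo null sequences.\<close>

definition cauchy_seqs :: "('x, 'm) star_alg_scheme \<Rightarrow> ('x \<Rightarrow> real) \<Rightarrow> (nat \<Rightarrow> 'x) set" where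
  "cauchy_seqs F p = {s. (\<forall>n. s n \<in> carrier F) \<and>
     (\<forall>e>0. \<exists>N. \<forall>m\<ge>N. \<forall>n\<ge>N. p (s m \<ominus>\<^bsub>F\<^esub> s n) < e)}"

definition null_rel ::
    "('x, 'm) star_alg_scheme \<Rightarrow> ('x \<Rightarrow> real) \<Rightarrow> ((nat \<Rightarrow> 'x) \<times> (nat \<Rightarrow> 'x)) set" where
  "null_rel F p = {(s, t). s \<in> cauchy_seqs F p \<and> t \<in> cauchy_seqs F p \<and>
     (\<lambda>n. p (s n \<ominus>\<^bsub>F\<^esub> t n)) \<longlonglongrightarrow> 0}"

definition completion ::
    "('x, 'm) star_alg_scheme \<Rightarrow> ('x \<Rightarrow> real) \<Rightarrow> (nat \<Rightarrow> 'x) set cstar" where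
  "completion F p =
     \<lparr>carrier = cauchy_seqs F p // null_rel F p,
      mult = (\<lambda>S T. \<Union>s\<in>S. \<Union>t\<in>T. null_rel F p `` {\<lambda>n. s n \<otimes>\<^bsub>F\<^esub> t n}),
      one = null_rel F p `` {\<lambda>n. \<one>\<^bsub>F\<^esub>},
      zero = null_rel F p `` {\<lambda>n. \<zero>\<^bsub>F\<^esub>},
      add = (\<lambda>S T. \<Union>s\<in>S. \<Union>t\<in>T. null_rel F p `` {\<lambda>n. s n \<oplus>\<^bsub>F\<^esub> t n}),
      smult = (\<lambda>c S. \<Union>s\<in>S. null_rel F p `` {\<lambda>n. c \<odot>\<^bsub>F\<^esub> s n}),
      star = (\<lambda>S. \<Union>s\<in>S. null_rel F p `` {\<lambda>n. star F (s n)}),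
      nrm = (\<lambda>S. THE l. \<forall>s\<in>S. (\<lambda>n. p (s n)) \<longlonglongrightarrow> l)\<rparr>"

type_synonym 'g univ = "(nat \<Rightarrow> 'g star_poly) set"

definition universal_cstar :: "'g set \<Rightarrow> ('g star_poly \<times> 'g star_poly) set \<Rightarrow> 'g univ cstar" where
  "universal_cstar G R = completion (free_star_alg G) (universal_seminorm (free_star_alg G) R)"

definition universal_gen ::
    "'g set \<Rightarrow> ('g star_poly \<times> 'g star_poly) set \<Rightarrow> 'g \<Rightarrow> 'g univ" where
  "universal_gen G R g =
     null_rel (free_star_alg G) (universal_seminorm (free_star_alg G) R) `` {\<lambda>n. gen g}"


section \<open>The maximal tensor product\<close>

text \<open>
  The *-algebra generated by symbols \<open>a \<otimes> b\<close>, here the generators \<open>(a, b)\<close>, subject to the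
  following relations is the algebraic tensor product of \<open>A\<close> and \<open>B\<close>, so its universal C*-algebra
  is the completion in the largest C*-seminorm.
\<close>

definition tensor_relations :: "('a, 'm) cstar_scheme \<Rightarrow> ('b, 'n) cstar_scheme \<Rightarrow>
    (('a \<times> 'b) star_poly \<times> ('a \<times> 'b) star_poly) set" where
  "tensor_relations A B = (let F = free_star_alg (carrier A \<times> carrier B) in
     {(gen (a \<oplus>\<^bsub>A\<^esub> a', b), gen (a, b) \<oplus>\<^bsub>F\<^esub> gen (a', b)) | a a' b.
        a \<in> carrier A \<and> a' \<in> carrier A \<and> b \<in> carrier B} \<union>
     {(gen (a, b \<oplus>\<^bsub>B\<^esub> b'), gen (a, b) \<oplus>\<^bsub>F\<^esub> gen (a, b')) | a b b'.
        a \<in> carrier A \<and> b \<in> carrier B \<and> b' \<in> carrier B} \<union>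
     {(gen (c \<odot>\<^bsub>A\<^esub> a, b), c \<odot>\<^bsub>F\<^esub> gen (a, b)) | c a b. a \<in> carrier A \<and> b \<in> carrier B} \<union>
     {(gen (a, c \<odot>\<^bsub>B\<^esub> b), c \<odot>\<^bsub>F\<^esub> gen (a, b)) | c a b. a \<in> carrier A \<and> b \<in> carrier B} \<union>
     {(gen (a, b) \<otimes>\<^bsub>F\<^esub> gen (a', b'), gen (a \<otimes>\<^bsub>A\<^esub> a', b \<otimes>\<^bsub>B\<^esub> b')) | a a' b b'.
        a \<in> carrier A \<and> a' \<in> carrier A \<and> b \<in> carrier B \<and> b' \<in> carrier B} \<union>
     {(star F (gen (a, b)), gen (star A a, star B b)) | a b. a \<in> carrier A \<and> b \<in> carrier B} \<union>
     {(gen (\<one>\<^bsub>A\<^esub>, \<one>\<^bsub>B\<^esub>), \<one>\<^bsub>F\<^esub>)})"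

definition max_tensor ::
    "('a, 'm) cstar_scheme \<Rightarrow> ('b, 'n) cstar_scheme \<Rightarrow> ('a \<times> 'b) univ cstar" where
  "max_tensor A B = universal_cstar (carrier A \<times> carrier B) (tensor_relations A B)"

definition tensor ::
    "('a, 'm) cstar_scheme \<Rightarrow> ('b, 'n) cstar_scheme \<Rightarrow> 'a \<Rightarrow> 'b \<Rightarrow> ('a \<times> 'b) univ" where
  "tensor A B a b = universal_gen (carrier A \<times> carrier B) (tensor_relations A B) (a, b)"

text \<open>
  Here and below a unital *-homomorphism is selected by its values on generators. Homomorphisms are
  automatically contractive, so these values determine it on the carrier, and all statements
  only use it there.
\<close>

definition tensor_lift ::
    "('a, 'k) cstar_scheme \<Rightarrow> ('b, 'm) cstar_scheme \<Rightarrow> ('c, 'n) cstar_scheme \<Rightarrow>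
     ('a \<Rightarrow> 'b \<Rightarrow> 'c) \<Rightarrow> ('a \<times> 'b) univ \<Rightarrow> 'c" where
  "tensor_lift A B C h = (SOME f. f \<in> cstar_hom (max_tensor A B) C \<and>
     (\<forall>a\<in>carrier A. \<forall>b\<in>carrier B. f (tensor A B a b) = h a b))"

definition tensor_map ::
    "('a, 'k) cstar_scheme \<Rightarrow> ('b, 'l) cstar_scheme \<Rightarrow> ('c, 'm) cstar_scheme \<Rightarrow>
     ('d, 'n) cstar_scheme \<Rightarrow> ('a \<Rightarrow> 'c) \<Rightarrow> ('b \<Rightarrow> 'd) \<Rightarrow> ('a \<times> 'b) univ \<Rightarrow> ('c \<times> 'd) univ" where
  "tensor_map A B C D f g =
     tensor_lift A B (max_tensor C D) (\<lambda>a b. tensor C D (f a) (g b))"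

definition tensor_assoc ::
    "('a, 'k) cstar_scheme \<Rightarrow> ('b, 'l) cstar_scheme \<Rightarrow> ('c, 'm) cstar_scheme \<Rightarrow>
     (('a \<times> 'b) univ \<times> 'c) univ \<Rightarrow> ('a \<times> ('b \<times> 'c) univ) univ" where
  "tensor_assoc A B C =
     (SOME f. f \<in> cstar_hom (max_tensor (max_tensor A B) C) (max_tensor A (max_tensor B C)) \<and>
        (\<forall>a\<in>carrier A. \<forall>b\<in>carrier B. \<forall>c\<in>carrier C.
           f (tensor (max_tensor A B) C (tensor A B a b) c) =
           tensor A (max_tensor B C) a (tensor B C b c)))"

definition tensor_interchange ::
    "('a, 'm) cstar_scheme \<Rightarrow> ('b, 'n) cstar_scheme \<Rightarrow>
     (('a \<times> 'a) univ \<times> ('b \<times> 'b) univ) univ \<Rightarrow> (('a \<times> 'b) univ \<times> ('a \<times> 'b) univ) univ" where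
  "tensor_interchange A B =
     (SOME f. f \<in> cstar_hom (max_tensor (max_tensor A A) (max_tensor B B))
                            (max_tensor (max_tensor A B) (max_tensor A B)) \<and>
        (\<forall>a\<in>carrier A. \<forall>a'\<in>carrier A. \<forall>b\<in>carrier B. \<forall>b'\<in>carrier B.
           f (tensor (max_tensor A A) (max_tensor B B) (tensor A A a a') (tensor B B b b')) =
           tensor (max_tensor A B) (max_tensor A B) (tensor A B a b) (tensor A B a' b')))"


section \<open>Hopf C*-algebras\<close>

record 'a hopf_cstar =
  alg :: "'a cstar"
  comult :: "'a \<Rightarrow> ('a \<times> 'a) univ"
  counit :: "'a \<Rightarrow> complex"
  antipode :: "'a \<Rightarrow> 'a"

definition star_subalgebra :: "'a set \<Rightarrow> ('a, 'm) cstar_scheme \<Rightarrow> bool" where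
  "star_subalgebra D A \<longleftrightarrow> subring D A \<and> (\<forall>x\<in>D. star A x \<in> D \<and> (\<forall>c. c \<odot>\<^bsub>A\<^esub> x \<in> D))"

definition dense_in :: "'a set \<Rightarrow> ('a, 'm) cstar_scheme \<Rightarrow> bool" where
  "dense_in D A \<longleftrightarrow> D \<subseteq> carrier A \<and> (\<forall>x\<in>carrier A. \<forall>e>0. \<exists>d\<in>D. nrm A (x \<ominus>\<^bsub>A\<^esub> d) < e)"

text \<open>
  The counit axioms are read in \<open>\<complex> \<otimes> A\<close> and \<open>A \<otimes> \<complex>\<close>. The antipode axioms
  \<open>m (S \<otimes> id) \<Delta> = \<epsilon>(\<cdot>) 1 = m (id \<otimes> S) \<Delta>\<close> involve the multiplication \<open>m\<close>, which is in general
  unbounded for the maximal C*-norm; as usual they are imposed on a dense *-subalgebra \<open>D\<close> that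
  \<open>\<Delta>\<close> maps to algebraic tensors over \<open>D\<close>.
\<close>

locale hopf_cstar_algebra =
  fixes H :: "'a hopf_cstar" and A and \<Delta> and \<epsilon> and S
  defines "A \<equiv> alg H" and "\<Delta> \<equiv> comult H" and "\<epsilon> \<equiv> counit H" and "S \<equiv> antipode H"
  assumes cstar: "cstar_algebra A"
    and comult_hom: "\<Delta> \<in> cstar_hom A (max_tensor A A)"
    and counit_hom: "\<epsilon> \<in> cstar_hom A complex_cstar"
    and antipode_hom: "S \<in> cstar_hom A (opposite A)"
    and coassoc: "x \<in> carrier A \<Longrightarrow>
      tensor_assoc A A A (tensor_map A A (max_tensor A A) A \<Delta> id (\<Delta> x)) =
      tensor_map A A A (max_tensor A A) id \<Delta> (\<Delta> x)"
    and counit_left: "x \<in> carrier A \<Longrightarrow>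
      tensor_map A A complex_cstar A \<epsilon> id (\<Delta> x) = tensor complex_cstar A 1 x"
    and counit_right: "x \<in> carrier A \<Longrightarrow>
      tensor_map A A A complex_cstar id \<epsilon> (\<Delta> x) = tensor A complex_cstar x 1"
    and antipode: "\<exists>D. star_subalgebra D A \<and> dense_in D A \<and> S ` D \<subseteq> D \<and>
      (\<forall>x\<in>D. \<exists>(n::nat) a b. (\<forall>k<n. a k \<in> D \<and> b k \<in> D) \<and>
         \<Delta> x = (\<Oplus>\<^bsub>max_tensor A A\<^esub> k\<in>{..<n}. tensor A A (a k) (b k)) \<and>
         (\<Oplus>\<^bsub>A\<^esub> k\<in>{..<n}. S (a k) \<otimes>\<^bsub>A\<^esub> b k) = \<epsilon> x \<odot>\<^bsub>A\<^esub> \<one>\<^bsub>A\<^esub> \<and>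
         (\<Oplus>\<^bsub>A\<^esub> k\<in>{..<n}. a k \<otimes>\<^bsub>A\<^esub> S (b k)) = \<epsilon> x \<odot>\<^bsub>A\<^esub> \<one>\<^bsub>A\<^esub>)"
    and antipode_involutive: "x \<in> carrier A \<Longrightarrow> S (S x) = x"

definition hopf_cstar_iso :: "'a hopf_cstar \<Rightarrow> 'b hopf_cstar \<Rightarrow> ('a \<Rightarrow> 'b) set" where
  "hopf_cstar_iso H K = {f \<in> cstar_hom (alg H) (alg K).
     bij_betw f (carrier (alg H)) (carrier (alg K)) \<and>
     (\<forall>x\<in>carrier (alg H).
        comult K (f x) = tensor_map (alg H) (alg H) (alg K) (alg K) f f (comult H x) \<and>
        counit K (f x) = counit H x \<and>
        antipode K (f x) = f (antipode H x))}"

definition hopf_cstar_isomorphic :: "'a hopf_cstar \<Rightarrow> 'b hopf_cstar \<Rightarrow> bool"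
    (infix \<open>\<cong>\<^sub>H\<close> 50) where
  "H \<cong>\<^sub>H K \<longleftrightarrow> hopf_cstar_algebra H \<and> hopf_cstar_algebra K \<and> hopf_cstar_iso H K \<noteq> {}"

text \<open>
  \<open>\<Delta> = (id \<otimes> \<sigma> \<otimes> id) (\<Delta>\<^sub>H \<otimes> \<Delta>\<^sub>K)\<close>, \<open>\<epsilon> = \<epsilon>\<^sub>H \<otimes> \<epsilon>\<^sub>K\<close> and \<open>S = S\<^sub>H \<otimes> S\<^sub>K\<close>.
\<close>

definition hopf_tensor :: "'a hopf_cstar \<Rightarrow> 'b hopf_cstar \<Rightarrow> ('a \<times> 'b) univ hopf_cstar"
    (infixr \<open>\<otimes>\<^sub>H\<close> 70) where
  "H \<otimes>\<^sub>H K =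
     \<lparr>alg = max_tensor (alg H) (alg K),
      comult = tensor_interchange (alg H) (alg K) \<circ>
        tensor_map (alg H) (alg K) (max_tensor (alg H) (alg H)) (max_tensor (alg K) (alg K))
          (comult H) (comult K),
      counit = tensor_lift (alg H) (alg K) complex_cstar (\<lambda>a b. counit H a * counit K b),
      antipode = tensor_lift (alg H) (alg K) (opposite (max_tensor (alg H) (alg K)))
        (\<lambda>a b. tensor (alg H) (alg K) (antipode H a) (antipode K b))\<rparr>"


section \<open>The Hopf C*-algebra of a graph\<close>

text \<open>
  The relations, in the unknowns \<open>u i j\<close>, saying that \<open>u\<close> is a magic unitary: the entries are
  projections, and every row and every column consists of pairwise orthogonal projections
  with sum \<open>1\<close>.
\<close>

definition magic_unitary_relations ::
    "('x, 'm) star_alg_scheme \<Rightarrow> ('a::finite \<Rightarrow> 'a \<Rightarrow> 'x) \<Rightarrow> ('x \<times> 'x) set" where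
  "magic_unitary_relations F u =
     {(u i j \<otimes>\<^bsub>F\<^esub> u i j, u i j) | i j. True} \<union>
     {(star F (u i j), u i j) | i j. True} \<union>
     {(u i j \<otimes>\<^bsub>F\<^esub> u i k, \<zero>\<^bsub>F\<^esub>) | i j k. j \<noteq> k} \<union>
     {(u i j \<otimes>\<^bsub>F\<^esub> u k j, \<zero>\<^bsub>F\<^esub>) | i j k. i \<noteq> k} \<union>
     {(\<Oplus>\<^bsub>F\<^esub> j\<in>UNIV. u i j, \<one>\<^bsub>F\<^esub>) | i. True} \<union>
     {(\<Oplus>\<^bsub>F\<^esub> i\<in>UNIV. u i j, \<one>\<^bsub>F\<^esub>) | j. True}"

definition commutation_relations ::
    "('x, 'm) star_alg_scheme \<Rightarrow> complex^'a^'a \<Rightarrow> ('a::finite \<Rightarrow> 'a \<Rightarrow> 'x) \<Rightarrow> ('x \<times> 'x) set" where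
  "commutation_relations F d u =
     {(\<Oplus>\<^bsub>F\<^esub> k\<in>UNIV. (d $ i $ k) \<odot>\<^bsub>F\<^esub> u k j, \<Oplus>\<^bsub>F\<^esub> k\<in>UNIV. (d $ k $ j) \<odot>\<^bsub>F\<^esub> u i k) | i j. True}"

definition graph_relations ::
    "('a::finite \<Rightarrow> 'a \<Rightarrow> bool) \<Rightarrow> (('a \<times> 'a) star_poly \<times> ('a \<times> 'a) star_poly) set" where
  "graph_relations X =
     magic_unitary_relations (free_star_alg UNIV) (\<lambda>i j. gen (i, j)) \<union>
     commutation_relations (free_star_alg UNIV) (adjacency X) (\<lambda>i j. gen (i, j))"

definition graph_cstar :: "('a::finite \<Rightarrow> 'a \<Rightarrow> bool) \<Rightarrow> ('a \<times> 'a) univ cstar" where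
  "graph_cstar X = universal_cstar UNIV (graph_relations X)"

definition graph_gen :: "('a::finite \<Rightarrow> 'a \<Rightarrow> bool) \<Rightarrow> 'a \<Rightarrow> 'a \<Rightarrow> ('a \<times> 'a) univ" where
  "graph_gen X i j = universal_gen UNIV (graph_relations X) (i, j)"

definition graph_hopf :: "('a::finite \<Rightarrow> 'a \<Rightarrow> bool) \<Rightarrow> ('a \<times> 'a) univ hopf_cstar" where
  "graph_hopf X = (let A = graph_cstar X; u = graph_gen X in
     \<lparr>alg = A,
      comult = (SOME f. f \<in> cstar_hom A (max_tensor A A) \<and>
        (\<forall>i j. f (u i j) = (\<Oplus>\<^bsub>max_tensor A A\<^esub> k\<in>UNIV. tensor A A (u i k) (u k j)))),
      counit = (SOME f. f \<in> cstar_hom A complex_cstar \<and> (\<forall>i j. f (u i j) = of_bool (i = j))),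
      antipode = (SOME f. f \<in> cstar_hom A (opposite A) \<and> (\<forall>i j. f (u i j) = u j i))\<rparr>)"

end

theory Submission
  imports Defs "HOL-Computational_Algebra.Fundamental_Theorem_Algebra"
begin

text \<open>
  Write \<open>w\<close> for the universal magic unitary of the product graph, with adjacency matrix \<open>D\<close>. The matrix
  \<open>D\<close> acts on a product of eigenfunctions of \<open>X\<close> and \<open>Y\<close> by the product (or sum) of the eigenvalues, and
  the hypothesis on the spectra says that this number determines the pair of eigenvalues. Hence a
  magic unitary commuting with \<open>D\<close> commutes with everything that acts on these products by a scalar
  depending on the pair only; as \<open>X\<close> and \<open>Y\<close> are connected and regular, this includes \<open>1 \<otimes> J\<close>, \<open>J \<otimes> 1\<close>,
  \<open>d\<^sub>X \<otimes> J\<close> and \<open>J \<otimes> d\<^sub>Y\<close>, for \<open>J\<close> the all-ones matrices. Commutation with \<open>1 \<otimes> J\<close> makes the sums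
  \<open>U\<^sub>i\<^sub>j = \<Sum>\<^sub>b w\<^bsub>(i,a),(j,b)\<^esub>\<close> independent of \<open>a\<close>; they form a magic unitary commuting with \<open>d\<^sub>X\<close>, likewise
  \<open>V\<^sub>a\<^sub>b = \<Sum>\<^sub>j w\<^bsub>(i,a),(j,b)\<^esub>\<close> for \<open>Y\<close>, and \<open>w\<^bsub>(i,a),(j,b)\<^esub> = U\<^sub>i\<^sub>j V\<^sub>a\<^sub>b = V\<^sub>a\<^sub>b U\<^sub>i\<^sub>j\<close>. This gives a homomorphism
  \<open>A(X) \<otimes> A(Y) \<rightarrow> A(P)\<close> inverse to \<open>w\<^bsub>(i,a),(j,b)\<^esub> \<mapsto> u\<^sub>i\<^sub>j \<otimes> v\<^sub>a\<^sub>b\<close>. All identities between homomorphisms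
  are checked on generators, which suffices since *-homomorphisms of C*-algebras are contractive.
\<close>

section \<open>Star algebras and C*-seminorms\<close>

text \<open>The hypotheses on the spectra act as separation statements:
  \<open>l * m = l' * m'\<close> gives \<open>l / l' = m' / m\<close>, an element of both sets of
  ratios, hence \<open>1\<close>; for sums, \<open>l - l' = m' - m\<close> lies in both sets of
  differences, hence is \<open>0\<close>. An eigenvalue \<open>0\<close> would make a product forget
  the other factor. Connectedness and regularity let the all-ones matrix act by a scalar on each
  eigenfunction. The factorisation of \<open>w\<close> rests on row orthogonality: in one row the
  sums for \<open>U\<close> and \<open>V\<close> have just one entry in common. Much of the work
  concerns the objects themselves. A universal algebra is the completion in a supremum of seminorms,
  which has to be shown finite, and the structure maps are choices by \<open>SOME\<close>, each of
  which needs an existence proof. Contractivity of homomorphisms is derived from the C*-identity: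
  every C*-seminorm on a C*-algebra lies below its norm. No spectral projections of \<open>D\<close>
  appear. Coefficient matrices are expanded in rank one matrices built from eigenfunctions, and
  contraction with \<open>w\<close> is compared on these.\<close>

locale star_algebra = ring F for F :: "('a, 'm) star_alg_scheme" (structure) +
  assumes scale_closed [simp, intro]: "x \<in> carrier F \<Longrightarrow> c \<odot> x \<in> carrier F"
    and scale_add_left: "x \<in> carrier F \<Longrightarrow> (c + d) \<odot> x = c \<odot> x \<oplus> d \<odot> x"
    and scale_add_right: "x \<in> carrier F \<Longrightarrow> y \<in> carrier F \<Longrightarrow> c \<odot> (x \<oplus> y) = c \<odot> x \<oplus> c \<odot> y"
    and scale_scale [simp]: "x \<in> carrier F \<Longrightarrow> c \<odot> (d \<odot> x) = (c * d) \<odot> x"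
    and scale_one [simp]: "x \<in> carrier F \<Longrightarrow> 1 \<odot> x = x"
    and scale_mult_left [simp]: "x \<in> carrier F \<Longrightarrow> y \<in> carrier F \<Longrightarrow> (c \<odot> x) \<otimes> y = c \<odot> (x \<otimes> y)"
    and scale_mult_right [simp]: "x \<in> carrier F \<Longrightarrow> y \<in> carrier F \<Longrightarrow> x \<otimes> (c \<odot> y) = c \<odot> (x \<otimes> y)"
    and adj_closed [simp, intro]: "x \<in> carrier F \<Longrightarrow> star F x \<in> carrier F"
    and adj_adj [simp]: "x \<in> carrier F \<Longrightarrow> star F (star F x) = x"
    and adj_add: "x \<in> carrier F \<Longrightarrow> y \<in> carrier F \<Longrightarrow> star F (x \<oplus> y) = star F x \<oplus> star F y"
    and adj_scale: "x \<in> carrier F \<Longrightarrow> star F (c \<odot> x) = cnj c \<odot> star F x"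
    and adj_mult: "x \<in> carrier F \<Longrightarrow> y \<in> carrier F \<Longrightarrow> star F (x \<otimes> y) = star F y \<otimes> star F x"
begin

lemma scale_zero_left [simp]: assumes "x \<in> carrier F" shows "0 \<odot> x = \<zero>"
proof -
  have "0 \<odot> x \<oplus> 0 \<odot> x = 0 \<odot> x"
    using scale_add_left[OF assms, of 0 0] by simp
  then show ?thesis
    using assms by (metis add.l_cancel_one scale_closed)
qed

lemma scale_zero_right [simp]: "c \<odot> \<zero> = \<zero>"
  using scale_mult_left[of \<zero> \<zero> c] scale_scale[of \<zero> c 0] by (metis mult_zero_right scale_zero_left zero_closed)

lemma neg_eq: "x \<in> carrier F \<Longrightarrow> \<ominus> x = (- 1) \<odot> x"
  using scale_add_left[of x "-1" 1] by (intro minus_equality) auto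

lemma diff_eq: "x \<in> carrier F \<Longrightarrow> y \<in> carrier F \<Longrightarrow> x \<ominus> y = x \<oplus> (- 1) \<odot> y"
  by (simp add: a_minus_def neg_eq)

lemma scale_diff: "x \<in> carrier F \<Longrightarrow> y \<in> carrier F \<Longrightarrow> c \<odot> (x \<ominus> y) = c \<odot> x \<ominus> c \<odot> y"
  by (simp add: diff_eq scale_add_right)

lemma adj_diff: "x \<in> carrier F \<Longrightarrow> y \<in> carrier F \<Longrightarrow> star F (x \<ominus> y) = star F x \<ominus> star F y"
  by (simp add: diff_eq adj_scale adj_add)

lemma adj_zero [simp]: "star F \<zero> = \<zero>"
  using adj_scale[of \<zero> 0] by simp

lemma adj_one [simp]: "star F \<one> = \<one>"
  by (metis adj_adj adj_closed adj_mult l_one one_closed r_one)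

lemma scale_finsum:
  "(\<And>i. i \<in> I \<Longrightarrow> f i \<in> carrier F) \<Longrightarrow> finite I \<Longrightarrow> c \<odot> (\<Oplus>i\<in>I. f i) = (\<Oplus>i\<in>I. c \<odot> f i)"
proof (induction I rule: infinite_finite_induct)
  case (insert i I)
  then show ?case by (simp add: scale_add_right Pi_def)
qed auto

lemma adj_finsum:
  "(\<And>i. i \<in> I \<Longrightarrow> f i \<in> carrier F) \<Longrightarrow> star F (\<Oplus>i\<in>I. f i) = (\<Oplus>i\<in>I. star F (f i))"
proof (induction I rule: infinite_finite_induct)
  case (insert i I)
  then show ?case by (simp add: adj_add Pi_def)
qed auto

lemma diff_self [simp]: "x \<in> carrier F \<Longrightarrow> x \<ominus> x = \<zero>"
  by (simp add: a_minus_def r_neg)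

lemma diff_eq_zero_iff: "x \<in> carrier F \<Longrightarrow> y \<in> carrier F \<Longrightarrow> x \<ominus> y = \<zero> \<longleftrightarrow> x = y"
  using r_right_minus_eq by blast

lemma finsum_closed' [simp, intro]: "(\<And>i. i \<in> I \<Longrightarrow> f i \<in> carrier F) \<Longrightarrow> (\<Oplus>i\<in>I. f i) \<in> carrier F"
  by (rule finsum_closed) auto

end

text \<open>The estimates below are shared by the admissible seminorms on free algebras, by their
  supremum and by the norm of a C*-algebra. Nonzero elements may have value zero.\<close>

locale star_seminorm = star_algebra F for F :: "('a, 'm) star_alg_scheme" (structure) +
  fixes p :: "'a \<Rightarrow> real"
  assumes seminorm: "cstar_seminorm F p"
begin

lemma p_nonneg [simp]: "x \<in> carrier F \<Longrightarrow> 0 \<le> p x"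
  and p_star_mult: "x \<in> carrier F \<Longrightarrow> p (star F x \<otimes> x) = (p x)\<^sup>2"
  and p_scale: "x \<in> carrier F \<Longrightarrow> p (c \<odot> x) = cmod c * p x"
  and p_add: "x \<in> carrier F \<Longrightarrow> y \<in> carrier F \<Longrightarrow> p (x \<oplus> y) \<le> p x + p y"
  and p_mult: "x \<in> carrier F \<Longrightarrow> y \<in> carrier F \<Longrightarrow> p (x \<otimes> y) \<le> p x * p y"
  using seminorm by (auto simp: cstar_seminorm_def)

lemma p_zero [simp]: "p \<zero> = 0"
  using p_scale[of \<zero> 0] by simp

lemma p_neg [simp]: "x \<in> carrier F \<Longrightarrow> p (\<ominus> x) = p x"
  by (simp add: neg_eq p_scale)

lemma p_diff_commute: "x \<in> carrier F \<Longrightarrow> y \<in> carrier F \<Longrightarrow> p (x \<ominus> y) = p (y \<ominus> x)"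
  by (metis add.inv_closed add.inv_mult_group minus_closed minus_eq minus_minus p_neg)

lemma p_triangle:
  assumes "x \<in> carrier F" "y \<in> carrier F" "z \<in> carrier F"
  shows "p (x \<ominus> z) \<le> p (x \<ominus> y) + p (y \<ominus> z)"
proof -
  have "x \<ominus> z = (x \<ominus> y) \<oplus> (y \<ominus> z)"
    using assms by algebra
  then show ?thesis using assms by (simp add: p_add)
qed

lemma p_add_diff:
  assumes "x \<in> carrier F" "y \<in> carrier F" "x' \<in> carrier F" "y' \<in> carrier F"
  shows "p ((x \<oplus> y) \<ominus> (x' \<oplus> y')) \<le> p (x \<ominus> x') + p (y \<ominus> y')"
proof -
  have "(x \<oplus> y) \<ominus> (x' \<oplus> y') = (x \<ominus> x') \<oplus> (y \<ominus> y')"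
    using assms by algebra
  then show ?thesis using assms by (simp add: p_add)
qed

lemma p_mult_diff:
  assumes "x \<in> carrier F" "y \<in> carrier F" "x' \<in> carrier F" "y' \<in> carrier F"
  shows "p ((x \<otimes> y) \<ominus> (x' \<otimes> y')) \<le> p (x \<ominus> x') * p y + p x' * p (y \<ominus> y')"
proof -
  have "(x \<otimes> y) \<ominus> (x' \<otimes> y') = (x \<ominus> x') \<otimes> y \<oplus> x' \<otimes> (y \<ominus> y')"
    using assms by algebra
  then have "p ((x \<otimes> y) \<ominus> (x' \<otimes> y')) \<le> p ((x \<ominus> x') \<otimes> y) + p (x' \<otimes> (y \<ominus> y'))"
    using assms by (simp add: p_add)
  also have "\<dots> \<le> p (x \<ominus> x') * p y + p x' * p (y \<ominus> y')"
    using assms by (intro add_mono p_mult) auto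
  finally show ?thesis .
qed

lemma p_scale_diff:
  assumes "x \<in> carrier F" "x' \<in> carrier F"
  shows "p (c \<odot> x \<ominus> c \<odot> x') = cmod c * p (x \<ominus> x')"
  using assms by (simp flip: scale_diff add: p_scale)

text \<open>The C*-identity gives \<open>(p x)\<^sup>2 \<le> p (star F x) * p x\<close>, so
  \<open>p x\<close> is at most \<open>p (star F x)\<close>; taking \<open>star F x\<close> in place
  of \<open>x\<close> gives the converse.\<close>

lemma p_star [simp]: assumes "x \<in> carrier F" shows "p (star F x) = p x"
proof -
  have le: "p x \<le> p (star F x)" if "x \<in> carrier F" for x
  proof (cases "p x = 0")
    case False
    then show ?thesis
      using that p_mult[of "star F x" x] p_star_mult[of x] p_nonneg[OF that]
      by (auto simp: power2_eq_square mult_le_cancel_right less_le)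
  qed (use that in auto)
  show ?thesis using le[OF assms] le[of "star F x"] assms by auto
qed

lemma p_star_diff:
  assumes "x \<in> carrier F" "x' \<in> carrier F"
  shows "p (star F x \<ominus> star F x') = p (x \<ominus> x')"
  using assms by (simp flip: adj_diff)

lemma p_one_le: "p \<one> \<le> 1"
proof -
  have "p \<one> = (p \<one>)\<^sup>2" using p_star_mult[of \<one>] by simp
  then show ?thesis
    by (metis dual_order.refl less_eq_real_def mult_cancel_right1 power2_eq_square zero_le_one)
qed

lemma p_abs_diff: "x \<in> carrier F \<Longrightarrow> y \<in> carrier F \<Longrightarrow> \<bar>p x - p y\<bar> \<le> p (x \<ominus> y)"
proof -
  have le: "p x \<le> p (x \<ominus> y) + p y" if "x \<in> carrier F" "y \<in> carrier F" for x y
    using p_triangle[of x y \<zero>] that by (simp add: a_minus_def)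
  assume "x \<in> carrier F" "y \<in> carrier F"
  then show ?thesis using le[of x y] le[of y x] p_diff_commute[of x y] by auto
qed

end


section \<open>The completion in a C*-seminorm\<close>

context star_seminorm begin

abbreviation "cauchy \<equiv> cauchy_seqs F p"
abbreviation "Q \<equiv> completion F p"

definition cls :: "(nat \<Rightarrow> 'a) \<Rightarrow> (nat \<Rightarrow> 'a) set" where
  "cls s = null_rel F p `` {s}"

lemma cauchy_carrier: "s \<in> cauchy \<Longrightarrow> s n \<in> carrier F"
  by (auto simp: cauchy_seqs_def)

lemma cauchyD: "s \<in> cauchy \<Longrightarrow> e > 0 \<Longrightarrow> \<exists>N. \<forall>m\<ge>N. \<forall>n\<ge>N. p (s m \<ominus> s n) < e"
  by (auto simp: cauchy_seqs_def)

lemma cauchyI: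
  "(\<And>n. s n \<in> carrier F) \<Longrightarrow> (\<And>e. e > 0 \<Longrightarrow> \<exists>N. \<forall>m\<ge>N. \<forall>n\<ge>N. p (s m \<ominus> s n) < e) \<Longrightarrow> s \<in> cauchy"
  by (auto simp: cauchy_seqs_def)

lemma cauchy_const [simp, intro]: "x \<in> carrier F \<Longrightarrow> (\<lambda>n. x) \<in> cauchy"
  by (auto intro!: cauchyI)

lemma cauchy_norm_convergent: assumes "s \<in> cauchy" shows "convergent (\<lambda>n. p (s n))"
proof -
  have "Cauchy (\<lambda>n. p (s n))"
  proof (rule CauchyI)
    fix e :: real assume "e > 0"
    then obtain N where N: "\<forall>m\<ge>N. \<forall>n\<ge>N. p (s m \<ominus> s n) < e" using cauchyD[OF assms] by blast
    then show "\<exists>M. \<forall>m\<ge>M. \<forall>n\<ge>M. norm (p (s m) - p (s n)) < e"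
      using p_abs_diff[of "s _" "s _"] cauchy_carrier[OF assms] by (metis real_norm_def order_le_less_trans)
  qed
  then show ?thesis by (rule Cauchy_convergent)
qed

lemma cauchy_bounded: assumes "s \<in> cauchy" obtains K where "K > 0" "\<And>n. p (s n) \<le> K"
proof -
  have "Bseq (\<lambda>n. p (s n))"
    using cauchy_norm_convergent[OF assms] convergent_imp_Bseq by blast
  then show ?thesis
    by (elim BseqE) (use that in \<open>fastforce simp: abs_le_iff\<close>)
qed

text \<open>Serves all operations at once: a sequence is Cauchy when its differences are controlled
  by those of two Cauchy sequences. Unary operations take the same sequence twice, with second
  constant \<open>0\<close>.\<close>

lemma cauchy_dominated:
  assumes s: "s \<in> cauchy" and t: "t \<in> cauchy" and r: "\<And>n. r n \<in> carrier F"
    and le: "\<And>m n. p (r m \<ominus> r n) \<le> K * p (s m \<ominus> s n) + L * p (t m \<ominus> t n)"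
  shows "r \<in> cauchy"
proof (rule cauchyI)
  fix e :: real assume e: "e > 0"
  \<comment> \<open>The \<open>1\<close> keeps \<open>M\<close> positive, so that dividing by
    \<open>M\<close> is possible whatever the constants are.\<close>
  define M where "M = max (max K L) 1"
  have M: "M > 0" "K \<le> M" "L \<le> M" by (auto simp: M_def)
  have "e / (2 * M) > 0" using e M by simp
  then obtain N1 N2 where N1: "\<forall>m\<ge>N1. \<forall>n\<ge>N1. p (s m \<ominus> s n) < e / (2 * M)"
    and N2: "\<forall>m\<ge>N2. \<forall>n\<ge>N2. p (t m \<ominus> t n) < e / (2 * M)" using cauchyD[OF s] cauchyD[OF t] by metis
  have "p (r m \<ominus> r n) < e" if "m \<ge> max N1 N2" "n \<ge> max N1 N2" for m n
  proof -
    have nn: "0 \<le> p (s m \<ominus> s n)" "0 \<le> p (t m \<ominus> t n)"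
      using cauchy_carrier[OF s] cauchy_carrier[OF t] by auto
    have "p (r m \<ominus> r n) \<le> K * p (s m \<ominus> s n) + L * p (t m \<ominus> t n)" by (rule le)
    also have "\<dots> \<le> M * p (s m \<ominus> s n) + M * p (t m \<ominus> t n)"
      using nn M by (intro add_mono mult_right_mono) auto
    also have "\<dots> < M * (e / (2 * M)) + M * (e / (2 * M))"
      using N1 N2 that M by (intro add_strict_mono mult_strict_left_mono) auto
    also have "\<dots> = e" using M by (simp add: field_simps)
    finally show ?thesis .
  qed
  then show "\<exists>N. \<forall>m\<ge>N. \<forall>n\<ge>N. p (r m \<ominus> r n) < e" by blast
qed (rule r)

lemma cauchy_add: "s \<in> cauchy \<Longrightarrow> t \<in> cauchy \<Longrightarrow> (\<lambda>n. s n \<oplus> t n) \<in> cauchy"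
  by (rule cauchy_dominated[where s = s and t = t and K = 1 and L = 1]) (auto simp: cauchy_carrier p_add_diff)

lemma cauchy_scale: "s \<in> cauchy \<Longrightarrow> (\<lambda>n. c \<odot> s n) \<in> cauchy"
  by (rule cauchy_dominated[where s = s and t = s and K = "cmod c" and L = 0])
    (auto simp: cauchy_carrier p_scale_diff)

lemma cauchy_star: "s \<in> cauchy \<Longrightarrow> (\<lambda>n. star F (s n)) \<in> cauchy"
  by (rule cauchy_dominated[where s = s and t = s and K = 1 and L = 0])
    (auto simp: cauchy_carrier p_star_diff)

lemma cauchy_mult: assumes s: "s \<in> cauchy" and t: "t \<in> cauchy" shows "(\<lambda>n. s n \<otimes> t n) \<in> cauchy"
proof -
  obtain K L where K: "K > 0" "\<And>n. p (s n) \<le> K" and L: "L > 0" "\<And>n. p (t n) \<le> L"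
    using cauchy_bounded[OF s] cauchy_bounded[OF t] by metis
  show ?thesis
  proof (rule cauchy_dominated[OF s t])
    fix m n
    have "p (s m \<otimes> t m \<ominus> s n \<otimes> t n) \<le> p (s m \<ominus> s n) * p (t m) + p (s n) * p (t m \<ominus> t n)"
      by (rule p_mult_diff) (auto simp: cauchy_carrier s t)
    also have "\<dots> \<le> p (s m \<ominus> s n) * L + K * p (t m \<ominus> t n)"
      using K L by (intro add_mono mult_left_mono mult_right_mono) (auto simp: cauchy_carrier s t)
    finally show "p (s m \<otimes> t m \<ominus> s n \<otimes> t n) \<le> L * p (s m \<ominus> s n) + K * p (t m \<ominus> t n)"
      by (simp add: mult.commute)
  qed (auto simp: cauchy_carrier s t)
qed

lemma null_relD:
  assumes "(s, t) \<in> null_rel F p"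
  shows "s \<in> cauchy" "t \<in> cauchy" "(\<lambda>n. p (s n \<ominus> t n)) \<longlonglongrightarrow> 0"
  using assms by (auto simp: null_rel_def)

lemma null_rel_dominated:
  assumes u: "u \<in> cauchy" and v: "v \<in> cauchy"
    and le: "\<And>n. p (u n \<ominus> v n) \<le> f n" and "f \<longlonglongrightarrow> 0"
  shows "(u, v) \<in> null_rel F p"
proof -
  have "(\<lambda>n. p (u n \<ominus> v n)) \<longlonglongrightarrow> 0"
    by (rule tendsto_sandwich[OF _ _ tendsto_const assms(4)])
      (auto simp: le intro!: always_eventually p_nonneg minus_closed cauchy_carrier[OF u] cauchy_carrier[OF v])
  then show ?thesis using u v by (auto simp: null_rel_def)
qed

lemma equiv_null_rel: "equiv cauchy (null_rel F p)"
proof (rule equivI)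
  show "null_rel F p \<subseteq> cauchy \<times> cauchy" by (auto simp: null_rel_def)
  show "refl_on cauchy (null_rel F p)"
    by (auto simp: refl_on_def null_rel_def cauchy_carrier)
  show "sym (null_rel F p)"
    by (auto simp: sym_def null_rel_def p_diff_commute cauchy_carrier)
  show "trans (null_rel F p)"
  proof (rule transI)
    fix s t r assume st: "(s, t) \<in> null_rel F p" and tr: "(t, r) \<in> null_rel F p"
    note D = null_relD[OF st] null_relD[OF tr]
    show "(s, r) \<in> null_rel F p"
      by (rule null_rel_dominated[OF D(1) D(5), of "\<lambda>n. p (s n \<ominus> t n) + p (t n \<ominus> r n)"])
        (use D tendsto_add[OF D(3) D(6)] in \<open>auto intro!: p_triangle cauchy_carrier\<close>)
  qed
qed

section \<open>Operations on classes of Cauchy sequences\<close>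

lemma cls_eq_iff:
  "s \<in> cauchy \<Longrightarrow> t \<in> cauchy \<Longrightarrow> cls s = cls t \<longleftrightarrow> (\<lambda>n. p (s n \<ominus> t n)) \<longlonglongrightarrow> 0"
  using eq_equiv_class_iff[OF equiv_null_rel] by (simp add: cls_def null_rel_def)

lemma completion_carrier: "carrier (Q) = cls ` cauchy"
  by (auto simp: completion_def quotient_def cls_def)

lemma completion_cases:
  assumes "S \<in> carrier (Q)" obtains s where "s \<in> cauchy" "S = cls s"
  using assms by (auto simp: completion_carrier)

lemma cls_closed [simp, intro]: "s \<in> cauchy \<Longrightarrow> cls s \<in> carrier (Q)"
  by (auto simp: completion_carrier)

text \<open>\<open>completion\<close> takes a union over all representatives; it collapses to one
  class because the operation maps equivalent sequences to equivalent ones. The lemmas for the other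
  operations follow the same pattern.\<close>

lemma completion_add [simp]:
  assumes s: "s \<in> cauchy" and t: "t \<in> cauchy"
  shows "cls s \<oplus>\<^bsub>Q\<^esub> cls t = cls (\<lambda>n. s n \<oplus> t n)"
proof -
  have "congruent2 (null_rel F p) (null_rel F p) (\<lambda>s t. null_rel F p `` {\<lambda>n. s n \<oplus> t n})"
  proof (rule congruent2I', rule equiv_class_eq[OF equiv_null_rel])
    fix s s' t t' assume st: "(s, s') \<in> null_rel F p" "(t, t') \<in> null_rel F p"
    note D = null_relD[OF st(1)] null_relD[OF st(2)]
    show "((\<lambda>n. s n \<oplus> t n), (\<lambda>n. s' n \<oplus> t' n)) \<in> null_rel F p"
      by (rule null_rel_dominated[of _ _ "\<lambda>n. p (s n \<ominus> s' n) + p (t n \<ominus> t' n)"])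
        (use D tendsto_add[OF D(3) D(6)] in \<open>auto intro!: cauchy_add p_add_diff cauchy_carrier\<close>)
  qed
  then show ?thesis
    using UN_equiv_class2[OF equiv_null_rel equiv_null_rel _ s t] by (simp add: completion_def cls_def)
qed

lemma completion_mult [simp]:
  assumes s: "s \<in> cauchy" and t: "t \<in> cauchy"
  shows "cls s \<otimes>\<^bsub>Q\<^esub> cls t = cls (\<lambda>n. s n \<otimes> t n)"
proof -
  have "congruent2 (null_rel F p) (null_rel F p) (\<lambda>s t. null_rel F p `` {\<lambda>n. s n \<otimes> t n})"
  proof (rule congruent2I', rule equiv_class_eq[OF equiv_null_rel])
    fix s s' t t' assume st: "(s, s') \<in> null_rel F p" "(t, t') \<in> null_rel F p"
    note D = null_relD[OF st(1)] null_relD[OF st(2)]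
    obtain K L where K: "K > 0" "\<And>n. p (s' n) \<le> K" and L: "L > 0" "\<And>n. p (t n) \<le> L"
      using cauchy_bounded[OF D(2)] cauchy_bounded[OF D(4)] by metis
    have c: "s n \<in> carrier F" "s' n \<in> carrier F" "t n \<in> carrier F" "t' n \<in> carrier F" for n
      using D by (auto intro: cauchy_carrier)
    show "((\<lambda>n. s n \<otimes> t n), (\<lambda>n. s' n \<otimes> t' n)) \<in> null_rel F p"
    proof (rule null_rel_dominated[of _ _ "\<lambda>n. p (s n \<ominus> s' n) * L + K * p (t n \<ominus> t' n)"])
      fix n
      have "p (s n \<otimes> t n \<ominus> s' n \<otimes> t' n) \<le> p (s n \<ominus> s' n) * p (t n) + p (s' n) * p (t n \<ominus> t' n)"
        by (rule p_mult_diff) (auto simp: c)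
      also have "\<dots> \<le> p (s n \<ominus> s' n) * L + K * p (t n \<ominus> t' n)"
        using K L by (intro add_mono mult_left_mono mult_right_mono) (auto simp: c)
      finally show "p (s n \<otimes> t n \<ominus> s' n \<otimes> t' n) \<le> p (s n \<ominus> s' n) * L + K * p (t n \<ominus> t' n)" .
    next
      show "(\<lambda>n. p (s n \<ominus> s' n) * L + K * p (t n \<ominus> t' n)) \<longlonglongrightarrow> 0"
        using tendsto_add[OF tendsto_mult_right[OF D(3), of L] tendsto_mult_left[OF D(6), of K]] by simp
    qed (use D in \<open>auto intro: cauchy_mult\<close>)
  qed
  then show ?thesis
    using UN_equiv_class2[OF equiv_null_rel equiv_null_rel _ s t] by (simp add: completion_def cls_def)
qed

lemma completion_scale [simp]:
  assumes s: "s \<in> cauchy"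
  shows "c \<odot>\<^bsub>Q\<^esub> cls s = cls (\<lambda>n. c \<odot> s n)"
proof -
  have "congruent (null_rel F p) (\<lambda>s. null_rel F p `` {\<lambda>n. c \<odot> s n})"
  proof (rule congruentI, rule equiv_class_eq[OF equiv_null_rel])
    fix s s' assume st: "(s, s') \<in> null_rel F p"
    note D = null_relD[OF st]
    show "((\<lambda>n. c \<odot> s n), (\<lambda>n. c \<odot> s' n)) \<in> null_rel F p"
      by (rule null_rel_dominated[of _ _ "\<lambda>n. cmod c * p (s n \<ominus> s' n)"])
        (use D tendsto_mult_left[OF D(3), of "cmod c"] in \<open>auto intro!: cauchy_scale simp: p_scale_diff cauchy_carrier\<close>)
  qed
  then show ?thesis
    using UN_equiv_class[OF equiv_null_rel _ s] by (simp add: completion_def cls_def)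
qed

lemma completion_star [simp]:
  assumes s: "s \<in> cauchy"
  shows "star (Q) (cls s) = cls (\<lambda>n. star F (s n))"
proof -
  have "congruent (null_rel F p) (\<lambda>s. null_rel F p `` {\<lambda>n. star F (s n)})"
  proof (rule congruentI, rule equiv_class_eq[OF equiv_null_rel])
    fix s s' assume st: "(s, s') \<in> null_rel F p"
    note D = null_relD[OF st]
    show "((\<lambda>n. star F (s n)), (\<lambda>n. star F (s' n))) \<in> null_rel F p"
      by (rule null_rel_dominated[of _ _ "\<lambda>n. p (s n \<ominus> s' n)"])
        (use D in \<open>auto intro!: cauchy_star simp: p_star_diff cauchy_carrier\<close>)
  qed
  then show ?thesis
    using UN_equiv_class[OF equiv_null_rel _ s] by (simp add: completion_def cls_def)
qed

lemma completion_zero: "\<zero>\<^bsub>Q\<^esub> = cls (\<lambda>n. \<zero>)"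
  and completion_one: "\<one>\<^bsub>Q\<^esub> = cls (\<lambda>n. \<one>)"
  by (simp_all add: completion_def cls_def)

text \<open>The seminorm along a sequence changes by at most \<open>p (s n \<ominus> t n)\<close>
  when \<open>s\<close> is replaced by an equivalent \<open>t\<close>, so all representatives have
  the same limit and the description by \<open>THE\<close> in \<open>nrm\<close> is met.\<close>

lemma tendsto_completion_nrm:
  assumes s: "s \<in> cauchy"
  shows "(\<lambda>n. p (s n)) \<longlonglongrightarrow> nrm (Q) (cls s)"
proof -
  obtain l where l: "(\<lambda>n. p (s n)) \<longlonglongrightarrow> l"
    using cauchy_norm_convergent[OF s] by (auto simp: convergent_def)
  have all: "\<forall>t\<in>cls s. (\<lambda>n. p (t n)) \<longlonglongrightarrow> l"
  proof
    fix t assume "t \<in> cls s"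
    then have "(s, t) \<in> null_rel F p" by (auto simp: cls_def)
    note D = null_relD[OF this]
    have "(\<lambda>n. p (t n) - p (s n)) \<longlonglongrightarrow> 0"
    proof (rule tendsto_0_le[OF D(3), of _ 1], rule always_eventually, rule allI)
      fix n
      have "p (t n \<ominus> s n) = p (s n \<ominus> t n)"
        using D by (intro p_diff_commute) (auto intro: cauchy_carrier)
      then show "norm (p (t n) - p (s n)) \<le> norm (p (s n \<ominus> t n)) * 1"
        using p_abs_diff[OF cauchy_carrier[OF D(2)] cauchy_carrier[OF D(1)], of n n] by simp
    qed
    from tendsto_add[OF this l] show "(\<lambda>n. p (t n)) \<longlonglongrightarrow> l" by simp
  qed
  have "s \<in> cls s" using equiv_class_self[OF equiv_null_rel s] by (simp add: cls_def)
  then have "(THE l. \<forall>t\<in>cls s. (\<lambda>n. p (t n)) \<longlonglongrightarrow> l) = l"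
    using all by (intro the_equality) (auto intro: LIMSEQ_unique)
  then show ?thesis using l by (simp add: completion_def)
qed

lemma completion_nrm_const: "x \<in> carrier F \<Longrightarrow> nrm (Q) (cls (\<lambda>n. x)) = p x"
  using tendsto_completion_nrm[of "\<lambda>n. x"] LIMSEQ_unique[OF tendsto_const] cauchy_const by metis

lemma completion_ring: "ring (Q)"
proof (rule ringI)
  show "abelian_group (Q)"
  proof (rule abelian_groupI)
    fix S assume "S \<in> carrier (Q)"
    then obtain s where s: "s \<in> cauchy" "S = cls s" using completion_cases by blast
    have "(\<lambda>n. (- 1) \<odot> s n \<oplus> s n) = (\<lambda>n. \<zero>)"
      using s by (auto simp: cauchy_carrier l_neg simp flip: neg_eq)
    then show "\<exists>T\<in>carrier (Q). T \<oplus>\<^bsub>Q\<^esub> S = \<zero>\<^bsub>Q\<^esub>"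
      using s by (intro bexI[of _ "cls (\<lambda>n. (- 1) \<odot> s n)"])
        (auto simp: completion_zero cauchy_scale simp del: scale_zero_left)
  next
    fix S T assume "S \<in> carrier (Q)" "T \<in> carrier (Q)"
    then show "S \<oplus>\<^bsub>Q\<^esub> T = T \<oplus>\<^bsub>Q\<^esub> S"
      by (elim completion_cases) (simp, intro arg_cong[of _ _ cls] ext a_comm cauchy_carrier)
  qed (auto elim!: completion_cases simp: completion_zero cauchy_add cauchy_carrier a_assoc)
  show "monoid (Q)"
    by (rule monoidI)
      (auto elim!: completion_cases simp: completion_one cauchy_mult cauchy_carrier m_assoc)
qed (auto elim!: completion_cases simp: cauchy_mult cauchy_add cauchy_carrier l_distr r_distr)

lemma completion_diff:
  assumes s: "s \<in> cauchy" and t: "t \<in> cauchy"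
  shows "cls s \<ominus>\<^bsub>Q\<^esub> cls t = cls (\<lambda>n. s n \<ominus> t n)"
proof -
  interpret Q: ring Q by (rule completion_ring)
  have "\<ominus>\<^bsub>Q\<^esub> cls t = cls (\<lambda>n. (- 1) \<odot> t n)"
    using t by (intro Q.minus_equality)
      (auto simp: completion_zero cauchy_scale cauchy_carrier a_comm diff_eq[symmetric])
  then show ?thesis
    using s t by (simp add: a_minus_def[of "Q"] cauchy_scale diff_eq cauchy_carrier)
qed

lemma completion_approx:
  assumes "S \<in> carrier (Q)" "e > 0"
  shows "\<exists>x\<in>carrier F. nrm (Q) (S \<ominus>\<^bsub>Q\<^esub> cls (\<lambda>n. x)) < e"
proof -
  obtain s where s: "s \<in> cauchy" "S = cls s" using assms completion_cases by blast
  \<comment> \<open>Half of \<open>e\<close>, since the limit turns the strict bound into a weak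
    one.\<close>
  obtain N where N: "\<forall>m\<ge>N. \<forall>n\<ge>N. p (s m \<ominus> s n) < e / 2"
    using cauchyD[OF s(1), of "e / 2"] assms by auto
  have x: "s N \<in> carrier F" using s cauchy_carrier by blast
  have c: "(\<lambda>n. s n \<ominus> s N) \<in> cauchy"
    using cauchy_add[OF s(1) cauchy_scale[OF cauchy_const[OF x], of "-1"]] s x
    by (simp add: diff_eq cauchy_carrier)
  have "(\<lambda>n. p (s n \<ominus> s N)) \<longlonglongrightarrow> nrm (Q) (cls (\<lambda>n. s n \<ominus> s N))"
    by (rule tendsto_completion_nrm[OF c])
  then have "nrm (Q) (cls (\<lambda>n. s n \<ominus> s N)) \<le> e / 2"
    by (rule LIMSEQ_le_const2) (use N in \<open>auto intro!: exI[of _ N] less_imp_le\<close>)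
  then show ?thesis
    using assms s x by (intro bexI[of _ "s N"]) (auto simp: completion_diff)
qed

lemma completion_nrm_add:
  assumes "S \<in> carrier (Q)" "T \<in> carrier (Q)"
  shows "nrm (Q) (S \<oplus>\<^bsub>Q\<^esub> T) \<le> nrm (Q) S + nrm (Q) T"
proof -
  obtain s t where s: "s \<in> cauchy" "S = cls s" and t: "t \<in> cauchy" "T = cls t"
    using assms completion_cases by metis
  have "nrm (Q) (cls (\<lambda>n. s n \<oplus> t n)) \<le> nrm (Q) (cls s) + nrm (Q) (cls t)"
    by (rule LIMSEQ_le[OF tendsto_completion_nrm[OF cauchy_add[OF s(1) t(1)]]
      tendsto_add[OF tendsto_completion_nrm[OF s(1)] tendsto_completion_nrm[OF t(1)]]])
      (auto intro!: p_add cauchy_carrier[OF s(1)] cauchy_carrier[OF t(1)])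
  then show ?thesis using s t by simp
qed

lemma completion_nrm_mult:
  assumes "S \<in> carrier (Q)" "T \<in> carrier (Q)"
  shows "nrm (Q) (S \<otimes>\<^bsub>Q\<^esub> T) \<le> nrm (Q) S * nrm (Q) T"
proof -
  obtain s t where s: "s \<in> cauchy" "S = cls s" and t: "t \<in> cauchy" "T = cls t"
    using assms completion_cases by metis
  have "nrm (Q) (cls (\<lambda>n. s n \<otimes> t n)) \<le> nrm (Q) (cls s) * nrm (Q) (cls t)"
    by (rule LIMSEQ_le[OF tendsto_completion_nrm[OF cauchy_mult[OF s(1) t(1)]]
      tendsto_mult[OF tendsto_completion_nrm[OF s(1)] tendsto_completion_nrm[OF t(1)]]])
      (auto intro!: p_mult cauchy_carrier[OF s(1)] cauchy_carrier[OF t(1)])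
  then show ?thesis using s t by simp
qed

lemma completion_nrm_eq_0:
  assumes "S \<in> carrier (Q)"
  shows "nrm (Q) S = 0 \<longleftrightarrow> S = \<zero>\<^bsub>Q\<^esub>"
proof -
  obtain s where s: "s \<in> cauchy" "S = cls s" using assms completion_cases by blast
  have "S = \<zero>\<^bsub>Q\<^esub> \<longleftrightarrow> (\<lambda>n. p (s n)) \<longlonglongrightarrow> 0"
    using s by (simp add: completion_zero cls_eq_iff cauchy_carrier a_minus_def)
  then show ?thesis
    using tendsto_completion_nrm[OF s(1)] s LIMSEQ_unique by metis
qed

lemma completion_nrm_diff_commute:
  assumes "S \<in> carrier (Q)" "T \<in> carrier (Q)"
  shows "nrm (Q) (S \<ominus>\<^bsub>Q\<^esub> T) = nrm (Q) (T \<ominus>\<^bsub>Q\<^esub> S)"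
proof -
  obtain s t where s: "s \<in> cauchy" "S = cls s" and t: "t \<in> cauchy" "T = cls t"
    using assms completion_cases by metis
  have c: "(\<lambda>n. s n \<ominus> t n) \<in> cauchy" if "s \<in> cauchy" "t \<in> cauchy" for s t
    using cauchy_add[OF that(1) cauchy_scale[OF that(2), of "-1"]] that by (simp add: diff_eq cauchy_carrier)
  have "(\<lambda>n. p (s n \<ominus> t n)) = (\<lambda>n. p (t n \<ominus> s n))"
    using s t by (auto intro!: p_diff_commute cauchy_carrier)
  then show ?thesis
    using tendsto_completion_nrm[OF c[OF s(1) t(1)]] tendsto_completion_nrm[OF c[OF t(1) s(1)]] s t LIMSEQ_unique
    by (simp add: completion_diff)
qed

lemma completion_nrm_triangle:
  assumes "S \<in> carrier (Q)" "T \<in> carrier (Q)" "U \<in> carrier (Q)"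
  shows "nrm (Q) (S \<ominus>\<^bsub>Q\<^esub> U) \<le>
    nrm (Q) (S \<ominus>\<^bsub>Q\<^esub> T) + nrm (Q) (T \<ominus>\<^bsub>Q\<^esub> U)"
proof -
  interpret Q: ring Q by (rule completion_ring)
  have "S \<ominus>\<^bsub>Q\<^esub> U = (S \<ominus>\<^bsub>Q\<^esub> T) \<oplus>\<^bsub>Q\<^esub> (T \<ominus>\<^bsub>Q\<^esub> U)"
    using assms by algebra
  then show ?thesis
    using assms by (simp add: completion_nrm_add)
qed

text \<open>Each \<open>S k\<close> is within \<open>1 / (k + 1)\<close> of a constant class, given
  by an element \<open>x k\<close>; the sequence \<open>x\<close> is then itself Cauchy, and its
  class is the limit.\<close>

lemma completion_complete:
  assumes S: "\<forall>k. S k \<in> carrier (Q)"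
    and C: "\<forall>e>0. \<exists>N. \<forall>m\<ge>N. \<forall>n\<ge>N. nrm (Q) (S m \<ominus>\<^bsub>Q\<^esub> S n) < e"
  shows "\<exists>L\<in>carrier (Q). (\<lambda>k. nrm (Q) (S k \<ominus>\<^bsub>Q\<^esub> L)) \<longlonglongrightarrow> 0"
proof -
  have "\<forall>k. \<exists>x\<in>carrier F. nrm Q (S k \<ominus>\<^bsub>Q\<^esub> cls (\<lambda>n. x)) < inverse (real (Suc k))"
    using S by (intro allI completion_approx) auto
  then obtain x where x: "\<And>k. x k \<in> carrier F"
    and near: "\<And>k. nrm Q (S k \<ominus>\<^bsub>Q\<^esub> cls (\<lambda>n. x k)) < inverse (real (Suc k))"
    by metis
  have xc: "cls (\<lambda>n. x k) \<in> carrier Q" for k using x by auto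
  have eq: "p (x m \<ominus> x n) = nrm Q (cls (\<lambda>i. x m) \<ominus>\<^bsub>Q\<^esub> cls (\<lambda>i. x n))" for m n
    using x by (simp add: completion_diff completion_nrm_const)
  have xcauchy: "x \<in> cauchy"
  proof (rule cauchyI)
    fix e :: real assume e: "e > 0"
    obtain N where N: "\<forall>m\<ge>N. \<forall>n\<ge>N. nrm Q (S m \<ominus>\<^bsub>Q\<^esub> S n) < e / 3"
      using C[rule_format, of "e / 3"] e by auto
    obtain M where M: "inverse (real (Suc M)) < e / 3" using reals_Archimedean[of "e / 3"] e by auto
    have "p (x m \<ominus> x n) < e" if "m \<ge> max M N" "n \<ge> max M N" for m n
    proof -
      have nk: "nrm Q (S k \<ominus>\<^bsub>Q\<^esub> cls (\<lambda>n. x k)) < e / 3" if "k \<ge> M" for k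
      proof -
        have "inverse (real (Suc k)) \<le> inverse (real (Suc M))" using that by (simp add: field_simps)
        then show ?thesis using near[of k] M by linarith
      qed
      have "p (x m \<ominus> x n) \<le> nrm Q (cls (\<lambda>i. x m) \<ominus>\<^bsub>Q\<^esub> S m) + nrm Q (S m \<ominus>\<^bsub>Q\<^esub> cls (\<lambda>i. x n))"
        unfolding eq using S xc by (intro completion_nrm_triangle) auto
      also have "nrm Q (S m \<ominus>\<^bsub>Q\<^esub> cls (\<lambda>i. x n)) \<le> nrm Q (S m \<ominus>\<^bsub>Q\<^esub> S n) + nrm Q (S n \<ominus>\<^bsub>Q\<^esub> cls (\<lambda>i. x n))"
        using S xc by (intro completion_nrm_triangle) auto
      also have "nrm Q (cls (\<lambda>i. x m) \<ominus>\<^bsub>Q\<^esub> S m) = nrm Q (S m \<ominus>\<^bsub>Q\<^esub> cls (\<lambda>i. x m))"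
        using S xc by (intro completion_nrm_diff_commute) auto
      finally show ?thesis using N[rule_format, of m n] nk[of m] nk[of n] that by linarith
    qed
    then show "\<exists>N. \<forall>m\<ge>N. \<forall>n\<ge>N. p (x m \<ominus> x n) < e" by blast
  qed (rule x)
  have lim: "(\<lambda>k. nrm Q (cls (\<lambda>n. x k) \<ominus>\<^bsub>Q\<^esub> cls x)) \<longlonglongrightarrow> 0"
  proof (rule LIMSEQ_I)
    fix e :: real assume e: "e > 0"
    obtain N where N: "\<forall>m\<ge>N. \<forall>n\<ge>N. p (x m \<ominus> x n) < e / 2"
      using cauchyD[OF xcauchy, of "e / 2"] e by auto
    have "norm (nrm Q (cls (\<lambda>n. x k) \<ominus>\<^bsub>Q\<^esub> cls x) - 0) < e" if "k \<ge> N" for k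
    proof -
      have c: "(\<lambda>n. x k \<ominus> x n) \<in> cauchy"
        using cauchy_add[OF cauchy_const[OF x] cauchy_scale[OF xcauchy, of "-1"]] x by (simp add: diff_eq)
      have "(\<lambda>n. p (x k \<ominus> x n)) \<longlonglongrightarrow> nrm Q (cls (\<lambda>n. x k \<ominus> x n))"
        by (rule tendsto_completion_nrm[OF c])
      moreover from this have "0 \<le> nrm Q (cls (\<lambda>n. x k \<ominus> x n))"
        by (rule LIMSEQ_le_const) (auto intro!: exI p_nonneg minus_closed x)
      moreover from calculation(1) have "nrm Q (cls (\<lambda>n. x k \<ominus> x n)) \<le> e / 2"
        by (rule LIMSEQ_le_const2) (use N that in \<open>auto intro!: exI[of _ N] less_imp_le\<close>)
      ultimately show ?thesis using e xcauchy x by (simp add: completion_diff)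
    qed
    then show "\<exists>N. \<forall>k\<ge>N. norm (nrm Q (cls (\<lambda>n. x k) \<ominus>\<^bsub>Q\<^esub> cls x) - 0) < e" by blast
  qed
  have nn: "0 \<le> nrm Q T" if "T \<in> carrier Q" for T
    using that by (elim completion_cases) (auto intro!: LIMSEQ_le_const[OF tendsto_completion_nrm] exI p_nonneg cauchy_carrier)
  interpret Q: ring Q by (rule completion_ring)
  have "(\<lambda>k. nrm Q (S k \<ominus>\<^bsub>Q\<^esub> cls x)) \<longlonglongrightarrow> 0"
  proof (rule tendsto_sandwich[OF _ _ tendsto_const])
    show "(\<lambda>k. inverse (real (Suc k)) + nrm Q (cls (\<lambda>n. x k) \<ominus>\<^bsub>Q\<^esub> cls x)) \<longlonglongrightarrow> 0"
      using tendsto_add[OF LIMSEQ_inverse_real_of_nat lim] by simp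
    show "\<forall>\<^sub>F k in sequentially. nrm Q (S k \<ominus>\<^bsub>Q\<^esub> cls x) \<le>
        inverse (real (Suc k)) + nrm Q (cls (\<lambda>n. x k) \<ominus>\<^bsub>Q\<^esub> cls x)"
    proof (rule always_eventually, rule allI)
      fix k
      have "nrm Q (S k \<ominus>\<^bsub>Q\<^esub> cls x) \<le>
        nrm Q (S k \<ominus>\<^bsub>Q\<^esub> cls (\<lambda>n. x k)) + nrm Q (cls (\<lambda>n. x k) \<ominus>\<^bsub>Q\<^esub> cls x)"
        using S xc xcauchy by (intro completion_nrm_triangle) auto
      then show "nrm Q (S k \<ominus>\<^bsub>Q\<^esub> cls x) \<le>
        inverse (real (Suc k)) + nrm Q (cls (\<lambda>n. x k) \<ominus>\<^bsub>Q\<^esub> cls x)" using near[of k] by linarith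
    qed
  qed (use S xcauchy nn in \<open>auto intro!: always_eventually\<close>)
  then show ?thesis using xcauchy by blast
qed

theorem completion_cstar_algebra: "cstar_algebra (Q)"
proof -
  interpret Q: ring Q by (rule completion_ring)
  show ?thesis
  proof
    fix S c assume "S \<in> carrier Q"
    then obtain s where s: "s \<in> cauchy" "S = cls s" using completion_cases by blast
    have "(\<lambda>n. p (c \<odot> s n)) = (\<lambda>n. cmod c * p (s n))"
      using s by (auto simp: p_scale cauchy_carrier)
    then show "nrm Q (c \<odot>\<^bsub>Q\<^esub> S) = cmod c * nrm Q S"
      using LIMSEQ_unique[OF tendsto_completion_nrm[OF cauchy_scale[OF s(1), of c]]]
        tendsto_mult_left[OF tendsto_completion_nrm[OF s(1)], of "cmod c"] s by simp
  next
    fix S assume "S \<in> carrier Q"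
    then obtain s where s: "s \<in> cauchy" "S = cls s" using completion_cases by blast
    have "(\<lambda>n. p (star F (s n) \<otimes> s n)) = (\<lambda>n. (p (s n))\<^sup>2)"
      using s by (auto simp: p_star_mult cauchy_carrier)
    then show "nrm Q (star Q S \<otimes>\<^bsub>Q\<^esub> S) = (nrm Q S)\<^sup>2"
      using LIMSEQ_unique[OF tendsto_completion_nrm[OF cauchy_mult[OF cauchy_star[OF s(1)] s(1)]]]
        tendsto_power[OF tendsto_completion_nrm[OF s(1)], of 2] s by (simp add: cauchy_star)
  next
    fix S assume "S \<in> carrier Q"
    then show "0 \<le> nrm Q S"
      by (elim completion_cases) (auto intro!: LIMSEQ_le_const[OF tendsto_completion_nrm] exI p_nonneg cauchy_carrier)
  next
    fix S assume "S \<in> carrier Q"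
    then show "nrm Q S = 0 \<longleftrightarrow> S = \<zero>\<^bsub>Q\<^esub>" by (rule completion_nrm_eq_0)
  qed (auto elim!: completion_cases simp: completion_zero cauchy_mult cauchy_add cauchy_scale cauchy_star cauchy_carrier
      scale_add_left scale_add_right adj_add adj_scale adj_mult
      intro: completion_nrm_add[simplified] completion_nrm_mult completion_complete)
qed

end

section \<open>C*-algebras: contractivity and generators\<close>

sublocale cstar_algebra \<subseteq> star_algebra A
  by unfold_locales (fact smult_closed smult_add_left smult_add_right smult_smult smult_one
      smult_mult_left smult_mult_right star_closed star_star star_add star_smult star_mult)+

sublocale cstar_algebra \<subseteq> norm: star_seminorm A "nrm A"
  by unfold_locales
    (auto simp: cstar_seminorm_def nrm_nonneg nrm_star_mult nrm_smult nrm_add nrm_mult)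

context cstar_algebra begin

section \<open>Norm limits in a C*-algebra\<close>

definition converges :: "(nat \<Rightarrow> 'a) \<Rightarrow> 'a \<Rightarrow> bool" where
  "converges s x \<longleftrightarrow> (\<forall>n. s n \<in> carrier A) \<and> x \<in> carrier A \<and> (\<lambda>n. nrm A (s n \<ominus> x)) \<longlonglongrightarrow> 0"

lemma convergesD:
  assumes "converges s x"
  shows "\<And>n. s n \<in> carrier A" "x \<in> carrier A" "(\<lambda>n. nrm A (s n \<ominus> x)) \<longlonglongrightarrow> 0"
  using assms by (auto simp: converges_def)

lemma converges_dominated:
  assumes "\<And>n. s n \<in> carrier A" "x \<in> carrier A" "\<And>n. nrm A (s n \<ominus> x) \<le> f n" "f \<longlonglongrightarrow> 0"
  shows "converges s x"
proof -
  have "(\<lambda>n. nrm A (s n \<ominus> x)) \<longlonglongrightarrow> 0"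
    by (rule tendsto_sandwich[OF _ _ tendsto_const assms(4)])
      (use assms in \<open>auto intro!: always_eventually nrm_nonneg\<close>)
  then show ?thesis using assms by (simp add: converges_def)
qed

lemma converges_const [intro, simp]: "x \<in> carrier A \<Longrightarrow> converges (\<lambda>n. x) x"
  by (simp add: converges_def)

lemma converges_add:
  assumes "converges s x" "converges t y" shows "converges (\<lambda>n. s n \<oplus> t n) (x \<oplus> y)"
  by (rule converges_dominated[of _ _ "\<lambda>n. nrm A (s n \<ominus> x) + nrm A (t n \<ominus> y)"])
    (use convergesD[OF assms(1)] convergesD[OF assms(2)] in
      \<open>auto intro!: norm.p_add_diff tendsto_add_zero\<close>)

lemma converges_scale:
  assumes "converges s x" shows "converges (\<lambda>n. c \<odot> s n) (c \<odot> x)"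
  by (rule converges_dominated[of _ _ "\<lambda>n. cmod c * nrm A (s n \<ominus> x)"])
    (use convergesD[OF assms(1)] in \<open>auto simp: norm.p_scale_diff intro!: tendsto_mult_right_zero\<close>)

lemma converges_star:
  assumes "converges s x" shows "converges (\<lambda>n. star A (s n)) (star A x)"
  by (rule converges_dominated[of _ _ "\<lambda>n. nrm A (s n \<ominus> x)"])
    (use convergesD[OF assms(1)] in \<open>auto simp: norm.p_star_diff\<close>)

lemma converges_nrm:
  assumes "converges s x" shows "(\<lambda>n. nrm A (s n)) \<longlonglongrightarrow> nrm A x"
proof -
  note D = convergesD[OF assms]
  have "(\<lambda>n. nrm A (s n) - nrm A x) \<longlonglongrightarrow> 0"
    by (rule tendsto_0_le[OF D(3), of _ 1])
      (use D norm.p_abs_diff in \<open>auto intro!: always_eventually simp: nrm_nonneg\<close>)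
  from tendsto_add[OF this tendsto_const[of "nrm A x"]] show ?thesis by simp
qed

lemma converges_mult:
  assumes "converges s x" "converges t y" shows "converges (\<lambda>n. s n \<otimes> t n) (x \<otimes> y)"
  by (rule converges_dominated[of _ _ "\<lambda>n. nrm A (s n \<ominus> x) * nrm A (t n) + nrm A x * nrm A (t n \<ominus> y)"])
    (use convergesD[OF assms(1)] convergesD[OF assms(2)] tendsto_mult[OF convergesD(3)[OF assms(1)] converges_nrm[OF assms(2)]]
      in \<open>auto intro!: norm.p_mult_diff tendsto_add_zero tendsto_mult_right_zero\<close>)

lemma converges_unique:
  assumes "converges s x" "converges s y" shows "x = y"
proof -
  have "(\<lambda>n. nrm A (x \<ominus> y)) \<longlonglongrightarrow> 0"
  proof (rule tendsto_sandwich[OF _ _ tendsto_const])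
    show "(\<lambda>n. nrm A (s n \<ominus> x) + nrm A (s n \<ominus> y)) \<longlonglongrightarrow> 0"
      using assms by (intro tendsto_add_zero convergesD(3))
    show "\<forall>\<^sub>F n in sequentially. nrm A (x \<ominus> y) \<le> nrm A (s n \<ominus> x) + nrm A (s n \<ominus> y)"
      using norm.p_triangle[of x "s _" y] norm.p_diff_commute[of x "s _"]
        convergesD[OF assms(1)] convergesD[OF assms(2)] by (auto intro!: always_eventually)
  qed (use convergesD[OF assms(1)] convergesD[OF assms(2)] in \<open>auto intro!: always_eventually nrm_nonneg\<close>)
  then have "nrm A (x \<ominus> y) = 0" by (simp add: LIMSEQ_const_iff)
  then show ?thesis
    using convergesD[OF assms(1)] convergesD[OF assms(2)] by (simp add: nrm_eq_0 diff_eq_zero_iff)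
qed

lemma converges_Suc: "converges s x \<Longrightarrow> converges (\<lambda>n. s (Suc n)) x"
  using LIMSEQ_Suc by (fastforce simp: converges_def)

section \<open>Square roots and comparison of C*-seminorms\<close>

lemma cauchy_converges:
  assumes "s \<in> norm.cauchy" obtains x where "converges s x"
  using complete[of s] assms by (auto simp: cauchy_seqs_def converges_def)

lemma scale_half_double: "x \<in> carrier A \<Longrightarrow> (1/2) \<odot> x \<oplus> (1/2) \<odot> x = x"
  by (simp flip: scale_add_left)

text \<open>Provides the square root of \<open>\<one> \<ominus> y \<otimes> y\<close> that completes
  a self-adjoint \<open>y\<close> of norm below \<open>1\<close> to a unitary. All iterates are
  polynomials in \<open>x\<close>, whence the last clause: the root commutes with everything that
  commutes with \<open>x\<close>.\<close>

lemma sqrt_one_minus: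
  assumes x: "x \<in> carrier A" "star A x = x" "nrm A x < 1"
  obtains z where "z \<in> carrier A" "star A z = z" "z \<otimes> z = \<one> \<ominus> x"
    "\<And>y. y \<in> carrier A \<Longrightarrow> x \<otimes> y = y \<otimes> x \<Longrightarrow> z \<otimes> y = y \<otimes> z"
proof -
  \<comment> \<open>\<open>1 - z\<close> is the fixed point of \<open>v \<mapsto> (x + v\<^sup>2) / 2\<close>, a contraction on the ball of radius \<open>r\<close>.\<close>
  define r where "r = 1 - sqrt (1 - nrm A x)"
  \<comment> \<open>\<open>r\<close> is the smaller root of
    \<open>t\<^sup>2 - 2 * t + nrm A x = 0\<close>; the last equation says that the iteration maps
    the ball of radius \<open>r\<close> into itself.\<close>
  have r: "0 \<le> r" "r < 1" "(nrm A x + r * r) / 2 = r"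
    using x nrm_nonneg[of x] by (auto simp: r_def field_simps)
  define v where "v n = ((\<lambda>v. (1/2) \<odot> (x \<oplus> v \<otimes> v)) ^^ n) \<zero>" for n
  have v0: "v 0 = \<zero>" and vS: "v (Suc n) = (1/2) \<odot> (x \<oplus> v n \<otimes> v n)" for n
    by (simp_all add: v_def)
  have vc [simp]: "v n \<in> carrier A" for n
    by (induction n) (use x in \<open>auto simp: v0 vS\<close>)
  have vr: "nrm A (v n) \<le> r" for n
  proof (induction n)
    case (Suc n)
    have "nrm A (v (Suc n)) \<le> (nrm A x + nrm A (v n \<otimes> v n)) / 2"
      using norm.p_add[of x "v n \<otimes> v n"] x by (simp add: vS nrm_smult)
    also have "\<dots> \<le> (nrm A x + r * r) / 2"
      using nrm_mult[of "v n" "v n"] mult_mono[OF Suc Suc] r nrm_nonneg[of "v n"] by simp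
    finally show ?case using r by simp
  qed (use r in \<open>simp add: v0\<close>)
  \<comment> \<open>The bound at \<open>n = 0\<close> is \<open>nrm A (v k) \<le> 1\<close>. Each
    step gains a factor \<open>r\<close>: a difference of squares in the ball is at most
    \<open>2 * r\<close> times the difference, and the iteration halves it.\<close>
  have vd: "nrm A (v (k + n) \<ominus> v n) \<le> r ^ n" for n k
  proof (induction n)
    case 0
    then show ?case using vr[of k] r by (simp add: v0 a_minus_def)
  next
    case (Suc n)
    have "v (k + Suc n) \<ominus> v (Suc n) = (1/2) \<odot> ((x \<oplus> v (k + n) \<otimes> v (k + n)) \<ominus> (x \<oplus> v n \<otimes> v n))"
      using x by (simp add: vS scale_diff)
    also have "(x \<oplus> v (k + n) \<otimes> v (k + n)) \<ominus> (x \<oplus> v n \<otimes> v n) = v (k + n) \<otimes> v (k + n) \<ominus> v n \<otimes> v n"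
      using x vc[of "k + n"] vc[of n] by algebra
    finally have "nrm A (v (k + Suc n) \<ominus> v (Suc n)) = nrm A (v (k + n) \<otimes> v (k + n) \<ominus> v n \<otimes> v n) / 2"
      by (simp add: nrm_smult)
    also have "\<dots> \<le> (nrm A (v (k + n) \<ominus> v n) * nrm A (v (k + n)) + nrm A (v n) * nrm A (v (k + n) \<ominus> v n)) / 2"
      using norm.p_mult_diff[of "v (k + n)" "v (k + n)" "v n" "v n"] by simp
    also have "\<dots> \<le> (r ^ n * r + r * r ^ n) / 2"
      using Suc vr r by (intro divide_right_mono add_mono mult_mono) (auto simp: nrm_nonneg)
    finally show ?case by simp
  qed
  have "v \<in> norm.cauchy"
  proof (rule norm.cauchyI)
    fix e :: real assume e: "e > 0"
    have "(\<lambda>n. r ^ n) \<longlonglongrightarrow> 0" using r by (intro LIMSEQ_realpow_zero) auto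
    from LIMSEQ_D[OF this e] obtain N where N: "\<And>n. n \<ge> N \<Longrightarrow> r ^ n < e" using r by auto
    have le: "nrm A (v m \<ominus> v n) < e" if "n \<ge> N" "n \<le> m" for m n
      using vd[of "m - n" n] N[of n] that by simp
    have "nrm A (v m \<ominus> v n) < e" if "m \<ge> N" "n \<ge> N" for m n
      using le[of n m] le[of m n] that norm.p_diff_commute[of "v m" "v n"] by (cases "n \<le> m") auto
    then show "\<exists>N. \<forall>m\<ge>N. \<forall>n\<ge>N. nrm A (v m \<ominus> v n) < e" by blast
  qed auto
  then obtain w where w: "converges v w" by (rule cauchy_converges)
  have wc: "w \<in> carrier A" using convergesD[OF w] by auto
  have "converges (\<lambda>n. v (Suc n)) ((1/2) \<odot> (x \<oplus> w \<otimes> w))"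
    unfolding vS using w x by (intro converges_scale converges_add converges_mult converges_const)
  then have w_eq: "w = (1/2) \<odot> (x \<oplus> w \<otimes> w)"
    using converges_Suc[OF w] converges_unique by blast
  then have "w \<oplus> w = x \<oplus> w \<otimes> w"
    using wc x scale_half_double[of "x \<oplus> w \<otimes> w"] by (metis a_closed m_closed)
  then have ww: "w \<otimes> w = (w \<oplus> w) \<ominus> x"
    using wc x by algebra
  have "star A (v n) = v n" for n
    by (induction n) (use x in \<open>auto simp: v0 vS adj_scale adj_add adj_mult\<close>)
  with converges_star[OF w] have "converges v (star A w)" by simp
  then have ws: "star A w = w" using w by (rule converges_unique)
  show ?thesis
  proof
    show "\<one> \<ominus> w \<in> carrier A" using wc by simp
    show "star A (\<one> \<ominus> w) = \<one> \<ominus> w" using wc ws by (simp add: adj_diff)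
    have "(\<one> \<ominus> w) \<otimes> (\<one> \<ominus> w) = \<one> \<ominus> w \<ominus> w \<oplus> w \<otimes> w"
      using wc by (simp add: minus_eq l_distr r_distr l_minus r_minus minus_add a_ac)
    also have "\<dots> = \<one> \<ominus> x" unfolding ww using wc x(1) by algebra
    finally show "(\<one> \<ominus> w) \<otimes> (\<one> \<ominus> w) = \<one> \<ominus> x" .
    fix y assume y: "y \<in> carrier A" "x \<otimes> y = y \<otimes> x"
    have vy: "v n \<otimes> y = y \<otimes> v n" for n
    proof (induction n)
      case (Suc n)
      have "(v n \<otimes> v n) \<otimes> y = y \<otimes> (v n \<otimes> v n)"
        using y Suc vc[of n] by (metis m_assoc)
      then show ?case using x y by (simp add: vS l_distr r_distr)
    qed (use y in \<open>simp add: v0\<close>)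
    have "converges (\<lambda>n. v n \<otimes> y) (w \<otimes> y)" "converges (\<lambda>n. v n \<otimes> y) (y \<otimes> w)"
      using converges_mult[OF w converges_const[OF y(1)]] converges_mult[OF converges_const[OF y(1)] w]
      by (simp_all add: vy)
    then have "w \<otimes> y = y \<otimes> w" by (rule converges_unique)
    then have "y \<ominus> w \<otimes> y = y \<ominus> y \<otimes> w" by simp
    moreover have "(\<one> \<ominus> w) \<otimes> y = y \<ominus> w \<otimes> y" "y \<otimes> (\<one> \<ominus> w) = y \<ominus> y \<otimes> w"
      using wc y(1) by (simp_all add: minus_eq l_distr r_distr l_minus r_minus)
    ultimately show "(\<one> \<ominus> w) \<otimes> y = y \<otimes> (\<one> \<ominus> w)" by simp
  qed
qed

text \<open>
  A self-adjoint contraction \<open>y\<close> is the real part of the unitary \<open>y + i sqrt (1 - y\<^sup>2)\<close>, and every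
  C*-seminorm is at most 1 on unitaries.
\<close>

lemma seminorm_le_nrm:
  assumes q: "cstar_seminorm A q" and x: "x \<in> carrier A"
  shows "q x \<le> nrm A x"
proof -
  interpret q: star_seminorm A q by unfold_locales (rule q)
  have small: "q y \<le> 1" if y: "y \<in> carrier A" "star A y = y" "nrm A y < 1" for y
  proof -
    have "nrm A (y \<otimes> y) = (nrm A y)\<^sup>2" using nrm_star_mult[of y] y by simp
    also have "\<dots> < 1" using y nrm_nonneg[of y] by (simp add: power_less_one_iff abs_square_less_1)
    finally have "nrm A (y \<otimes> y) < 1" .
    moreover have "star A (y \<otimes> y) = y \<otimes> y" using y by (simp add: adj_mult)
    ultimately obtain z where z: "z \<in> carrier A" "star A z = z" "z \<otimes> z = \<one> \<ominus> y \<otimes> y"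
      "\<And>t. t \<in> carrier A \<Longrightarrow> (y \<otimes> y) \<otimes> t = t \<otimes> (y \<otimes> y) \<Longrightarrow> z \<otimes> t = t \<otimes> z"
      using sqrt_one_minus[of "y \<otimes> y"] m_closed[OF y(1) y(1)] by blast
    \<comment> \<open>Commutation with \<open>y\<close> makes the mixed terms of
      \<open>star A u \<otimes> u\<close> cancel.\<close>
    have zy: "z \<otimes> y = y \<otimes> z" by (rule z(4)[OF y(1) m_assoc[OF y(1) y(1) y(1)]])
    define u where "u = y \<oplus> \<i> \<odot> z"
    have u: "u \<in> carrier A" using y z(1,2) by (simp add: u_def)
    have su: "star A u = y \<oplus> (-\<i>) \<odot> z" using y z(1,2) by (simp add: u_def adj_add adj_scale)
    have "star A u \<otimes> u = (y \<otimes> y \<oplus> \<i> \<odot> (y \<otimes> z)) \<oplus> ((-\<i>) \<odot> (y \<otimes> z) \<oplus> z \<otimes> z)"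
      unfolding su using y z(1,2) by (simp add: u_def l_distr r_distr zy scale_add_right a_ac)
    also have "(-\<i>) \<odot> (y \<otimes> z) = \<ominus> (\<i> \<odot> (y \<otimes> z))" using y z(1,2) by (simp add: neg_eq)
    also have "(y \<otimes> y \<oplus> \<i> \<odot> (y \<otimes> z)) \<oplus> (\<ominus> (\<i> \<odot> (y \<otimes> z)) \<oplus> z \<otimes> z) = y \<otimes> y \<oplus> z \<otimes> z"
    proof -
      have "\<i> \<odot> (y \<otimes> z) \<in> carrier A" "y \<otimes> y \<in> carrier A" "z \<otimes> z \<in> carrier A" using y z(1,2) by auto
      then show ?thesis by algebra
    qed
    also have "\<dots> = \<one>" unfolding z(3) using y(1) by algebra
    finally have "(q u)\<^sup>2 = q \<one>" using u q.p_star_mult[of u] by simp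
    then have "(q u)\<^sup>2 \<le> 1\<^sup>2" using q.p_one_le by simp
    then have "q u \<le> 1" by (rule power2_le_imp_le) simp
    have "u \<oplus> star A u = y \<oplus> y"
    proof -
      have "\<i> \<odot> z \<in> carrier A" "(-\<i>) \<odot> z = \<ominus> (\<i> \<odot> z)" using z(1,2) by (auto simp: neg_eq)
      then show ?thesis unfolding su unfolding u_def using y(1) by algebra
    qed
    moreover have "y = (1/2) \<odot> (y \<oplus> y)" using y scale_half_double[of y] by (simp add: scale_add_right)
    ultimately have "q y = q ((1/2) \<odot> (u \<oplus> star A u))" by simp
    also have "\<dots> \<le> 1" using u q.p_add[of u "star A u"] \<open>q u \<le> 1\<close> by (simp add: q.p_scale)
    finally show ?thesis .
  qed
  have sa: "q y \<le> nrm A y" if y: "y \<in> carrier A" "star A y = y" for y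
  proof (rule field_le_epsilon)
    fix e :: real assume e: "e > 0"
    \<comment> \<open>A constant strictly above the norm, since \<open>small\<close> asks for norm
      below \<open>1\<close>; it is positive even when \<open>nrm A y = 0\<close>.\<close>
    define c where "c = nrm A y + e"
    have c: "c > 0" "nrm A y < c" using e nrm_nonneg[OF y(1)] by (auto simp: c_def)
    define d where "d = inverse c"
    have d: "d > 0" "d * nrm A y < 1" "c * d = 1" using c by (simp_all add: d_def field_simps)
    have "q (of_real d \<odot> y) \<le> 1"
      using y d by (intro small) (auto simp: adj_scale nrm_smult)
    then have "d * q y \<le> c * d" using d y by (simp add: q.p_scale)
    then show "q y \<le> nrm A y + e" using d by (simp add: c_def mult.commute)
  qed
  \<comment> \<open>The C*-identity on both sides reduces the general case to the self-adjoint
    element \<open>star A x \<otimes> x\<close>.\<close>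
  have "(q x)\<^sup>2 \<le> (nrm A x)\<^sup>2"
    using sa[of "star A x \<otimes> x"] x by (simp add: adj_mult q.p_star_mult nrm_star_mult)
  then show ?thesis using nrm_nonneg[OF x] by (rule power2_le_imp_le)
qed

end

text \<open>The conditions of \<open>cstar_hom\<close>, for algebras without a norm, so that
  evaluations of free algebras are covered too.\<close>

definition star_hom :: "('a, 'm) star_alg_scheme \<Rightarrow> ('b, 'n) star_alg_scheme \<Rightarrow> ('a \<Rightarrow> 'b) \<Rightarrow> bool" where
  "star_hom A B f \<longleftrightarrow> f \<in> ring_hom A B \<and>
     (\<forall>x\<in>carrier A. (\<forall>c. f (c \<odot>\<^bsub>A\<^esub> x) = c \<odot>\<^bsub>B\<^esub> f x) \<and> f (star A x) = star B (f x))"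

lemma cstar_hom_iff: "f \<in> cstar_hom A B \<longleftrightarrow> star_hom A B f"
  by (simp add: cstar_hom_def star_hom_def)

lemma star_homI:
  assumes "\<And>x. x \<in> carrier A \<Longrightarrow> f x \<in> carrier B"
    and "\<And>x y. x \<in> carrier A \<Longrightarrow> y \<in> carrier A \<Longrightarrow> f (x \<otimes>\<^bsub>A\<^esub> y) = f x \<otimes>\<^bsub>B\<^esub> f y"
    and "\<And>x y. x \<in> carrier A \<Longrightarrow> y \<in> carrier A \<Longrightarrow> f (x \<oplus>\<^bsub>A\<^esub> y) = f x \<oplus>\<^bsub>B\<^esub> f y"
    and "f \<one>\<^bsub>A\<^esub> = \<one>\<^bsub>B\<^esub>"
    and "\<And>x c. x \<in> carrier A \<Longrightarrow> f (c \<odot>\<^bsub>A\<^esub> x) = c \<odot>\<^bsub>B\<^esub> f x"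
    and "\<And>x. x \<in> carrier A \<Longrightarrow> f (star A x) = star B (f x)"
  shows "star_hom A B f"
  using assms by (auto simp: star_hom_def intro!: ring_hom_memI)

lemma star_hom_comp: "star_hom A B f \<Longrightarrow> star_hom B C g \<Longrightarrow> star_hom A C (\<lambda>x. g (f x))"
  by (rule star_homI) (auto simp: star_hom_def ring_hom_closed ring_hom_mult ring_hom_add ring_hom_one)

lemma star_hom_id: "star_hom A A id"
  by (rule star_homI) auto

locale star_map = A: star_algebra A + B: star_algebra B
  for A :: "('a, 'm) star_alg_scheme" and B :: "('b, 'n) star_alg_scheme" +
  fixes f :: "'a \<Rightarrow> 'b"
  assumes hom: "star_hom A B f"
begin

lemma closed [simp, intro]: "x \<in> carrier A \<Longrightarrow> f x \<in> carrier B"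
  and mult [simp]: "x \<in> carrier A \<Longrightarrow> y \<in> carrier A \<Longrightarrow> f (x \<otimes>\<^bsub>A\<^esub> y) = f x \<otimes>\<^bsub>B\<^esub> f y"
  and add [simp]: "x \<in> carrier A \<Longrightarrow> y \<in> carrier A \<Longrightarrow> f (x \<oplus>\<^bsub>A\<^esub> y) = f x \<oplus>\<^bsub>B\<^esub> f y"
  and one [simp]: "f \<one>\<^bsub>A\<^esub> = \<one>\<^bsub>B\<^esub>"
  and scale [simp]: "x \<in> carrier A \<Longrightarrow> f (c \<odot>\<^bsub>A\<^esub> x) = c \<odot>\<^bsub>B\<^esub> f x"
  and adj [simp]: "x \<in> carrier A \<Longrightarrow> f (star A x) = star B (f x)"
  using hom by (auto simp: star_hom_def ring_hom_closed ring_hom_mult ring_hom_add ring_hom_one)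

lemma zero [simp]: "f \<zero>\<^bsub>A\<^esub> = \<zero>\<^bsub>B\<^esub>"
  using scale[of "\<zero>\<^bsub>A\<^esub>" 0] by simp

lemma diff [simp]: "x \<in> carrier A \<Longrightarrow> y \<in> carrier A \<Longrightarrow> f (x \<ominus>\<^bsub>A\<^esub> y) = f x \<ominus>\<^bsub>B\<^esub> f y"
  by (simp add: A.diff_eq B.diff_eq)

lemma finsum: "(\<And>i. i \<in> I \<Longrightarrow> g i \<in> carrier A) \<Longrightarrow> f (\<Oplus>\<^bsub>A\<^esub>i\<in>I. g i) = (\<Oplus>\<^bsub>B\<^esub>i\<in>I. f (g i))"
proof (induction I rule: infinite_finite_induct)
  case (insert i I)
  then show ?case by (simp add: Pi_def)
qed auto

text \<open>With \<open>q\<close> the norm of the target this pulls a norm back: on a C*-algebra it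
  yields contractivity, on a free algebra an admissible seminorm.\<close>

lemma seminorm_comp:
  assumes "cstar_seminorm B q" shows "cstar_seminorm A (\<lambda>x. q (f x))"
  using assms unfolding cstar_seminorm_def by (simp del: mult_eq_0_iff)

end

lemma star_mapI [intro]:
  "cstar_algebra A \<Longrightarrow> cstar_algebra B \<Longrightarrow> star_hom A B f \<Longrightarrow> star_map A B f"
proof -
  assume A: "cstar_algebra A" and B: "cstar_algebra B" and f: "star_hom A B f"
  interpret A: cstar_algebra A by (rule A)
  interpret B: cstar_algebra B by (rule B)
  show ?thesis by unfold_locales (rule f)
qed

locale cstar_map = A: cstar_algebra A + B: cstar_algebra B + star_map A B f
  for A :: "('a, 'm) cstar_scheme" and B :: "('b, 'n) cstar_scheme" and f :: "'a \<Rightarrow> 'b"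
begin

lemma contractive: "x \<in> carrier A \<Longrightarrow> nrm B (f x) \<le> nrm A x"
  by (rule A.seminorm_le_nrm[OF seminorm_comp[OF B.norm.seminorm]])

lemma converges: assumes "A.converges s x" shows "B.converges (\<lambda>n. f (s n)) (f x)"
  by (rule B.converges_dominated[of _ _ "\<lambda>n. nrm A (s n \<ominus>\<^bsub>A\<^esub> x)"])
    (use A.convergesD[OF assms] contractive in \<open>auto simp flip: diff\<close>)

end

lemma cstar_mapI: "cstar_algebra A \<Longrightarrow> cstar_algebra B \<Longrightarrow> star_hom A B f \<Longrightarrow> cstar_map A B f"
  using star_mapI[of A B f] by (simp add: cstar_map_def star_map_def)

text \<open>Generation as an induction principle: a property of the elements of \<open>S\<close>
  that survives the operations and norm limits holds everywhere. Equality of two homomorphisms and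
  commutation with an element are treated as such properties; density of the algebraic span is
  deduced later.\<close>

definition generates :: "('a, 'm) cstar_scheme \<Rightarrow> 'a set \<Rightarrow> bool" where
  "generates A S \<longleftrightarrow> S \<subseteq> carrier A \<and>
     (\<forall>P. (\<forall>x\<in>S. P x) \<longrightarrow> P \<one>\<^bsub>A\<^esub> \<longrightarrow>
        (\<forall>x\<in>carrier A. \<forall>y\<in>carrier A. P x \<longrightarrow> P y \<longrightarrow> P (x \<oplus>\<^bsub>A\<^esub> y) \<and> P (x \<otimes>\<^bsub>A\<^esub> y)) \<longrightarrow>
        (\<forall>x\<in>carrier A. P x \<longrightarrow> P (star A x) \<and> (\<forall>c. P (c \<odot>\<^bsub>A\<^esub> x))) \<longrightarrow>
        (\<forall>s x. cstar_algebra.converges A s x \<longrightarrow> (\<forall>n. P (s n)) \<longrightarrow> P x) \<longrightarrow>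
        (\<forall>x\<in>carrier A. P x))"

lemma generates_induct [consumes 2, case_names base one add mult scale star limit]:
  assumes "generates A S" "x \<in> carrier A"
    and "\<And>x. x \<in> S \<Longrightarrow> P x"
    and "P \<one>\<^bsub>A\<^esub>"
    and "\<And>x y. x \<in> carrier A \<Longrightarrow> y \<in> carrier A \<Longrightarrow> P x \<Longrightarrow> P y \<Longrightarrow> P (x \<oplus>\<^bsub>A\<^esub> y)"
    and "\<And>x y. x \<in> carrier A \<Longrightarrow> y \<in> carrier A \<Longrightarrow> P x \<Longrightarrow> P y \<Longrightarrow> P (x \<otimes>\<^bsub>A\<^esub> y)"
    and "\<And>x c. x \<in> carrier A \<Longrightarrow> P x \<Longrightarrow> P (c \<odot>\<^bsub>A\<^esub> x)"
    and "\<And>x. x \<in> carrier A \<Longrightarrow> P x \<Longrightarrow> P (star A x)"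
    and "\<And>s x. cstar_algebra.converges A s x \<Longrightarrow> (\<And>n. P (s n)) \<Longrightarrow> P x"
  shows "P x"
proof -
  have "(\<forall>x\<in>S. P x) \<longrightarrow> P \<one>\<^bsub>A\<^esub> \<longrightarrow>
        (\<forall>x\<in>carrier A. \<forall>y\<in>carrier A. P x \<longrightarrow> P y \<longrightarrow> P (x \<oplus>\<^bsub>A\<^esub> y) \<and> P (x \<otimes>\<^bsub>A\<^esub> y)) \<longrightarrow>
        (\<forall>x\<in>carrier A. P x \<longrightarrow> P (star A x) \<and> (\<forall>c. P (c \<odot>\<^bsub>A\<^esub> x))) \<longrightarrow>
        (\<forall>s x. cstar_algebra.converges A s x \<longrightarrow> (\<forall>n. P (s n)) \<longrightarrow> P x) \<longrightarrow>
        (\<forall>x\<in>carrier A. P x)"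
    using assms(1) unfolding generates_def by (elim conjE allE)
  then show ?thesis using assms(2-) by blast
qed

lemma generates_subset: "generates A S \<Longrightarrow> S \<subseteq> carrier A"
  by (simp add: generates_def)

lemma generatesI:
  assumes "S \<subseteq> carrier A"
    and "\<And>P x. (\<And>x. x \<in> S \<Longrightarrow> P x) \<Longrightarrow> P \<one>\<^bsub>A\<^esub> \<Longrightarrow>
      (\<And>x y. x \<in> carrier A \<Longrightarrow> y \<in> carrier A \<Longrightarrow> P x \<Longrightarrow> P y \<Longrightarrow> P (x \<oplus>\<^bsub>A\<^esub> y)) \<Longrightarrow>
      (\<And>x y. x \<in> carrier A \<Longrightarrow> y \<in> carrier A \<Longrightarrow> P x \<Longrightarrow> P y \<Longrightarrow> P (x \<otimes>\<^bsub>A\<^esub> y)) \<Longrightarrow>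
      (\<And>x c. x \<in> carrier A \<Longrightarrow> P x \<Longrightarrow> P (c \<odot>\<^bsub>A\<^esub> x)) \<Longrightarrow>
      (\<And>x. x \<in> carrier A \<Longrightarrow> P x \<Longrightarrow> P (star A x)) \<Longrightarrow>
      (\<And>s x. cstar_algebra.converges A s x \<Longrightarrow> (\<And>n. P (s n)) \<Longrightarrow> P x) \<Longrightarrow>
      x \<in> carrier A \<Longrightarrow> P x"
  shows "generates A S"
  unfolding generates_def
proof (intro conjI allI impI ballI)
  fix P x
  assume "\<forall>x\<in>S. P x" "P \<one>\<^bsub>A\<^esub>"
    "\<forall>x\<in>carrier A. \<forall>y\<in>carrier A. P x \<longrightarrow> P y \<longrightarrow> P (x \<oplus>\<^bsub>A\<^esub> y) \<and> P (x \<otimes>\<^bsub>A\<^esub> y)"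
    "\<forall>x\<in>carrier A. P x \<longrightarrow> P (star A x) \<and> (\<forall>c. P (c \<odot>\<^bsub>A\<^esub> x))"
    "\<forall>s x. cstar_algebra.converges A s x \<longrightarrow> (\<forall>n. P (s n)) \<longrightarrow> P x" "x \<in> carrier A"
  then show "P x" by - (rule assms(2)[of P x]; blast)
qed (rule assms(1))

text \<open>Contractive maps preserve limits, so agreement passes through the limit clause of
  \<open>generates\<close> as well as through the algebraic ones.\<close>

lemma hom_eq_on_generators:
  assumes A: "cstar_algebra A" and B: "cstar_algebra B"
    and f: "star_hom A B f" and g: "star_hom A B g"
    and gen: "generates A S" and eq: "\<And>x. x \<in> S \<Longrightarrow> f x = g x" and x: "x \<in> carrier A"
  shows "f x = g x"
proof -
  interpret f: cstar_map A B f using A B f by (rule cstar_mapI)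
  interpret g: cstar_map A B g using A B g by (rule cstar_mapI)
  show ?thesis using gen x
  proof (induction rule: generates_induct)
    case (limit s x)
    then show ?case using f.converges[of s x] g.converges[of s x] f.B.converges_unique by simp
  qed (simp_all add: eq)
qed

text \<open>Adjoints exchange commutation with \<open>y\<close> and commutation with
  \<open>star B y\<close>, so the induction has to carry both; this is why both are assumed on
  generators.\<close>

lemma commute_on_generators:
  assumes A: "cstar_algebra A" and B: "cstar_algebra B" and f: "star_hom A B f"
    and gen: "generates A S" and y: "y \<in> carrier B"
    and eq: "\<And>x. x \<in> S \<Longrightarrow> f x \<otimes>\<^bsub>B\<^esub> y = y \<otimes>\<^bsub>B\<^esub> f x"
    and eq': "\<And>x. x \<in> S \<Longrightarrow> f x \<otimes>\<^bsub>B\<^esub> star B y = star B y \<otimes>\<^bsub>B\<^esub> f x"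
    and x: "x \<in> carrier A"
  shows "f x \<otimes>\<^bsub>B\<^esub> y = y \<otimes>\<^bsub>B\<^esub> f x"
proof -
  interpret f: cstar_map A B f using A B f by (rule cstar_mapI)
  have "\<forall>y\<in>{y, star B y}. f x \<otimes>\<^bsub>B\<^esub> y = y \<otimes>\<^bsub>B\<^esub> f x" using gen x
  proof (induction rule: generates_induct)
    case (base x)
    then show ?case by (simp add: eq eq')
  next
    case (mult x1 x2)
    then show ?case using y by (auto simp: f.B.m_assoc) (metis f.B.m_assoc f.closed f.B.adj_closed)+
  next
    case (star x)
    have *: "star B (f x) \<otimes>\<^bsub>B\<^esub> z = z \<otimes>\<^bsub>B\<^esub> star B (f x)"
      if "star B z \<otimes>\<^bsub>B\<^esub> f x = f x \<otimes>\<^bsub>B\<^esub> star B z" "z \<in> carrier B" for z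
      using arg_cong[OF that(1), of "star B"] that(2) star(1) by (simp add: f.B.adj_mult)
    from star show ?case using y by (auto intro!: *)
  next
    case (limit s x)
    show ?case
    proof
      fix z assume z: "z \<in> {y, star B y}"
      then have zc: "z \<in> carrier B" using y by auto
      have "f.B.converges (\<lambda>n. f (s n) \<otimes>\<^bsub>B\<^esub> z) (f x \<otimes>\<^bsub>B\<^esub> z)"
        and "f.B.converges (\<lambda>n. z \<otimes>\<^bsub>B\<^esub> f (s n)) (z \<otimes>\<^bsub>B\<^esub> f x)"
        by (intro f.B.converges_mult f.converges limit(1) f.B.converges_const zc)+
      moreover have "(\<lambda>n. f (s n) \<otimes>\<^bsub>B\<^esub> z) = (\<lambda>n. z \<otimes>\<^bsub>B\<^esub> f (s n))" using limit(2) z by auto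
      ultimately show "f x \<otimes>\<^bsub>B\<^esub> z = z \<otimes>\<^bsub>B\<^esub> f x" using f.B.converges_unique by metis
    qed
  qed (use y in \<open>auto simp: f.B.l_distr f.B.r_distr\<close>)
  then show ?thesis by simp
qed

text \<open>The algebraic counterpart of \<open>generates\<close>, with no limits taken; it supplies
  the dense subalgebra in the antipode axiom.\<close>

inductive_set star_span :: "('a, 'm) star_alg_scheme \<Rightarrow> 'a set \<Rightarrow> 'a set" for A S where
  base: "x \<in> S \<Longrightarrow> x \<in> star_span A S"
| one: "\<one>\<^bsub>A\<^esub> \<in> star_span A S"
| add: "x \<in> star_span A S \<Longrightarrow> y \<in> star_span A S \<Longrightarrow> x \<oplus>\<^bsub>A\<^esub> y \<in> star_span A S"
| mult: "x \<in> star_span A S \<Longrightarrow> y \<in> star_span A S \<Longrightarrow> x \<otimes>\<^bsub>A\<^esub> y \<in> star_span A S"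
| scale: "x \<in> star_span A S \<Longrightarrow> c \<odot>\<^bsub>A\<^esub> x \<in> star_span A S"
| star: "x \<in> star_span A S \<Longrightarrow> star A x \<in> star_span A S"

context cstar_algebra begin

lemma star_span_closed: "S \<subseteq> carrier A \<Longrightarrow> x \<in> star_span A S \<Longrightarrow> x \<in> carrier A"
  by (rotate_tac, induction rule: star_span.induct) auto

lemma star_subalgebra_star_span:
  assumes "S \<subseteq> carrier A" shows "star_subalgebra (star_span A S) A"
proof -
  have "subring (star_span A S) A"
  proof (rule subringI)
    fix x assume x: "x \<in> star_span A S"
    then have "x \<in> carrier A" using assms star_span_closed by blast
    then show "\<ominus> x \<in> star_span A S" using x by (simp add: neg_eq star_span.scale)
  qed (use assms star_span_closed in \<open>auto intro: star_span.intros\<close>)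
  then show ?thesis by (auto simp: star_subalgebra_def intro: star_span.intros)
qed

lemma limit_of_span:
  assumes D: "D \<subseteq> carrier A" and x: "x \<in> carrier A" and near: "\<And>e. e > 0 \<Longrightarrow> \<exists>d\<in>D. nrm A (x \<ominus> d) < e"
  obtains s where "\<And>n. s n \<in> D" "converges s x"
proof -
  have "\<forall>n. \<exists>d\<in>D. nrm A (x \<ominus> d) < inverse (real (Suc n))" using near by simp
  then obtain s where s: "\<And>n. s n \<in> D" "\<And>n. nrm A (x \<ominus> s n) < inverse (real (Suc n))" by metis
  have "converges s x"
  proof (rule converges_dominated[OF _ x _ LIMSEQ_inverse_real_of_nat])
    fix n
    show c: "s n \<in> carrier A" using s(1) D by blast
    show "nrm A (s n \<ominus> x) \<le> inverse (real (Suc n))"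
      using s(2)[of n] norm.p_diff_commute[OF x c] by simp
  qed
  then show ?thesis using s that by blast
qed

lemma near_limit:
  assumes "converges s x" "\<And>n. s n \<in> D" "e > 0" shows "\<exists>d\<in>D. nrm A (x \<ominus> d) < e"
proof -
  note C = convergesD[OF assms(1)]
  obtain n where "nrm A (s n \<ominus> x) < e"
    using LIMSEQ_D[OF C(3) assms(3)] C by (auto simp: nrm_nonneg abs_of_nonneg)
  then show ?thesis using assms(2) norm.p_diff_commute C by metis
qed

text \<open>Nearness to the span is stable under the operations because approximating sequences for
  the arguments, combined termwise, stay in the span.\<close>

lemma dense_star_span:
  assumes "generates A S" shows "dense_in (star_span A S) A"
proof -
  have sub: "S \<subseteq> carrier A" by (rule generates_subset[OF assms])
  let ?D = "star_span A S"
  have D: "?D \<subseteq> carrier A" using star_span_closed[OF sub] by blast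
  have "\<forall>e>0. \<exists>d\<in>?D. nrm A (x \<ominus> d) < e" if "x \<in> carrier A" for x
    using assms that
  proof (induction rule: generates_induct)
    case (base x)
    then show ?case using sub by (auto intro!: bexI[of _ x] star_span.base simp: subset_iff)
  next
    case one
    then show ?case by (auto intro!: bexI[of _ \<one>] star_span.one)
  next
    case (add x y)
    obtain s t where "\<And>n. s n \<in> ?D" "converges s x" "\<And>n. t n \<in> ?D" "converges t y"
      using limit_of_span[OF D] add by metis
    then show ?case using near_limit[OF converges_add, where D = ?D] star_span.add by metis
  next
    case (mult x y)
    obtain s t where "\<And>n. s n \<in> ?D" "converges s x" "\<And>n. t n \<in> ?D" "converges t y"
      using limit_of_span[OF D] mult by metis
    then show ?case using near_limit[OF converges_mult, where D = ?D] star_span.mult by metis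
  next
    case (scale x c)
    obtain s where "\<And>n. s n \<in> ?D" "converges s x"
      using limit_of_span[OF D] scale by metis
    then show ?case using near_limit[OF converges_scale, where D = ?D] star_span.scale by metis
  next
    case (star x)
    obtain s where "\<And>n. s n \<in> ?D" "converges s x"
      using limit_of_span[OF D] star by metis
    then show ?case using near_limit[OF converges_star, where D = ?D] star_span.star by metis
  next
    case (limit s x)
    note C = convergesD[OF limit(1)]
    show ?case
    proof (intro allI impI)
      fix e :: real assume e: "e > 0"
      obtain n where n: "nrm A (x \<ominus> s n) < e / 2"
        using near_limit[OF limit(1), of "range s" "e / 2"] e by auto
      obtain d where d: "d \<in> ?D" "nrm A (s n \<ominus> d) < e / 2"
        using limit(2)[of n] e by (meson half_gt_zero)
      have "nrm A (x \<ominus> d) \<le> nrm A (x \<ominus> s n) + nrm A (s n \<ominus> d)"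
        using C d D by (intro norm.p_triangle) auto
      then show "\<exists>d\<in>?D. nrm A (x \<ominus> d) < e" using n d by (intro bexI[of _ d]) auto
    qed
  qed
  then show ?thesis using D by (simp add: dense_in_def)
qed

end

section \<open>Free star algebras\<close>

abbreviation flip_word :: "('g \<times> bool) list \<Rightarrow> ('g \<times> bool) list" where
  "flip_word w \<equiv> rev (map (\<lambda>(g, b). (g, \<not> b)) w)"

lemma flip_word_flip_word [simp]: "flip_word (flip_word w) = w"
  by (simp add: rev_map case_prod_beta comp_def)

lemma fst_set_flip_word [simp]: "fst ` set (flip_word w) = fst ` set w"
  by (force simp: image_image case_prod_beta)

lemma flip_word_eq_iff: "flip_word v = w \<longleftrightarrow> v = flip_word w"
  by (metis flip_word_flip_word)

definition monomial :: "('g \<times> bool) list \<Rightarrow> 'g star_poly" where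
  "monomial w = (\<lambda>v. of_bool (v = w))"

lemma gen_eq_monomial: "gen g = monomial [(g, False)]"
  by (simp add: gen_def monomial_def)

lemma free_carrier_iff:
  "f \<in> carrier (free_star_alg G) \<longleftrightarrow> finite {w. f w \<noteq> 0} \<and> (\<forall>w. f w \<noteq> 0 \<longrightarrow> fst ` set w \<subseteq> G)"
  by (simp add: free_star_alg_def)

lemma free_mult_support:
  assumes "(f \<otimes>\<^bsub>free_star_alg G\<^esub> g) w \<noteq> 0"
  obtains u v where "w = u @ v" "f u \<noteq> 0" "g v \<noteq> 0"
proof -
  obtain k where "f (take k w) * g (drop k w) \<noteq> 0"
    using assms by (auto simp: free_star_alg_def elim: sum.not_neutral_contains_not_neutral)
  then show ?thesis using that[of "take k w" "drop k w"] by auto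
qed

lemma free_mult_closed:
  assumes f: "f \<in> carrier (free_star_alg G)" and g: "g \<in> carrier (free_star_alg G)"
  shows "f \<otimes>\<^bsub>free_star_alg G\<^esub> g \<in> carrier (free_star_alg G)"
  unfolding free_carrier_iff
proof (intro conjI allI impI)
  have "{w. (f \<otimes>\<^bsub>free_star_alg G\<^esub> g) w \<noteq> 0} \<subseteq> (\<lambda>(u, v). u @ v) ` ({u. f u \<noteq> 0} \<times> {v. g v \<noteq> 0})"
    by (auto elim!: free_mult_support)
  then show "finite {w. (f \<otimes>\<^bsub>free_star_alg G\<^esub> g) w \<noteq> 0}"
    by (rule finite_subset) (use f g in \<open>auto simp: free_carrier_iff\<close>)
next
  fix w assume "(f \<otimes>\<^bsub>free_star_alg G\<^esub> g) w \<noteq> 0"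
  then show "fst ` set w \<subseteq> G"
    using f g by (elim free_mult_support) (auto simp: free_carrier_iff image_Un)
qed

lemma free_mult_assoc:
  "(f \<otimes>\<^bsub>free_star_alg G\<^esub> g) \<otimes>\<^bsub>free_star_alg G\<^esub> h = f \<otimes>\<^bsub>free_star_alg G\<^esub> (g \<otimes>\<^bsub>free_star_alg G\<^esub> h)"
proof
  fix w :: "('a \<times> bool) list"
  define n where "n = length w"
  \<comment> \<open>The summand for cutting \<open>w\<close> into pieces of lengths
    \<open>i\<close>, \<open>d\<close> and the rest; \<open>c\<close> is there to match
    \<open>fps_mult_assoc_lemma\<close>, the associativity of the Cauchy product.\<close>
  define F where "F i d c = f (take i w) * g (take d (drop i w)) * h (drop (i + d) w)" for i d and c :: nat
  have "((f \<otimes>\<^bsub>free_star_alg G\<^esub> g) \<otimes>\<^bsub>free_star_alg G\<^esub> h) w = (\<Sum>k=0..n. \<Sum>i=0..k. F i (k - i) (n - k))"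
    unfolding free_star_alg_def
    by (auto simp: n_def F_def sum_distrib_right atMost_atLeast0 min.absorb2 take_drop mult.assoc intro!: sum.cong)
  also have "\<dots> = (\<Sum>k=0..n. \<Sum>i=0..n - k. F k i (n - k - i))"
    by (rule fps_mult_assoc_lemma)
  also have "\<dots> = (f \<otimes>\<^bsub>free_star_alg G\<^esub> (g \<otimes>\<^bsub>free_star_alg G\<^esub> h)) w"
    unfolding free_star_alg_def
    by (auto simp: n_def F_def sum_distrib_left atMost_atLeast0 mult.assoc add.commute intro!: sum.cong)
  finally show "((f \<otimes>\<^bsub>free_star_alg G\<^esub> g) \<otimes>\<^bsub>free_star_alg G\<^esub> h) w = \<dots>" .
qed

lemma monomial_closed [simp, intro]: "fst ` set w \<subseteq> G \<Longrightarrow> monomial w \<in> carrier (free_star_alg G)"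
  by (auto simp: free_carrier_iff monomial_def of_bool_def split: if_splits)

lemma gen_closed [simp, intro]: "g \<in> G \<Longrightarrow> gen g \<in> carrier (free_star_alg G)"
  by (simp add: gen_eq_monomial)

lemma free_one: "\<one>\<^bsub>free_star_alg G\<^esub> = monomial []"
  by (simp add: free_star_alg_def monomial_def)

lemma free_one_mult: "monomial [] \<otimes>\<^bsub>free_star_alg G\<^esub> f = f"
proof
  fix w :: "('a \<times> bool) list"
  have "(monomial [] \<otimes>\<^bsub>free_star_alg G\<^esub> f) w = (\<Sum>k\<le>length w. of_bool (take k w = []) * f (drop k w))"
    by (simp add: free_star_alg_def monomial_def)
  also have "\<dots> = (\<Sum>k\<le>length w. if k = 0 then f w else 0)"
    by (rule sum.cong) (auto simp: of_bool_def)
  finally show "(monomial [] \<otimes>\<^bsub>free_star_alg G\<^esub> f) w = f w" by simp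
qed

lemma free_mult_one: "f \<otimes>\<^bsub>free_star_alg G\<^esub> monomial [] = f"
proof
  fix w :: "('a \<times> bool) list"
  have "(f \<otimes>\<^bsub>free_star_alg G\<^esub> monomial []) w = (\<Sum>k\<le>length w. f (take k w) * of_bool (drop k w = []))"
    by (simp add: free_star_alg_def monomial_def)
  also have "\<dots> = (\<Sum>k\<le>length w. if k = length w then f w else 0)"
    by (rule sum.cong) (auto simp: of_bool_def)
  finally show "(f \<otimes>\<^bsub>free_star_alg G\<^esub> monomial []) w = f w" by simp
qed

lemma free_star_mult:
  "star (free_star_alg G) (f \<otimes>\<^bsub>free_star_alg G\<^esub> g) =
    star (free_star_alg G) g \<otimes>\<^bsub>free_star_alg G\<^esub> star (free_star_alg G) f"
proof
  fix w :: "('a \<times> bool) list"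
  \<comment> \<open>Flipping a word exchanges prefixes and suffixes, hence the substitution of
    \<open>length w - k\<close> for \<open>k\<close>.\<close>
  have "(\<Sum>k\<le>length w. cnj (f (take k (flip_word w))) * cnj (g (drop k (flip_word w)))) =
     (\<Sum>k\<le>length w. cnj (g (flip_word (take k w))) * cnj (f (flip_word (drop k w))))"
    by (rule sum.reindex_bij_witness[of _ "\<lambda>k. length w - k" "\<lambda>k. length w - k"])
      (auto simp: take_rev drop_rev take_map drop_map rev_map mult.commute)
  then show "star (free_star_alg G) (f \<otimes>\<^bsub>free_star_alg G\<^esub> g) w =
    (star (free_star_alg G) g \<otimes>\<^bsub>free_star_alg G\<^esub> star (free_star_alg G) f) w"
    by (simp add: free_star_alg_def)
qed

lemma free_star_closed:
  assumes "f \<in> carrier (free_star_alg G)" shows "star (free_star_alg G) f \<in> carrier (free_star_alg G)"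
proof -
  have "{w. f (flip_word w) \<noteq> 0} \<subseteq> flip_word ` {w. f w \<noteq> 0}"
    by (auto simp: image_iff intro!: exI[of _ "flip_word _"])
  then have "finite {w. f (flip_word w) \<noteq> 0}"
    by (rule finite_subset) (use assms in \<open>auto simp: free_carrier_iff\<close>)
  moreover have "fst ` set w \<subseteq> G" if "f (flip_word w) \<noteq> 0" for w
    using assms that fst_set_flip_word[of w] unfolding free_carrier_iff by metis
  ultimately show ?thesis by (simp add: free_star_alg_def)
qed

lemma free_add_closed:
  assumes "f \<in> carrier (free_star_alg G)" "g \<in> carrier (free_star_alg G)"
  shows "f \<oplus>\<^bsub>free_star_alg G\<^esub> g \<in> carrier (free_star_alg G)"
proof -
  have "{w. f w + g w \<noteq> 0} \<subseteq> {w. f w \<noteq> 0} \<union> {w. g w \<noteq> 0}" by auto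
  then have "finite {w. f w + g w \<noteq> 0}"
    by (rule finite_subset) (use assms in \<open>auto simp: free_carrier_iff\<close>)
  moreover have "fst ` set w \<subseteq> G" if "f w + g w \<noteq> 0" for w
    using assms that unfolding free_carrier_iff by (metis add.right_neutral)
  ultimately show ?thesis by (simp add: free_star_alg_def)
qed

lemma free_scale_closed:
  "f \<in> carrier (free_star_alg G) \<Longrightarrow> c \<odot>\<^bsub>free_star_alg G\<^esub> f \<in> carrier (free_star_alg G)"
  by (auto simp: free_star_alg_def elim: rev_finite_subset)

lemma free_star_algebra: "star_algebra (free_star_alg G)"
proof -
  let ?F = "free_star_alg G"
  have "ring ?F"
  proof (rule ringI)
    show "abelian_group ?F"
    proof (rule abelian_groupI)
      fix f assume "f \<in> carrier ?F"
      then show "\<exists>g\<in>carrier ?F. g \<oplus>\<^bsub>?F\<^esub> f = \<zero>\<^bsub>?F\<^esub>"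
        by (intro bexI[of _ "(-1) \<odot>\<^bsub>?F\<^esub> f"] free_scale_closed) (auto simp: free_star_alg_def)
    next
      fix f g assume "f \<in> carrier ?F" "g \<in> carrier ?F"
      then show "f \<oplus>\<^bsub>?F\<^esub> g \<in> carrier ?F" by (rule free_add_closed)
    qed (auto simp: free_star_alg_def algebra_simps)
    show "monoid ?F"
      by (rule monoidI) (simp_all add: free_mult_closed free_mult_assoc free_one free_one_mult free_mult_one)
  qed (auto simp: free_star_alg_def algebra_simps sum.distrib)
  then show ?thesis
    unfolding star_algebra_def star_algebra_axioms_def
    by (auto simp: free_scale_closed free_star_closed free_star_mult)
      (auto simp: free_star_alg_def algebra_simps sum_distrib_left)
qed

lemma monomial_mult: "monomial v \<otimes>\<^bsub>free_star_alg G\<^esub> monomial w = monomial (v @ w)"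
proof
  fix u :: "('a \<times> bool) list"
  have iff: "take k u = v \<and> drop k u = w \<longleftrightarrow> k = length v \<and> u = v @ w" if "k \<le> length u" for k
    using that by (metis append_take_drop_id append_eq_conv_conj length_take min.absorb2)
  have "(monomial v \<otimes>\<^bsub>free_star_alg G\<^esub> monomial w) u =
    (\<Sum>k\<le>length u. of_bool (take k u = v) * of_bool (drop k u = w))"
    by (simp add: free_star_alg_def monomial_def)
  also have "\<dots> = (\<Sum>k\<le>length u. if k = length v then of_bool (u = v @ w) else 0)"
    by (rule sum.cong) (use iff in \<open>auto simp flip: of_bool_conj\<close>)
  finally show "(monomial v \<otimes>\<^bsub>free_star_alg G\<^esub> monomial w) u = monomial (v @ w) u" by (auto simp: monomial_def)
qed

lemma monomial_star: "star (free_star_alg G) (monomial w) = monomial (flip_word w)"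
  by (auto simp: free_star_alg_def monomial_def flip_word_eq_iff)

lemma free_induct [consumes 1, case_names zero add]:
  assumes f: "f \<in> carrier (free_star_alg G)" and zero: "P \<zero>\<^bsub>free_star_alg G\<^esub>"
    and add: "\<And>c w f. f \<in> carrier (free_star_alg G) \<Longrightarrow> fst ` set w \<subseteq> G \<Longrightarrow> P f \<Longrightarrow>
      P (c \<odot>\<^bsub>free_star_alg G\<^esub> monomial w \<oplus>\<^bsub>free_star_alg G\<^esub> f)"
  shows "P f"
proof -
  have "finite S \<Longrightarrow> {w. f w \<noteq> 0} = S \<Longrightarrow> f \<in> carrier (free_star_alg G) \<Longrightarrow> P f" for S
  proof (induction S arbitrary: f rule: finite_induct)
    case empty
    then have "f = \<zero>\<^bsub>free_star_alg G\<^esub>" by (auto simp: free_star_alg_def)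
    then show ?case using zero by simp
  next
    case (insert w S)
    define g where "g = f(w := 0)"
    have supp: "{v. g v \<noteq> 0} = S" using insert by (auto simp: g_def)
    have g: "g \<in> carrier (free_star_alg G)"
      using insert.prems insert.hyps supp unfolding free_carrier_iff by (auto simp: g_def)
    have "fst ` set w \<subseteq> G" using insert.prems unfolding free_carrier_iff by auto
    moreover have "f = f w \<odot>\<^bsub>free_star_alg G\<^esub> monomial w \<oplus>\<^bsub>free_star_alg G\<^esub> g"
      by (auto simp: free_star_alg_def monomial_def g_def)
    ultimately show ?case using add[OF g _ insert.IH[OF supp g], of w "f w"] by simp
  qed
  then show ?thesis using f free_carrier_iff by blast
qed

lemma monomial_in_star_span: "fst ` set w \<subseteq> G \<Longrightarrow> monomial w \<in> star_span (free_star_alg G) (gen ` G)"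
proof (induction w)
  case Nil
  show ?case using star_span.one[of "free_star_alg G"] by (simp add: free_one)
next
  case (Cons l w)
  obtain g b where l: "l = (g, b)" by fastforce
  have g: "gen g \<in> star_span (free_star_alg G) (gen ` G)" using Cons l by (auto intro: star_span.base)
  have "monomial [l] \<in> star_span (free_star_alg G) (gen ` G)"
    using g star_span.star[OF g] by (cases b) (auto simp: l gen_eq_monomial monomial_star)
  then show ?case
    using star_span.mult[OF _ Cons.IH, of "monomial [l]"] Cons.prems by (simp add: monomial_mult)
qed

text \<open>Bounds on seminorms can thereby be shown by induction over the operations, starting from
  the generators.\<close>

lemma free_carrier_star_span:
  assumes "f \<in> carrier (free_star_alg G)" shows "f \<in> star_span (free_star_alg G) (gen ` G)"
proof -
  interpret F: star_algebra "free_star_alg G" by (rule free_star_algebra)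
  from assms show ?thesis
  proof (induction rule: free_induct)
    case zero
    show ?case using star_span.scale[OF star_span.one, where c = 0] F.scale_zero_left by (metis F.one_closed)
  qed (intro star_span.add star_span.scale monomial_in_star_span)
qed

section \<open>Evaluation of *-polynomials in a star algebra\<close>

locale free_eval = B: star_algebra B for G :: "'g set" and B :: "('b, 'n) star_alg_scheme" +
  fixes b :: "'g \<Rightarrow> 'b"
  assumes b_closed: "g \<in> G \<Longrightarrow> b g \<in> carrier B"
begin

abbreviation "F \<equiv> free_star_alg G"

sublocale F: star_algebra F by (rule free_star_algebra)

definition word_value :: "('g \<times> bool) list \<Rightarrow> 'b" where
  "word_value w = foldr (\<lambda>(g, s) x. (if s then star B (b g) else b g) \<otimes>\<^bsub>B\<^esub> x) w \<one>\<^bsub>B\<^esub>"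

definition eval_at :: "'g star_poly \<Rightarrow> 'b" where
  "eval_at f = (\<Oplus>\<^bsub>B\<^esub>w\<in>{w. f w \<noteq> 0}. f w \<odot>\<^bsub>B\<^esub> word_value w)"

lemma word_value_simps [simp]:
  "word_value [] = \<one>\<^bsub>B\<^esub>"
  "word_value ((g, s) # w) = (if s then star B (b g) else b g) \<otimes>\<^bsub>B\<^esub> word_value w"
  by (simp_all add: word_value_def)

lemma word_value_closed [simp, intro]: "fst ` set w \<subseteq> G \<Longrightarrow> word_value w \<in> carrier B"
  by (induction w) (auto simp: b_closed)

lemma word_value_append:
  "fst ` set v \<subseteq> G \<Longrightarrow> fst ` set w \<subseteq> G \<Longrightarrow> word_value (v @ w) = word_value v \<otimes>\<^bsub>B\<^esub> word_value w"
  by (induction v) (auto simp: b_closed B.m_assoc)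

lemma word_value_flip: "fst ` set w \<subseteq> G \<Longrightarrow> word_value (flip_word w) = star B (word_value w)"
proof (induction w)
  case (Cons l w)
  obtain g s where l: "l = (g, s)" by fastforce
  have g: "b g \<in> carrier B" using Cons.prems by (simp add: l b_closed)
  have "fst ` set (flip_word w) \<subseteq> G" using Cons.prems by (subst fst_set_flip_word) simp
  then have "word_value (flip_word (l # w)) = word_value (flip_word w) \<otimes>\<^bsub>B\<^esub> word_value [(g, \<not> s)]"
    using Cons.prems by (simp add: l word_value_append del: word_value_simps)
  then show ?case using Cons g by (simp add: l B.adj_mult)
qed simp

text \<open>Two polynomials can be evaluated over a common finite set of words, which allows
  termwise comparison.\<close>

lemma eval_superset:
  assumes "finite S" "{w. f w \<noteq> 0} \<subseteq> S" "\<And>w. w \<in> S \<Longrightarrow> fst ` set w \<subseteq> G"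
  shows "eval_at f = (\<Oplus>\<^bsub>B\<^esub>w\<in>S. f w \<odot>\<^bsub>B\<^esub> word_value w)"
  unfolding eval_at_def
  by (rule B.add.finprod_mono_neutral_cong_left) (use assms in auto)

lemma eval_add:
  assumes f: "f \<in> carrier F" and g: "g \<in> carrier F"
  shows "eval_at (f \<oplus>\<^bsub>F\<^esub> g) = eval_at f \<oplus>\<^bsub>B\<^esub> eval_at g"
proof -
  define S where "S = {w. f w \<noteq> 0} \<union> {w. g w \<noteq> 0}"
  have S: "finite S" "\<And>w. w \<in> S \<Longrightarrow> fst ` set w \<subseteq> G"
    using f g by (auto simp: S_def free_carrier_iff)
  have c: "word_value w \<in> carrier B" if "w \<in> S" for w using S that by auto
  have "eval_at (f \<oplus>\<^bsub>F\<^esub> g) = (\<Oplus>\<^bsub>B\<^esub>w\<in>S. (f w + g w) \<odot>\<^bsub>B\<^esub> word_value w)"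
    by (subst eval_superset[OF S(1) _ S(2)]) (auto simp: S_def free_star_alg_def)
  also have "\<dots> = (\<Oplus>\<^bsub>B\<^esub>w\<in>S. f w \<odot>\<^bsub>B\<^esub> word_value w \<oplus>\<^bsub>B\<^esub> g w \<odot>\<^bsub>B\<^esub> word_value w)"
    using c by (intro B.finsum_cong') (auto simp: B.scale_add_left)
  also have "\<dots> = (\<Oplus>\<^bsub>B\<^esub>w\<in>S. f w \<odot>\<^bsub>B\<^esub> word_value w) \<oplus>\<^bsub>B\<^esub> (\<Oplus>\<^bsub>B\<^esub>w\<in>S. g w \<odot>\<^bsub>B\<^esub> word_value w)"
    using c by (intro B.finsum_addf) auto
  also have "(\<Oplus>\<^bsub>B\<^esub>w\<in>S. f w \<odot>\<^bsub>B\<^esub> word_value w) = eval_at f"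
    by (rule eval_superset[OF S(1) _ S(2), symmetric]) (auto simp: S_def)
  also have "(\<Oplus>\<^bsub>B\<^esub>w\<in>S. g w \<odot>\<^bsub>B\<^esub> word_value w) = eval_at g"
    by (rule eval_superset[OF S(1) _ S(2), symmetric]) (auto simp: S_def)
  finally show ?thesis .
qed

lemma eval_scale:
  assumes f: "f \<in> carrier F"
  shows "eval_at (c \<odot>\<^bsub>F\<^esub> f) = c \<odot>\<^bsub>B\<^esub> eval_at f"
proof -
  define S where "S = {w. f w \<noteq> 0}"
  have S: "finite S" "\<And>w. w \<in> S \<Longrightarrow> fst ` set w \<subseteq> G"
    using f by (auto simp: S_def free_carrier_iff)
  have c: "word_value w \<in> carrier B" if "w \<in> S" for w using S that by auto
  have "eval_at (c \<odot>\<^bsub>F\<^esub> f) = (\<Oplus>\<^bsub>B\<^esub>w\<in>S. (c * f w) \<odot>\<^bsub>B\<^esub> word_value w)"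
    by (subst eval_superset[OF S(1) _ S(2)]) (auto simp: S_def free_star_alg_def)
  also have "\<dots> = (\<Oplus>\<^bsub>B\<^esub>w\<in>S. c \<odot>\<^bsub>B\<^esub> (f w \<odot>\<^bsub>B\<^esub> word_value w))"
    using c by (intro B.finsum_cong') auto
  also have "\<dots> = c \<odot>\<^bsub>B\<^esub> (\<Oplus>\<^bsub>B\<^esub>w\<in>S. f w \<odot>\<^bsub>B\<^esub> word_value w)"
    using c S by (intro B.scale_finsum[symmetric]) auto
  also have "(\<Oplus>\<^bsub>B\<^esub>w\<in>S. f w \<odot>\<^bsub>B\<^esub> word_value w) = eval_at f"
    by (rule eval_superset[OF S(1) _ S(2), symmetric]) (auto simp: S_def)
  finally show ?thesis .
qed

lemma eval_monomial: "fst ` set w \<subseteq> G \<Longrightarrow> eval_at (monomial w) = word_value w"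
  by (subst eval_superset[of "{w}"]) (auto simp: monomial_def)

lemma eval_zero: "eval_at \<zero>\<^bsub>F\<^esub> = \<zero>\<^bsub>B\<^esub>"
  by (simp add: eval_at_def free_star_alg_def)

lemma eval_closed [simp, intro]: "f \<in> carrier F \<Longrightarrow> eval_at f \<in> carrier B"
  by (auto simp: eval_at_def free_carrier_iff)

lemma eval_mult:
  assumes "f \<in> carrier F" "g \<in> carrier F"
  shows "eval_at (f \<otimes>\<^bsub>F\<^esub> g) = eval_at f \<otimes>\<^bsub>B\<^esub> eval_at g"
proof -
  \<comment> \<open>Multiplicativity is bilinear: one induction over \<open>g\<close> for a monomial
    on the left, then one over \<open>f\<close>, replace a computation with double sums.\<close>
  have monomial: "eval_at (monomial v \<otimes>\<^bsub>F\<^esub> g) = word_value v \<otimes>\<^bsub>B\<^esub> eval_at g"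
    if "fst ` set v \<subseteq> G" for v
    using assms(2) that
  proof (induction rule: free_induct)
    case (add c w f)
    then show ?case
      by (simp add: F.r_distr eval_add eval_scale monomial_mult eval_monomial image_Un word_value_append B.r_distr)
  qed (simp add: eval_zero)
  from assms show ?thesis
  proof (induction rule: free_induct)
    case (add c w f)
    then show ?case by (simp add: F.l_distr eval_add eval_scale monomial eval_monomial B.l_distr)
  qed (simp add: eval_zero)
qed

lemma eval_star:
  assumes "f \<in> carrier F" shows "eval_at (star F f) = star B (eval_at f)"
  using assms
proof (induction rule: free_induct)
  case (add c w f)
  have "fst ` set (flip_word w) \<subseteq> G" using add by (subst fst_set_flip_word)
  with add show ?case
    by (simp add: F.adj_add F.adj_scale monomial_star eval_add eval_scale eval_monomial word_value_flip B.adj_add B.adj_scale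
        del: rev_map)
qed (simp add: eval_zero)

lemma eval_hom: "star_hom F B eval_at"
  using eval_monomial[of "[]"]
  by (intro star_homI) (auto simp: eval_add eval_scale eval_mult eval_star free_one)

lemma eval_gen: "g \<in> G \<Longrightarrow> eval_at (gen g) = b g"
  by (simp add: gen_eq_monomial eval_monomial b_closed)

end

section \<open>Universal C*-algebras\<close>

definition admissible :: "'g set \<Rightarrow> ('g star_poly \<times> 'g star_poly) set \<Rightarrow> ('g star_poly \<Rightarrow> real) \<Rightarrow> bool" where
  "admissible G R p \<longleftrightarrow> cstar_seminorm (free_star_alg G) p \<and> (\<forall>(l, r)\<in>R. p (l \<ominus>\<^bsub>free_star_alg G\<^esub> r) = 0)"

text \<open>The supremum defining \<open>universal_seminorm\<close> carries information only when it
  is finite. A bound for each generator, uniform in the seminorm, suffices: \<open>bounded\<close>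
  spreads it to all elements.\<close>

locale bounded_relations =
  fixes G :: "'g set" and R :: "('g star_poly \<times> 'g star_poly) set"
  assumes relations_closed: "\<And>l r. (l, r) \<in> R \<Longrightarrow> l \<in> carrier (free_star_alg G) \<and> r \<in> carrier (free_star_alg G)"
    and generators_bounded: "\<And>g. g \<in> G \<Longrightarrow> \<exists>C. \<forall>p. admissible G R p \<longrightarrow> p (gen g) \<le> C"
begin

abbreviation "F \<equiv> free_star_alg G"
abbreviation "N \<equiv> universal_seminorm F R"
abbreviation "U \<equiv> universal_cstar G R"

sublocale F: star_algebra F by (rule free_star_algebra)

lemma admissible_seminorm: "admissible G R p \<Longrightarrow> star_seminorm F p"
  by unfold_locales (simp add: admissible_def)

text \<open>Keeps the set of seminorm values nonempty, so that its upper bounds bound the supremum;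
  it also shows that the supremum is nonnegative.\<close>

lemma admissible_zero: "admissible G R (\<lambda>x. 0)"
  by (auto simp: admissible_def cstar_seminorm_def)

lemma bounded: assumes "x \<in> carrier F" shows "\<exists>C. \<forall>p. admissible G R p \<longrightarrow> p x \<le> C"
proof -
  have "x \<in> star_span F (gen ` G)" using assms by (rule free_carrier_star_span)
  then have "x \<in> carrier F \<and> (\<exists>C. \<forall>p. admissible G R p \<longrightarrow> p x \<le> C)"
  proof induction
    case (base x)
    then show ?case using generators_bounded by auto
  next
    case one
    show ?case using star_seminorm.p_one_le[OF admissible_seminorm] by auto
  next
    case (add x y)
    then obtain C D where "\<forall>p. admissible G R p \<longrightarrow> p x \<le> C" "\<forall>p. admissible G R p \<longrightarrow> p y \<le> D" by blast
    then have "\<forall>p. admissible G R p \<longrightarrow> p (x \<oplus>\<^bsub>F\<^esub> y) \<le> C + D"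
      using add star_seminorm.p_add[OF admissible_seminorm] by (meson add_mono order_trans)
    then show ?case using add by auto
  next
    case (mult x y)
    then obtain C D where C: "\<forall>p. admissible G R p \<longrightarrow> p x \<le> C" and D: "\<forall>p. admissible G R p \<longrightarrow> p y \<le> D" by blast
    have "p (x \<otimes>\<^bsub>F\<^esub> y) \<le> \<bar>C\<bar> * \<bar>D\<bar>" if p: "admissible G R p" for p
    proof -
      interpret p: star_seminorm F p using p by (rule admissible_seminorm)
      have "p (x \<otimes>\<^bsub>F\<^esub> y) \<le> p x * p y" using mult by (intro p.p_mult) auto
      also have "\<dots> \<le> \<bar>C\<bar> * \<bar>D\<bar>"
        using C D p mult by (intro mult_mono) (auto intro: order_trans[OF _ abs_ge_self])
      finally show ?thesis .
    qed
    then show ?case using mult by auto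
  next
    case (scale x c)
    then obtain C where C: "\<forall>p. admissible G R p \<longrightarrow> p x \<le> C" by blast
    have "p (c \<odot>\<^bsub>F\<^esub> x) \<le> cmod c * C" if p: "admissible G R p" for p
      using C scale p star_seminorm.p_scale[OF admissible_seminorm[OF p], of x c]
      by (simp add: mult_left_mono)
    then show ?case using scale by auto
  next
    case (star x)
    then show ?case using star_seminorm.p_star[OF admissible_seminorm] by fastforce
  qed
  then show ?thesis by blast
qed

lemma N_def: "N x = Sup {p x | p. admissible G R p}"
  by (simp add: universal_seminorm_def admissible_def)

lemma admissible_le: assumes "admissible G R p" "x \<in> carrier F" shows "p x \<le> N x"
  unfolding N_def
proof (rule cSup_upper)
  obtain C where "\<forall>p. admissible G R p \<longrightarrow> p x \<le> C" using bounded[OF assms(2)] by blast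
  then show "bdd_above {p x | p. admissible G R p}" by (auto simp: bdd_above_def)
qed (use assms in auto)

lemma N_le: "(\<And>p. admissible G R p \<Longrightarrow> p x \<le> C) \<Longrightarrow> N x \<le> C"
  unfolding N_def using admissible_zero by (intro cSup_least) auto

lemma N_nonneg: "x \<in> carrier F \<Longrightarrow> 0 \<le> N x"
  using admissible_le[OF admissible_zero] by simp

lemma N_relation: assumes "(l, r) \<in> R" shows "N (l \<ominus>\<^bsub>F\<^esub> r) = 0"
proof (rule antisym)
  show "N (l \<ominus>\<^bsub>F\<^esub> r) \<le> 0" using assms by (intro N_le) (auto simp: admissible_def)
qed (use relations_closed[OF assms] in \<open>auto intro!: N_nonneg\<close>)

text \<open>Every clause is checked on admissible \<open>p\<close> and passed to the supremum. The
  lower half of the C*-identity bounds \<open>p x\<close> by a square root before the supremum is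
  taken, and the lower half of homogeneity comes from the upper half for the inverse scalar.\<close>

lemma N_seminorm: "cstar_seminorm F N"
  unfolding cstar_seminorm_def
proof (intro ballI conjI allI)
  fix x assume x: "x \<in> carrier F"
  show "0 \<le> N x" using x by (rule N_nonneg)
  show "N (star F x \<otimes>\<^bsub>F\<^esub> x) = (N x)\<^sup>2"
  proof (rule antisym)
    show "N (star F x \<otimes>\<^bsub>F\<^esub> x) \<le> (N x)\<^sup>2"
    proof (rule N_le)
      fix p assume p: "admissible G R p"
      interpret p: star_seminorm F p using p by (rule admissible_seminorm)
      show "p (star F x \<otimes>\<^bsub>F\<^esub> x) \<le> (N x)\<^sup>2"
        using x p by (simp add: p.p_star_mult admissible_le power_mono)
    qed
    have "N x \<le> sqrt (N (star F x \<otimes>\<^bsub>F\<^esub> x))"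
    proof (rule N_le)
      fix p assume p: "admissible G R p"
      interpret p: star_seminorm F p using p by (rule admissible_seminorm)
      have "(p x)\<^sup>2 \<le> N (star F x \<otimes>\<^bsub>F\<^esub> x)"
        using x admissible_le[OF p, of "star F x \<otimes>\<^bsub>F\<^esub> x"] by (simp add: p.p_star_mult)
      then show "p x \<le> sqrt (N (star F x \<otimes>\<^bsub>F\<^esub> x))" by (rule real_le_rsqrt)
    qed
    then show "(N x)\<^sup>2 \<le> N (star F x \<otimes>\<^bsub>F\<^esub> x)"
      using N_nonneg[OF x] N_nonneg[of "star F x \<otimes>\<^bsub>F\<^esub> x"] x by (simp add: sqrt_ge_absD)
  qed
  have le: "N (c \<odot>\<^bsub>F\<^esub> x) \<le> cmod c * N x" if "x \<in> carrier F" for c x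
  proof (rule N_le)
    fix p assume p: "admissible G R p"
    interpret p: star_seminorm F p using p by (rule admissible_seminorm)
    show "p (c \<odot>\<^bsub>F\<^esub> x) \<le> cmod c * N x"
      using that p by (simp add: p.p_scale admissible_le mult_left_mono)
  qed
  fix c
  show "N (c \<odot>\<^bsub>F\<^esub> x) = cmod c * N x"
  proof (cases "c = 0")
    case True
    then show ?thesis using le[OF x, of 0] N_nonneg[of "c \<odot>\<^bsub>F\<^esub> x"] x by simp
  next
    case False
    have "N x \<le> cmod (inverse c) * N (c \<odot>\<^bsub>F\<^esub> x)"
      using le[of "c \<odot>\<^bsub>F\<^esub> x" "inverse c"] x False by simp
    then have "cmod c * N x \<le> N (c \<odot>\<^bsub>F\<^esub> x)"
      using False unfolding norm_inverse by (simp add: field_simps)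
    then show ?thesis using le[OF x, of c] by simp
  qed
  fix y assume y: "y \<in> carrier F"
  show "N (x \<oplus>\<^bsub>F\<^esub> y) \<le> N x + N y"
  proof (rule N_le)
    fix p assume p: "admissible G R p"
    interpret p: star_seminorm F p using p by (rule admissible_seminorm)
    show "p (x \<oplus>\<^bsub>F\<^esub> y) \<le> N x + N y"
      using p.p_add[OF x y] admissible_le[OF p x] admissible_le[OF p y] by simp
  qed
  show "N (x \<otimes>\<^bsub>F\<^esub> y) \<le> N x * N y"
  proof (rule N_le)
    fix p assume p: "admissible G R p"
    interpret p: star_seminorm F p using p by (rule admissible_seminorm)
    have "p x * p y \<le> N x * N y"
      using x y p by (intro mult_mono admissible_le N_nonneg) auto
    then show "p (x \<otimes>\<^bsub>F\<^esub> y) \<le> N x * N y" using p.p_mult[OF x y] by simp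
  qed
qed

sublocale N: star_seminorm F N
  by unfold_locales (rule N_seminorm)

lemma U_cstar: "cstar_algebra U"
  unfolding universal_cstar_def by (rule N.completion_cstar_algebra)

sublocale U: cstar_algebra U by (rule U_cstar)

definition image :: "'g star_poly \<Rightarrow> 'g univ" where
  "image x = N.cls (\<lambda>n. x)"

lemma image_gen: "image (gen g) = universal_gen G R g"
  by (simp add: image_def universal_gen_def N.cls_def)

lemma image_hom: "star_hom F U image"
  by (rule star_homI) (simp_all add: image_def universal_cstar_def N.completion_one)

sublocale image: star_map F U image
  by unfold_locales (rule image_hom)

lemma image_relation: assumes "(l, r) \<in> R" shows "image l = image r"
  using relations_closed[OF assms] N_relation[OF assms]
  by (simp add: image_def N.cls_eq_iff)

text \<open>Gives each class an explicit approximating sequence from the free algebra, as the limit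
  clause of \<open>generates\<close> requires.\<close>

lemma image_converges: assumes s: "s \<in> N.cauchy" shows "U.converges (\<lambda>n. image (s n)) (N.cls s)"
  unfolding U.converges_def
proof (intro conjI allI)
  have sc: "s n \<in> carrier F" for n using s by (rule N.cauchy_carrier)
  show "image (s n) \<in> carrier U" for n using sc by auto
  show "N.cls s \<in> carrier U" using s by (auto simp: universal_cstar_def)
  show "(\<lambda>n. nrm U (image (s n) \<ominus>\<^bsub>U\<^esub> N.cls s)) \<longlonglongrightarrow> 0"
  proof (rule LIMSEQ_I)
    fix e :: real assume e: "e > 0"
    obtain M where M: "\<forall>m\<ge>M. \<forall>n\<ge>M. N (s m \<ominus>\<^bsub>F\<^esub> s n) < e / 2"
      using N.cauchyD[OF s, of "e / 2"] e by auto
    have "norm (nrm U (image (s k) \<ominus>\<^bsub>U\<^esub> N.cls s) - 0) < e" if "k \<ge> M" for k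
    proof -
      have c: "(\<lambda>n. s k \<ominus>\<^bsub>F\<^esub> s n) \<in> N.cauchy"
        using N.cauchy_add[OF N.cauchy_const[OF sc] N.cauchy_scale[OF s, of "-1"]] sc by (simp add: F.diff_eq)
      have eq: "image (s k) \<ominus>\<^bsub>U\<^esub> N.cls s = N.cls (\<lambda>n. s k \<ominus>\<^bsub>F\<^esub> s n)"
        using s sc by (simp add: image_def universal_cstar_def N.completion_diff)
      have "(\<lambda>n. N (s k \<ominus>\<^bsub>F\<^esub> s n)) \<longlonglongrightarrow> nrm U (image (s k) \<ominus>\<^bsub>U\<^esub> N.cls s)"
        unfolding eq using N.tendsto_completion_nrm[OF c] by (simp add: universal_cstar_def)
      then have "nrm U (image (s k) \<ominus>\<^bsub>U\<^esub> N.cls s) \<le> e / 2"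
        by (rule LIMSEQ_le_const2) (use M that in \<open>auto intro!: exI[of _ M] less_imp_le\<close>)
      moreover have "0 \<le> nrm U (image (s k) \<ominus>\<^bsub>U\<^esub> N.cls s)"
        using sc s by (intro U.nrm_nonneg U.minus_closed image.closed) (auto simp: universal_cstar_def)
      ultimately show ?thesis using e by simp
    qed
    then show "\<exists>M. \<forall>k\<ge>M. norm (nrm U (image (s k) \<ominus>\<^bsub>U\<^esub> N.cls s) - 0) < e" by blast
  qed
qed

lemma U_cases:
  assumes "x \<in> carrier U" obtains s where "s \<in> N.cauchy" "x = N.cls s"
  using assms N.completion_cases unfolding universal_cstar_def by blast

lemma U_generates: "generates U (universal_gen G R ` G)"
proof (rule generatesI)
  show "universal_gen G R ` G \<subseteq> carrier U" by (auto simp flip: image_gen)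
next
  fix P x
  assume base: "\<And>x. x \<in> universal_gen G R ` G \<Longrightarrow> P x" and one: "P \<one>\<^bsub>U\<^esub>"
    and add: "\<And>x y. x \<in> carrier U \<Longrightarrow> y \<in> carrier U \<Longrightarrow> P x \<Longrightarrow> P y \<Longrightarrow> P (x \<oplus>\<^bsub>U\<^esub> y)"
    and mult: "\<And>x y. x \<in> carrier U \<Longrightarrow> y \<in> carrier U \<Longrightarrow> P x \<Longrightarrow> P y \<Longrightarrow> P (x \<otimes>\<^bsub>U\<^esub> y)"
    and scale: "\<And>x c. x \<in> carrier U \<Longrightarrow> P x \<Longrightarrow> P (c \<odot>\<^bsub>U\<^esub> x)"
    and star: "\<And>x. x \<in> carrier U \<Longrightarrow> P x \<Longrightarrow> P (star U x)"
    and lim: "\<And>s x. U.converges s x \<Longrightarrow> (\<And>n. P (s n)) \<Longrightarrow> P x"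
    and x: "x \<in> carrier U"
  have im: "x \<in> carrier F \<and> P (image x)" if "x \<in> star_span F (gen ` G)" for x
    using that
  proof induction
    case (base x)
    then show ?case using \<open>\<And>x. x \<in> universal_gen G R ` G \<Longrightarrow> P x\<close> by (auto simp: image_gen)
  qed (auto intro: one add mult scale star)
  obtain s where s: "s \<in> N.cauchy" "x = N.cls s" using x by (rule U_cases)
  show "P x" unfolding s(2)
    by (rule lim[OF image_converges[OF s(1)]])
      (use im s(1) N.cauchy_carrier free_carrier_star_span in blast)
qed

text \<open>The norm of \<open>B\<close> pulled back along \<open>e\<close> is admissible, so
  \<open>e\<close> is bounded by the universal seminorm and extends by continuity to the
  completion.\<close>

theorem universal_property:
  assumes B: "cstar_algebra B" and e: "star_hom F B e" and R: "\<And>l r. (l, r) \<in> R \<Longrightarrow> e l = e r"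
  obtains f where "star_hom U B f" "\<And>x. x \<in> carrier F \<Longrightarrow> f (image x) = e x"
proof -
  interpret B: cstar_algebra B by (rule B)
  interpret e: star_map F B e by unfold_locales (rule e)
  have "admissible G R (\<lambda>x. nrm B (e x))"
    using e.seminorm_comp[OF B.norm.seminorm] R relations_closed
    by (auto simp: admissible_def)
  then have le: "nrm B (e x) \<le> N x" if "x \<in> carrier F" for x
    using that by (rule admissible_le)
  have sc: "s n \<in> carrier F" if "s \<in> N.cauchy" for s n using that by (rule N.cauchy_carrier)
  have ex: "\<exists>y. B.converges (\<lambda>n. e (s n)) y" if s: "s \<in> N.cauchy" for s
  proof -
    have "(\<lambda>n. e (s n)) \<in> B.norm.cauchy"
    proof (rule B.norm.cauchyI)
      fix d :: real assume "d > 0"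
      then obtain M where M: "\<And>m n. m \<ge> M \<Longrightarrow> n \<ge> M \<Longrightarrow> N (s m \<ominus>\<^bsub>F\<^esub> s n) < d"
        using N.cauchyD[OF s] by meson
      have "nrm B (e (s m) \<ominus>\<^bsub>B\<^esub> e (s n)) \<le> N (s m \<ominus>\<^bsub>F\<^esub> s n)" for m n
        using le[of "s m \<ominus>\<^bsub>F\<^esub> s n"] sc[OF s] by simp
      then show "\<exists>M. \<forall>m\<ge>M. \<forall>n\<ge>M. nrm B (e (s m) \<ominus>\<^bsub>B\<^esub> e (s n)) < d"
        using M by (meson order_le_less_trans)
    qed (use sc[OF s] in auto)
    then show ?thesis using B.cauchy_converges by metis
  qed
  define f where "f x = (SOME y. \<exists>s\<in>N.cauchy. x = N.cls s \<and> B.converges (\<lambda>n. e (s n)) y)" for x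
  \<comment> \<open>Equivalent sequences have images whose difference tends to zero, so the value
    does not depend on the representative chosen in \<open>f_def\<close>.\<close>
  have f: "f (N.cls s) = y" if s: "s \<in> N.cauchy" and y: "B.converges (\<lambda>n. e (s n)) y" for s y
    unfolding f_def
  proof (rule some_equality)
    fix z assume "\<exists>t\<in>N.cauchy. N.cls s = N.cls t \<and> B.converges (\<lambda>n. e (t n)) z"
    then obtain t where t: "t \<in> N.cauchy" "N.cls s = N.cls t" and z: "B.converges (\<lambda>n. e (t n)) z" by blast
    have "(\<lambda>n. N (s n \<ominus>\<^bsub>F\<^esub> t n)) \<longlonglongrightarrow> 0" using s t by (simp add: N.cls_eq_iff)
    moreover have "nrm B ((e (s n) \<ominus>\<^bsub>B\<^esub> e (t n)) \<ominus>\<^bsub>B\<^esub> \<zero>\<^bsub>B\<^esub>) \<le> N (s n \<ominus>\<^bsub>F\<^esub> t n)" for n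
      using le[of "s n \<ominus>\<^bsub>F\<^esub> t n"] sc[OF s] sc[OF t(1)] by (simp add: B.minus_eq)
    ultimately have "B.converges (\<lambda>n. e (s n) \<ominus>\<^bsub>B\<^esub> e (t n)) \<zero>\<^bsub>B\<^esub>"
      by (intro B.converges_dominated[where f = "\<lambda>n. N (s n \<ominus>\<^bsub>F\<^esub> t n)"])
        (use sc[OF s] sc[OF t(1)] in auto)
    moreover have "B.converges (\<lambda>n. e (s n) \<ominus>\<^bsub>B\<^esub> e (t n)) (y \<ominus>\<^bsub>B\<^esub> z)"
      using B.converges_add[OF y B.converges_scale[OF z, of "-1"]] sc[OF s] sc[OF t(1)]
        B.convergesD(2)[OF y] B.convergesD(2)[OF z] by (simp add: B.diff_eq)
    ultimately have "y \<ominus>\<^bsub>B\<^esub> z = \<zero>\<^bsub>B\<^esub>" using B.converges_unique by blast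
    then show "z = y"
      using B.convergesD(2)[OF y] B.convergesD(2)[OF z] B.diff_eq_zero_iff by metis
  qed (use s y in blast)
  have f_lim: "B.converges (\<lambda>n. e (s n)) (f (N.cls s))" if "s \<in> N.cauchy" for s
  proof -
    obtain y where y: "B.converges (\<lambda>n. e (s n)) y" using ex[OF \<open>s \<in> N.cauchy\<close>] by blast
    show ?thesis using y unfolding f[OF \<open>s \<in> N.cauchy\<close> y] .
  qed
  have fim: "f (image x) = e x" if "x \<in> carrier F" for x
    unfolding image_def using that by (intro f) auto
  have "star_hom U B f"
  proof (rule star_homI)
    fix x assume "x \<in> carrier U"
    then obtain s where s: "s \<in> N.cauchy" "x = N.cls s" by (rule U_cases)
    note S = sc[OF s(1)] f_lim[OF s(1)]
    show "f x \<in> carrier B" using S(2) s by (auto dest: B.convergesD)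
    show "f (c \<odot>\<^bsub>U\<^esub> x) = c \<odot>\<^bsub>B\<^esub> f x" for c
      unfolding s(2) universal_cstar_def N.completion_scale[OF s(1)]
      using B.converges_scale[OF S(2), of c] S(1) by (intro f N.cauchy_scale s(1)) simp
    show "f (star U x) = star B (f x)"
      unfolding s(2) universal_cstar_def N.completion_star[OF s(1)]
      using B.converges_star[OF S(2)] S(1) by (intro f N.cauchy_star s(1)) simp
    fix y assume "y \<in> carrier U"
    then obtain t where t: "t \<in> N.cauchy" "y = N.cls t" by (rule U_cases)
    note T = sc[OF t(1)] f_lim[OF t(1)]
    show "f (x \<oplus>\<^bsub>U\<^esub> y) = f x \<oplus>\<^bsub>B\<^esub> f y"
      unfolding s(2) t(2) universal_cstar_def N.completion_add[OF s(1) t(1)]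
      using B.converges_add[OF S(2) T(2)] S(1) T(1) by (intro f N.cauchy_add s(1) t(1)) simp
    show "f (x \<otimes>\<^bsub>U\<^esub> y) = f x \<otimes>\<^bsub>B\<^esub> f y"
      unfolding s(2) t(2) universal_cstar_def N.completion_mult[OF s(1) t(1)]
      using B.converges_mult[OF S(2) T(2)] S(1) T(1) by (intro f N.cauchy_mult s(1) t(1)) simp
  next
    show "f \<one>\<^bsub>U\<^esub> = \<one>\<^bsub>B\<^esub>" using fim[of "\<one>\<^bsub>F\<^esub>"] by simp
  qed
  then show ?thesis using fim that by blast
qed

end

section \<open>Scalars and opposite algebras\<close>

lemma (in cstar_algebra) cstar: "cstar_algebra A"
  by (rule cstar_algebra_axioms)

lemma (in star_seminorm) cls_const_hom: "star_hom F (completion F p) (\<lambda>x. cls (\<lambda>n. x))"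
  by (rule star_homI) (simp_all add: completion_one)

lemma complex_cstar_algebra: "cstar_algebra complex_cstar"
proof -
  have "ring complex_cstar"
    by (intro ringI abelian_groupI monoidI)
      (auto simp: complex_cstar_def algebra_simps intro: exI[of _ "- _"])
  interpret ring complex_cstar by fact
  have diff: "x \<ominus>\<^bsub>complex_cstar\<^esub> y = x - y" for x y
  proof -
    have "\<ominus>\<^bsub>complex_cstar\<^esub> y = - y"
      by (rule minus_equality) (auto simp: complex_cstar_def)
    then show ?thesis by (simp add: a_minus_def) (simp add: complex_cstar_def)
  qed
  show ?thesis
  proof unfold_locales
    fix s :: "nat \<Rightarrow> complex"
    assume "\<forall>e>0. \<exists>N. \<forall>m\<ge>N. \<forall>n\<ge>N. nrm complex_cstar (s m \<ominus>\<^bsub>complex_cstar\<^esub> s n) < e"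
    then have "Cauchy s" unfolding diff by (intro CauchyI) (simp add: complex_cstar_def)
    then obtain x where "s \<longlonglongrightarrow> x" by (auto simp: Cauchy_convergent_iff convergent_def)
    then have "(\<lambda>n. cmod (s n - x)) \<longlonglongrightarrow> 0" by (simp add: LIM_zero_iff tendsto_norm_zero_iff)
    then show "\<exists>x\<in>carrier complex_cstar. (\<lambda>n. nrm complex_cstar (s n \<ominus>\<^bsub>complex_cstar\<^esub> x)) \<longlonglongrightarrow> 0"
      unfolding diff by (auto simp: complex_cstar_def)
  next
    fix x
    show "nrm complex_cstar (star complex_cstar x \<otimes>\<^bsub>complex_cstar\<^esub> x) = (nrm complex_cstar x)\<^sup>2"
      by (simp add: complex_cstar_def norm_mult power2_eq_square)
  qed (auto simp: complex_cstar_def algebra_simps norm_mult norm_triangle_ineq)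
qed

lemma complex_cstar_simps [simp]:
  "carrier complex_cstar = UNIV" "\<one>\<^bsub>complex_cstar\<^esub> = 1" "\<zero>\<^bsub>complex_cstar\<^esub> = 0"
  "x \<oplus>\<^bsub>complex_cstar\<^esub> y = x + y" "x \<otimes>\<^bsub>complex_cstar\<^esub> y = x * y"
  "c \<odot>\<^bsub>complex_cstar\<^esub> x = c * x" "star complex_cstar x = cnj x" "nrm complex_cstar x = cmod x"
  by (simp_all add: complex_cstar_def)

lemma complex_cstar_finsum [simp]: "finsum complex_cstar f I = sum f I"
proof -
  interpret cstar_algebra complex_cstar by (rule complex_cstar_algebra)
  show ?thesis by (induction I rule: infinite_finite_induct) (simp_all add: Pi_def)
qed

lemma opposite_simps [simp]:
  "carrier (opposite A) = carrier A" "\<one>\<^bsub>opposite A\<^esub> = \<one>\<^bsub>A\<^esub>" "\<zero>\<^bsub>opposite A\<^esub> = \<zero>\<^bsub>A\<^esub>"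
  "x \<oplus>\<^bsub>opposite A\<^esub> y = x \<oplus>\<^bsub>A\<^esub> y" "x \<otimes>\<^bsub>opposite A\<^esub> y = y \<otimes>\<^bsub>A\<^esub> x"
  "c \<odot>\<^bsub>opposite A\<^esub> x = c \<odot>\<^bsub>A\<^esub> x" "star (opposite A) x = star A x" "nrm (opposite A) x = nrm A x"
  by (simp_all add: opposite_def)

lemma opposite_minus [simp]: "x \<ominus>\<^bsub>opposite A\<^esub> y = x \<ominus>\<^bsub>A\<^esub> y"
  by (simp add: a_minus_def a_inv_def m_inv_def)

lemma opposite_finsum [simp]: "finsum (opposite A) f I = finsum A f I"
  by (simp add: finsum_def finprod_def opposite_def)

lemma opposite_cstar_algebra:
  fixes A :: "('a, 'm) cstar_scheme"
  assumes "cstar_algebra A" shows "cstar_algebra (opposite A)"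
proof -
  interpret cstar_algebra A by fact
  have "ring (opposite A)"
  proof (rule ringI)
    show "abelian_group (opposite A)"
    proof (rule abelian_groupI)
      show "\<exists>y\<in>carrier (opposite A). y \<oplus>\<^bsub>opposite A\<^esub> x = \<zero>\<^bsub>opposite A\<^esub>" if "x \<in> carrier (opposite A)" for x
        using that by (intro bexI[of _ "\<ominus>\<^bsub>A\<^esub> x"]) (auto simp: l_neg)
    qed (simp_all add: a_ac)
    show "monoid (opposite A)" by (rule monoidI) (simp_all add: m_assoc)
  qed (simp_all add: l_distr r_distr)
  then show ?thesis
  proof (intro cstar_algebra.intro cstar_algebra_axioms.intro)
    fix s :: "nat \<Rightarrow> 'a" assume "\<forall>n. s n \<in> carrier (opposite A)"
      "\<forall>e>0. \<exists>N. \<forall>m\<ge>N. \<forall>n\<ge>N. nrm (opposite A) (s m \<ominus>\<^bsub>opposite A\<^esub> s n) < e"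
    then show "\<exists>x\<in>carrier (opposite A). (\<lambda>n. nrm (opposite A) (s n \<ominus>\<^bsub>opposite A\<^esub> x)) \<longlonglongrightarrow> 0"
      unfolding opposite_simps opposite_minus by (rule complete)
  next
    fix x assume "x \<in> carrier (opposite A)"
    \<comment> \<open>In the opposite algebra this product is \<open>x \<otimes> star A x\<close>,
      so the C*-identity is applied at \<open>star A x\<close>, whose norm is that of
      \<open>x\<close>.\<close>
    then show "nrm (opposite A) (star (opposite A) x \<otimes>\<^bsub>opposite A\<^esub> x) = (nrm (opposite A) x)\<^sup>2"
      using nrm_star_mult[of "star A x"] by simp
  next
    fix x y assume "x \<in> carrier (opposite A)" "y \<in> carrier (opposite A)"
    then show "nrm (opposite A) (x \<otimes>\<^bsub>opposite A\<^esub> y) \<le> nrm (opposite A) x * nrm (opposite A) y"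
      using nrm_mult[of y x] by (simp add: mult.commute)
  qed (simp_all add: scale_add_left scale_add_right adj_add adj_scale adj_mult nrm_nonneg nrm_eq_0 nrm_add nrm_smult)
qed

section \<open>The maximal tensor product\<close>

text \<open>The conditions on \<open>t\<close> are exactly the relations of the tensor product, so
  such \<open>t\<close> are the restrictions to elementary tensors of homomorphisms out of
  \<open>max_tensor A B\<close>.\<close>

locale tensor_rep = A: cstar_algebra A + B: cstar_algebra B + C: cstar_algebra C
  for A :: "('a, 'k) cstar_scheme" and B :: "('b, 'l) cstar_scheme" and C :: "('c, 'm) cstar_scheme" +
  fixes t :: "'a \<Rightarrow> 'b \<Rightarrow> 'c"
  assumes t_closed [simp, intro]: "a \<in> carrier A \<Longrightarrow> b \<in> carrier B \<Longrightarrow> t a b \<in> carrier C"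
    and t_add_left: "a \<in> carrier A \<Longrightarrow> a' \<in> carrier A \<Longrightarrow> b \<in> carrier B \<Longrightarrow>
      t (a \<oplus>\<^bsub>A\<^esub> a') b = t a b \<oplus>\<^bsub>C\<^esub> t a' b"
    and t_add_right: "a \<in> carrier A \<Longrightarrow> b \<in> carrier B \<Longrightarrow> b' \<in> carrier B \<Longrightarrow>
      t a (b \<oplus>\<^bsub>B\<^esub> b') = t a b \<oplus>\<^bsub>C\<^esub> t a b'"
    and t_scale_left: "a \<in> carrier A \<Longrightarrow> b \<in> carrier B \<Longrightarrow> t (c \<odot>\<^bsub>A\<^esub> a) b = c \<odot>\<^bsub>C\<^esub> t a b"
    and t_scale_right: "a \<in> carrier A \<Longrightarrow> b \<in> carrier B \<Longrightarrow> t a (c \<odot>\<^bsub>B\<^esub> b) = c \<odot>\<^bsub>C\<^esub> t a b"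
    and t_mult: "a \<in> carrier A \<Longrightarrow> a' \<in> carrier A \<Longrightarrow> b \<in> carrier B \<Longrightarrow> b' \<in> carrier B \<Longrightarrow>
      t a b \<otimes>\<^bsub>C\<^esub> t a' b' = t (a \<otimes>\<^bsub>A\<^esub> a') (b \<otimes>\<^bsub>B\<^esub> b')"
    and t_star: "a \<in> carrier A \<Longrightarrow> b \<in> carrier B \<Longrightarrow> star C (t a b) = t (star A a) (star B b)"
    and t_one [simp]: "t \<one>\<^bsub>A\<^esub> \<one>\<^bsub>B\<^esub> = \<one>\<^bsub>C\<^esub>"
begin

lemma left_hom: "star_hom A C (\<lambda>a. t a \<one>\<^bsub>B\<^esub>)"
  by (rule star_homI) (auto simp: t_add_left t_scale_left t_mult t_star)

lemma right_hom: "star_hom B C (t \<one>\<^bsub>A\<^esub>)"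
  by (rule star_homI) (auto simp: t_add_right t_scale_right t_mult t_star)

lemma split: "a \<in> carrier A \<Longrightarrow> b \<in> carrier B \<Longrightarrow> t a b = t a \<one>\<^bsub>B\<^esub> \<otimes>\<^bsub>C\<^esub> t \<one>\<^bsub>A\<^esub> b"
  by (simp add: t_mult)

text \<open>\<open>t a b\<close> is a product of images under the homomorphisms of
  \<open>left_hom\<close> and \<open>right_hom\<close>, each contractive. Applied in the completion
  for an arbitrary admissible seminorm, this bounds the generators of the maximal tensor
  product.\<close>

lemma nrm_le:
  assumes "a \<in> carrier A" "b \<in> carrier B" shows "nrm C (t a b) \<le> nrm A a * nrm B b"
proof -
  interpret l: cstar_map A C "\<lambda>a. t a \<one>\<^bsub>B\<^esub>" by (intro cstar_mapI A.cstar C.cstar left_hom)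
  interpret r: cstar_map B C "t \<one>\<^bsub>A\<^esub>" by (intro cstar_mapI B.cstar C.cstar right_hom)
  have "nrm C (t a b) \<le> nrm C (t a \<one>\<^bsub>B\<^esub>) * nrm C (t \<one>\<^bsub>A\<^esub> b)"
    using assms by (subst split) (auto intro!: C.nrm_mult)
  also have "\<dots> \<le> nrm A a * nrm B b"
    using assms by (intro mult_mono l.contractive r.contractive C.nrm_nonneg A.nrm_nonneg) auto
  finally show ?thesis .
qed

lemma t_finsum_left:
  "(\<And>i. i \<in> I \<Longrightarrow> f i \<in> carrier A) \<Longrightarrow> b \<in> carrier B \<Longrightarrow> finite I \<Longrightarrow>
    t (\<Oplus>\<^bsub>A\<^esub>i\<in>I. f i) b = (\<Oplus>\<^bsub>C\<^esub>i\<in>I. t (f i) b)"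
  using t_scale_left[of "\<zero>\<^bsub>A\<^esub>" b 0]
  by (induction I rule: infinite_finite_induct) (simp_all add: t_add_left Pi_def)

lemma t_finsum_right:
  "(\<And>i. i \<in> I \<Longrightarrow> f i \<in> carrier B) \<Longrightarrow> a \<in> carrier A \<Longrightarrow> finite I \<Longrightarrow>
    t a (\<Oplus>\<^bsub>B\<^esub>i\<in>I. f i) = (\<Oplus>\<^bsub>C\<^esub>i\<in>I. t a (f i))"
  using t_scale_right[of a "\<zero>\<^bsub>B\<^esub>" 0]
  by (induction I rule: infinite_finite_induct) (simp_all add: t_add_right Pi_def)

lemma t_zero_left: "b \<in> carrier B \<Longrightarrow> t \<zero>\<^bsub>A\<^esub> b = \<zero>\<^bsub>C\<^esub>"
  using t_scale_left[of "\<zero>\<^bsub>A\<^esub>" b 0] by simp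

lemma t_zero_right: "a \<in> carrier A \<Longrightarrow> t a \<zero>\<^bsub>B\<^esub> = \<zero>\<^bsub>C\<^esub>"
  using t_scale_right[of a "\<zero>\<^bsub>B\<^esub>" 0] by simp

lemma comp_homs:
  assumes "cstar_algebra A'" "cstar_algebra B'" "star_hom A' A f" "star_hom B' B g"
  shows "tensor_rep A' B' C (\<lambda>a b. t (f a) (g b))"
proof -
  interpret f: cstar_map A' A f by (intro cstar_mapI A.cstar assms)
  interpret g: cstar_map B' B g by (intro cstar_mapI B.cstar assms)
  show ?thesis
    by unfold_locales (auto simp: t_add_left t_add_right t_scale_left t_scale_right t_mult t_star)
qed

end

lemma tensor_rep_commuting:
  assumes "cstar_algebra A" "cstar_algebra B" "cstar_algebra C" and "star_hom A C f" "star_hom B C g"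
    and comm: "\<And>a b. a \<in> carrier A \<Longrightarrow> b \<in> carrier B \<Longrightarrow> f a \<otimes>\<^bsub>C\<^esub> g b = g b \<otimes>\<^bsub>C\<^esub> f a"
  shows "tensor_rep A B C (\<lambda>a b. f a \<otimes>\<^bsub>C\<^esub> g b)"
proof -
  interpret f: cstar_map A C f by (intro cstar_mapI assms)
  interpret g: cstar_map B C g by (intro cstar_mapI assms)
  show ?thesis
  proof unfold_locales
    fix a a' b b' assume ab: "a \<in> carrier A" "a' \<in> carrier A" "b \<in> carrier B" "b' \<in> carrier B"
    have "(f a \<otimes>\<^bsub>C\<^esub> g b) \<otimes>\<^bsub>C\<^esub> (f a' \<otimes>\<^bsub>C\<^esub> g b') = f a \<otimes>\<^bsub>C\<^esub> (g b \<otimes>\<^bsub>C\<^esub> f a') \<otimes>\<^bsub>C\<^esub> g b'"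
      using ab by (simp add: f.B.m_assoc)
    also have "g b \<otimes>\<^bsub>C\<^esub> f a' = f a' \<otimes>\<^bsub>C\<^esub> g b" using ab comm by simp
    finally show "(f a \<otimes>\<^bsub>C\<^esub> g b) \<otimes>\<^bsub>C\<^esub> (f a' \<otimes>\<^bsub>C\<^esub> g b') = f (a \<otimes>\<^bsub>A\<^esub> a') \<otimes>\<^bsub>C\<^esub> g (b \<otimes>\<^bsub>B\<^esub> b')"
      using ab by (simp add: f.B.m_assoc)
  next
    fix a b assume "a \<in> carrier A" "b \<in> carrier B"
    then show "star C (f a \<otimes>\<^bsub>C\<^esub> g b) = f (star A a) \<otimes>\<^bsub>C\<^esub> g (star B b)"
      using comm[of "star A a" "star B b"] by (simp add: f.B.adj_mult)
  qed (auto simp: f.B.l_distr f.B.r_distr)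
qed

text \<open>\<open>commute_on_generators\<close> is applied once per factor, first with a generator
  of \<open>B\<close> held fixed, then with an arbitrary element of \<open>A\<close>. Closure of
  \<open>T\<close> under \<open>star\<close> supplies its condition on adjoints.\<close>

lemma commuting_homs:
  assumes A: "cstar_algebra A" and B: "cstar_algebra B" and C: "cstar_algebra C"
    and f: "star_hom A C f" and g: "star_hom B C g"
    and S: "generates A S" and T: "generates B T" and star: "\<And>y. y \<in> T \<Longrightarrow> star B y \<in> T"
    and comm: "\<And>x y. x \<in> S \<Longrightarrow> y \<in> T \<Longrightarrow> f x \<otimes>\<^bsub>C\<^esub> g y = g y \<otimes>\<^bsub>C\<^esub> f x"
    and a: "a \<in> carrier A" and b: "b \<in> carrier B"
  shows "f a \<otimes>\<^bsub>C\<^esub> g b = g b \<otimes>\<^bsub>C\<^esub> f a"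
proof -
  interpret f: cstar_map A C f by (intro cstar_mapI A B C f)
  interpret g: cstar_map B C g by (intro cstar_mapI A B C g)
  have gen: "f a \<otimes>\<^bsub>C\<^esub> g y = g y \<otimes>\<^bsub>C\<^esub> f a" if y: "y \<in> T" and a: "a \<in> carrier A" for a y
  proof (rule commute_on_generators[OF A C f S _ _ _ a])
    have yc: "y \<in> carrier B" using T y generates_subset by blast
    then show "g y \<in> carrier C" by simp
    show "f x \<otimes>\<^bsub>C\<^esub> g y = g y \<otimes>\<^bsub>C\<^esub> f x" if "x \<in> S" for x using comm that y by simp
    show "f x \<otimes>\<^bsub>C\<^esub> star C (g y) = star C (g y) \<otimes>\<^bsub>C\<^esub> f x" if "x \<in> S" for x
      using comm[OF that star[OF y]] yc by simp
  qed
  have "g b \<otimes>\<^bsub>C\<^esub> f a = f a \<otimes>\<^bsub>C\<^esub> g b"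
  proof (rule commute_on_generators[OF B C g T _ _ _ b])
    show "f a \<in> carrier C" using a by simp
    show "g y \<otimes>\<^bsub>C\<^esub> f a = f a \<otimes>\<^bsub>C\<^esub> g y" if "y \<in> T" for y using gen[OF that a] by simp
    show "g y \<otimes>\<^bsub>C\<^esub> star C (f a) = star C (f a) \<otimes>\<^bsub>C\<^esub> g y" if "y \<in> T" for y
      using gen[OF that, of "star A a"] a by simp
  qed
  then show ?thesis by simp
qed

text \<open>Rewrites the set of relations as conditions on parameters for an arbitrary
  \<open>P\<close>: closedness of both sides and equality under a homomorphism are then
  instances.\<close>

lemma tensor_relations_iff:
  assumes "cstar_algebra A" "cstar_algebra B"
  defines "F \<equiv> free_star_alg (carrier A \<times> carrier B)"
  shows "(\<forall>(l, r)\<in>tensor_relations A B. P l r) \<longleftrightarrow>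
    (\<forall>a\<in>carrier A. \<forall>a'\<in>carrier A. \<forall>b\<in>carrier B. \<forall>b'\<in>carrier B. \<forall>c.
      P (gen (a \<oplus>\<^bsub>A\<^esub> a', b)) (gen (a, b) \<oplus>\<^bsub>F\<^esub> gen (a', b)) \<and>
      P (gen (a, b \<oplus>\<^bsub>B\<^esub> b')) (gen (a, b) \<oplus>\<^bsub>F\<^esub> gen (a, b')) \<and>
      P (gen (c \<odot>\<^bsub>A\<^esub> a, b)) (c \<odot>\<^bsub>F\<^esub> gen (a, b)) \<and>
      P (gen (a, c \<odot>\<^bsub>B\<^esub> b)) (c \<odot>\<^bsub>F\<^esub> gen (a, b)) \<and>
      P (gen (a, b) \<otimes>\<^bsub>F\<^esub> gen (a', b')) (gen (a \<otimes>\<^bsub>A\<^esub> a', b \<otimes>\<^bsub>B\<^esub> b')) \<and>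
      P (star F (gen (a, b))) (gen (star A a, star B b)) \<and>
      P (gen (\<one>\<^bsub>A\<^esub>, \<one>\<^bsub>B\<^esub>)) \<one>\<^bsub>F\<^esub>)" (is "?L \<longleftrightarrow> ?R")
proof
  interpret A: cstar_algebra A by fact
  interpret B: cstar_algebra B by fact
  show ?L if R: ?R
  proof -
    \<comment> \<open>The unit relation has no parameters but stands under the quantifiers; the
      units show that the carriers are inhabited.\<close>
    have "P (gen (\<one>\<^bsub>A\<^esub>, \<one>\<^bsub>B\<^esub>)) \<one>\<^bsub>F\<^esub>"
      using R A.one_closed B.one_closed by blast
    with R show ?thesis
      unfolding tensor_relations_def Let_def F_def by auto
  qed
  assume L: ?L
  then have P: "P l r" if "(l, r) \<in> tensor_relations A B" for l r using that by blast
  show ?R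
  proof (intro ballI allI)
    fix a a' b b' c
    assume ab: "a \<in> carrier A" "a' \<in> carrier A" "b \<in> carrier B" "b' \<in> carrier B"
    show "P (gen (a \<oplus>\<^bsub>A\<^esub> a', b)) (gen (a, b) \<oplus>\<^bsub>F\<^esub> gen (a', b)) \<and>
      P (gen (a, b \<oplus>\<^bsub>B\<^esub> b')) (gen (a, b) \<oplus>\<^bsub>F\<^esub> gen (a, b')) \<and>
      P (gen (c \<odot>\<^bsub>A\<^esub> a, b)) (c \<odot>\<^bsub>F\<^esub> gen (a, b)) \<and>
      P (gen (a, c \<odot>\<^bsub>B\<^esub> b)) (c \<odot>\<^bsub>F\<^esub> gen (a, b)) \<and>
      P (gen (a, b) \<otimes>\<^bsub>F\<^esub> gen (a', b')) (gen (a \<otimes>\<^bsub>A\<^esub> a', b \<otimes>\<^bsub>B\<^esub> b')) \<and>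
      P (star F (gen (a, b))) (gen (star A a, star B b)) \<and>
      P (gen (\<one>\<^bsub>A\<^esub>, \<one>\<^bsub>B\<^esub>)) \<one>\<^bsub>F\<^esub>"
      by (intro conjI; rule P; unfold tensor_relations_def Let_def F_def Un_iff; use ab in blast)
  qed
qed

locale tensor_pair = A: cstar_algebra A + B: cstar_algebra B
  for A :: "('a, 'k) cstar_scheme" and B :: "('b, 'l) cstar_scheme"
begin

abbreviation "F \<equiv> free_star_alg (carrier A \<times> carrier B)"

sublocale F: star_algebra F by (rule free_star_algebra)

lemmas relations_iff = tensor_relations_iff[OF A.cstar B.cstar]

lemma respects_relations_iff:
  assumes "cstar_algebra C" "star_hom F C e"
  shows "(\<forall>(l, r)\<in>tensor_relations A B. e l = e r) \<longleftrightarrow> tensor_rep A B C (\<lambda>a b. e (gen (a, b)))"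
proof -
  interpret C: cstar_algebra C by fact
  interpret e: star_map F C e by unfold_locales fact
  show ?thesis
    unfolding relations_iff tensor_rep_def tensor_rep_axioms_def
    using A.one_closed B.one_closed by (auto simp: A.cstar B.cstar C.cstar) blast+
qed

text \<open>An admissible seminorm is the norm of a representation: in its completion the classes of
  the generators form a \<open>tensor_rep\<close>, so \<open>nrm_le\<close> applies. The bound is
  uniform in \<open>p\<close>, which makes the maximal norm finite.\<close>

lemma admissible_le:
  assumes p: "admissible (carrier A \<times> carrier B) (tensor_relations A B) p"
    and ab: "a \<in> carrier A" "b \<in> carrier B"
  shows "p (gen (a, b)) \<le> nrm A a * nrm B b"
proof -
  interpret p: star_seminorm F p
    by unfold_locales (use p in \<open>simp add: admissible_def\<close>)
  have C: "cstar_algebra (completion F p)" by (rule p.completion_cstar_algebra)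
  have closed: "\<forall>(l, r)\<in>tensor_relations A B. l \<in> carrier F \<and> r \<in> carrier F"
    unfolding relations_iff by auto
  have "\<forall>(l, r)\<in>tensor_relations A B. p.cls (\<lambda>n. l) = p.cls (\<lambda>n. r)"
  proof clarify
    fix l r assume lr: "(l, r) \<in> tensor_relations A B"
    then have "p (l \<ominus>\<^bsub>F\<^esub> r) = 0" "l \<in> carrier F" "r \<in> carrier F"
      using p closed by (auto simp: admissible_def)
    then show "p.cls (\<lambda>n. l) = p.cls (\<lambda>n. r)" by (simp add: p.cls_eq_iff)
  qed
  then have "tensor_rep A B (completion F p) (\<lambda>a b. p.cls (\<lambda>n. gen (a, b)))"
    by (subst (asm) respects_relations_iff[OF C p.cls_const_hom])
  from tensor_rep.nrm_le[OF this ab] show ?thesis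
    using ab by (simp add: p.completion_nrm_const)
qed

sublocale T: bounded_relations "carrier A \<times> carrier B" "tensor_relations A B"
proof
  have "\<forall>(l, r)\<in>tensor_relations A B. l \<in> carrier F \<and> r \<in> carrier F"
    unfolding relations_iff by auto
  then show "l \<in> carrier F \<and> r \<in> carrier F" if "(l, r) \<in> tensor_relations A B" for l r
    using that by blast
  fix g assume "g \<in> carrier A \<times> carrier B"
  then show "\<exists>C. \<forall>p. admissible (carrier A \<times> carrier B) (tensor_relations A B) p \<longrightarrow> p (gen g) \<le> C"
    using admissible_le by (cases g) auto
qed

end

lemma max_tensor_cstar_algebra:
  assumes "cstar_algebra A" "cstar_algebra B" shows "cstar_algebra (max_tensor A B)"
proof -
  interpret tensor_pair A B by (intro tensor_pair.intro assms)
  show ?thesis unfolding max_tensor_def by (rule T.U_cstar)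
qed

lemma tensor_tensor_rep:
  assumes "cstar_algebra A" "cstar_algebra B" shows "tensor_rep A B (max_tensor A B) (tensor A B)"
proof -
  interpret tensor_pair A B by (intro tensor_pair.intro assms)
  have "tensor_rep A B T.U (\<lambda>a b. T.image (gen (a, b)))"
    using T.image_relation by (subst respects_relations_iff[OF T.U_cstar T.image_hom, symmetric]) auto
  then show ?thesis
    by (simp add: T.image_gen max_tensor_def tensor_def[abs_def])
qed

lemma max_tensor_generates:
  assumes "cstar_algebra A" "cstar_algebra B"
  shows "generates (max_tensor A B) {tensor A B a b | a b. a \<in> carrier A \<and> b \<in> carrier B}"
proof -
  interpret tensor_pair A B by (intro tensor_pair.intro assms)
  have "universal_gen (carrier A \<times> carrier B) (tensor_relations A B) ` (carrier A \<times> carrier B) =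
    {tensor A B a b | a b. a \<in> carrier A \<and> b \<in> carrier B}"
    by (auto simp: tensor_def)
  then show ?thesis using T.U_generates by (simp add: max_tensor_def)
qed

section \<open>Homomorphisms out of a maximal tensor product\<close>

lemma max_tensor_lift_ex:
  assumes "tensor_rep A B C h"
  shows "\<exists>f. f \<in> cstar_hom (max_tensor A B) C \<and> (\<forall>a\<in>carrier A. \<forall>b\<in>carrier B. f (tensor A B a b) = h a b)"
proof -
  interpret h: tensor_rep A B C h by fact
  interpret tensor_pair A B by (intro tensor_pair.intro h.A.cstar h.B.cstar)
  interpret E: free_eval "carrier A \<times> carrier B" C "\<lambda>(a, b). h a b" by unfold_locales auto
  have "tensor_rep A B C (\<lambda>a b. E.eval_at (gen (a, b)))"
    using h.tensor_rep_axioms unfolding tensor_rep_def tensor_rep_axioms_def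
    by (auto simp: E.eval_gen)
  then have "\<forall>(l, r)\<in>tensor_relations A B. E.eval_at l = E.eval_at r"
    by (subst respects_relations_iff[OF h.C.cstar E.eval_hom])
  then obtain f where f: "star_hom T.U C f" "\<And>x. x \<in> carrier F \<Longrightarrow> f (T.image x) = E.eval_at x"
    using T.universal_property[OF h.C.cstar E.eval_hom] by blast
  have "f (tensor A B a b) = h a b" if "a \<in> carrier A" "b \<in> carrier B" for a b
    using that f(2)[of "gen (a, b)"] by (simp add: E.eval_gen tensor_def T.image_gen)
  then show ?thesis using f by (auto simp: cstar_hom_iff max_tensor_def)
qed

lemma tensor_lift:
  assumes "tensor_rep A B C h"
  shows tensor_lift_hom: "star_hom (max_tensor A B) C (tensor_lift A B C h)"
    and tensor_lift_tensor: "a \<in> carrier A \<Longrightarrow> b \<in> carrier B \<Longrightarrow> tensor_lift A B C h (tensor A B a b) = h a b"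
  using someI_ex[OF max_tensor_lift_ex[OF assms]] by (simp_all add: tensor_lift_def cstar_hom_iff)

lemma tensor_map:
  assumes "cstar_algebra A" "cstar_algebra B" "cstar_algebra C" "cstar_algebra D" "star_hom A C f" "star_hom B D g"
  shows tensor_map_hom: "star_hom (max_tensor A B) (max_tensor C D) (tensor_map A B C D f g)"
    and tensor_map_tensor: "a \<in> carrier A \<Longrightarrow> b \<in> carrier B \<Longrightarrow>
      tensor_map A B C D f g (tensor A B a b) = tensor C D (f a) (g b)"
  using tensor_lift[OF tensor_rep.comp_homs[OF tensor_tensor_rep[OF assms(3,4)] assms(1,2,5,6)]]
  by (simp_all add: tensor_map_def)

lemma generates_tensor_star:
  assumes "cstar_algebra A" "cstar_algebra B"
    and "y \<in> {tensor A B a b | a b. a \<in> carrier A \<and> b \<in> carrier B}"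
  shows "star (max_tensor A B) y \<in> {tensor A B a b | a b. a \<in> carrier A \<and> b \<in> carrier B}"
proof -
  interpret t: tensor_rep A B "max_tensor A B" "tensor A B" by (intro tensor_tensor_rep assms)
  obtain a b where "y = tensor A B a b" "a \<in> carrier A" "b \<in> carrier B" using assms(3) by blast
  then show ?thesis by (auto simp: t.t_star intro!: exI[of _ "star A a"] exI[of _ "star B b"])
qed

text \<open>Existence of the homomorphism chosen by \<open>SOME\<close>: elements of
  \<open>A \<otimes> B\<close> and of \<open>C\<close> are placed in the corresponding legs of the
  target, with units elsewhere. The two images commute, since this can be tested on elementary
  tensors, and their product is the required map.\<close>

lemma tensor_assoc:
  assumes A: "cstar_algebra A" and B: "cstar_algebra B" and C: "cstar_algebra C"
  shows tensor_assoc_hom: "star_hom (max_tensor (max_tensor A B) C) (max_tensor A (max_tensor B C)) (tensor_assoc A B C)"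
    and tensor_assoc_tensor: "a \<in> carrier A \<Longrightarrow> b \<in> carrier B \<Longrightarrow> c \<in> carrier C \<Longrightarrow>
      tensor_assoc A B C (tensor (max_tensor A B) C (tensor A B a b) c) = tensor A (max_tensor B C) a (tensor B C b c)"
proof -
  note AB = max_tensor_cstar_algebra[OF A B] and BC = max_tensor_cstar_algebra[OF B C]
  let ?D = "max_tensor A (max_tensor B C)"
  interpret bc: tensor_rep B C "max_tensor B C" "tensor B C" by (intro tensor_tensor_rep B C)
  interpret d: tensor_rep A "max_tensor B C" ?D "tensor A (max_tensor B C)" by (intro tensor_tensor_rep A BC)
  define f where "f = tensor_map A B A (max_tensor B C) id (\<lambda>b. tensor B C b \<one>\<^bsub>C\<^esub>)"
  define g where "g = (\<lambda>c. tensor A (max_tensor B C) \<one>\<^bsub>A\<^esub> (tensor B C \<one>\<^bsub>B\<^esub> c))"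
  have f: "star_hom (max_tensor A B) ?D f"
    unfolding f_def by (intro tensor_map_hom A B BC star_hom_id bc.left_hom)
  have f_tensor: "f (tensor A B a b) = tensor A (max_tensor B C) a (tensor B C b \<one>\<^bsub>C\<^esub>)"
    if "a \<in> carrier A" "b \<in> carrier B" for a b
    unfolding f_def using that by (subst tensor_map_tensor[OF A B A BC star_hom_id bc.left_hom]) auto
  have g: "star_hom C ?D g"
    unfolding g_def by (rule star_hom_comp[OF bc.right_hom d.right_hom])
  have C_gen: "generates C (carrier C)" by (rule generatesI) auto
  have comm: "f x \<otimes>\<^bsub>?D\<^esub> g c = g c \<otimes>\<^bsub>?D\<^esub> f x" if "x \<in> carrier (max_tensor A B)" "c \<in> carrier C" for x c
    using that
    by (rule commuting_homs[OF AB C d.C.cstar f g max_tensor_generates[OF A B] C_gen, rotated 2])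
      (auto simp: f_tensor g_def d.t_mult bc.t_mult)
  from max_tensor_lift_ex[OF tensor_rep_commuting[OF AB C d.C.cstar f g comm]]
  obtain h where h: "h \<in> cstar_hom (max_tensor (max_tensor A B) C) ?D"
    "\<And>x c. x \<in> carrier (max_tensor A B) \<Longrightarrow> c \<in> carrier C \<Longrightarrow> h (tensor (max_tensor A B) C x c) = f x \<otimes>\<^bsub>?D\<^esub> g c"
    by blast
  interpret ab: tensor_rep A B "max_tensor A B" "tensor A B" by (intro tensor_tensor_rep A B)
  have "\<exists>f. f \<in> cstar_hom (max_tensor (max_tensor A B) C) ?D \<and>
        (\<forall>a\<in>carrier A. \<forall>b\<in>carrier B. \<forall>c\<in>carrier C.
           f (tensor (max_tensor A B) C (tensor A B a b) c) =
           tensor A (max_tensor B C) a (tensor B C b c))"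
    by (rule exI[of _ h]) (auto simp: h f_tensor g_def d.t_mult bc.t_mult)
  from someI_ex[OF this]
  show "star_hom (max_tensor (max_tensor A B) C) ?D (tensor_assoc A B C)"
    and "a \<in> carrier A \<Longrightarrow> b \<in> carrier B \<Longrightarrow> c \<in> carrier C \<Longrightarrow>
      tensor_assoc A B C (tensor (max_tensor A B) C (tensor A B a b) c) = tensor A (max_tensor B C) a (tensor B C b c)"
    by (simp_all add: tensor_assoc_def cstar_hom_iff)
qed

text \<open>\<open>f\<close> places \<open>A \<otimes> A\<close> in the first legs of the two
  factors and \<open>g\<close> places \<open>B \<otimes> B\<close> in the second legs; these images
  commute and their product is the required map.\<close>

lemma tensor_interchange:
  assumes A: "cstar_algebra A" and B: "cstar_algebra B"
  shows tensor_interchange_hom: "star_hom (max_tensor (max_tensor A A) (max_tensor B B))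
      (max_tensor (max_tensor A B) (max_tensor A B)) (tensor_interchange A B)"
    and tensor_interchange_tensor: "a \<in> carrier A \<Longrightarrow> a' \<in> carrier A \<Longrightarrow> b \<in> carrier B \<Longrightarrow> b' \<in> carrier B \<Longrightarrow>
      tensor_interchange A B (tensor (max_tensor A A) (max_tensor B B) (tensor A A a a') (tensor B B b b')) =
      tensor (max_tensor A B) (max_tensor A B) (tensor A B a b) (tensor A B a' b')"
proof -
  note AA = max_tensor_cstar_algebra[OF A A] and BB = max_tensor_cstar_algebra[OF B B]
    and AB = max_tensor_cstar_algebra[OF A B]
  let ?D = "max_tensor (max_tensor A B) (max_tensor A B)"
  let ?t = "tensor (max_tensor A B) (max_tensor A B)"
  interpret ab: tensor_rep A B "max_tensor A B" "tensor A B" by (intro tensor_tensor_rep A B)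
  interpret aa: tensor_rep A A "max_tensor A A" "tensor A A" by (intro tensor_tensor_rep A A)
  interpret bb: tensor_rep B B "max_tensor B B" "tensor B B" by (intro tensor_tensor_rep B B)
  interpret d: tensor_rep "max_tensor A B" "max_tensor A B" ?D ?t by (intro tensor_tensor_rep AB)
  let ?l = "\<lambda>a. tensor A B a \<one>\<^bsub>B\<^esub>" and ?r = "tensor A B \<one>\<^bsub>A\<^esub>"
  define f where "f = tensor_map A A (max_tensor A B) (max_tensor A B) ?l ?l"
  define g where "g = tensor_map B B (max_tensor A B) (max_tensor A B) ?r ?r"
  have f: "star_hom (max_tensor A A) ?D f"
    unfolding f_def by (intro tensor_map_hom A AB ab.left_hom)
  have g: "star_hom (max_tensor B B) ?D g"
    unfolding g_def by (intro tensor_map_hom B AB ab.right_hom)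
  have f_tensor: "f (tensor A A a a') = ?t (?l a) (?l a')" if "a \<in> carrier A" "a' \<in> carrier A" for a a'
    unfolding f_def by (rule tensor_map_tensor[OF A A AB AB ab.left_hom ab.left_hom that])
  have g_tensor: "g (tensor B B b b') = ?t (?r b) (?r b')" if "b \<in> carrier B" "b' \<in> carrier B" for b b'
    unfolding g_def by (rule tensor_map_tensor[OF B B AB AB ab.right_hom ab.right_hom that])
  have comm: "f x \<otimes>\<^bsub>?D\<^esub> g y = g y \<otimes>\<^bsub>?D\<^esub> f x"
    if "x \<in> carrier (max_tensor A A)" "y \<in> carrier (max_tensor B B)" for x y
    using that
    by (rule commuting_homs[OF AA BB d.C.cstar f g max_tensor_generates[OF A A] max_tensor_generates[OF B B], rotated 2])
      (erule generates_tensor_star[OF B B], auto simp: f_tensor g_tensor d.t_mult ab.t_mult)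
  from max_tensor_lift_ex[OF tensor_rep_commuting[OF AA BB d.C.cstar f g comm]]
  obtain h where h: "h \<in> cstar_hom (max_tensor (max_tensor A A) (max_tensor B B)) ?D"
    "\<And>x c. x \<in> carrier (max_tensor A A) \<Longrightarrow> c \<in> carrier (max_tensor B B) \<Longrightarrow>
      h (tensor (max_tensor A A) (max_tensor B B) x c) = f x \<otimes>\<^bsub>?D\<^esub> g c"
    by blast
  have "\<exists>f. f \<in> cstar_hom (max_tensor (max_tensor A A) (max_tensor B B)) ?D \<and>
     (\<forall>a\<in>carrier A. \<forall>a'\<in>carrier A. \<forall>b\<in>carrier B. \<forall>b'\<in>carrier B.
        f (tensor (max_tensor A A) (max_tensor B B) (tensor A A a a') (tensor B B b b')) =
        ?t (tensor A B a b) (tensor A B a' b'))"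
    by (rule exI[of _ h]) (auto simp: h f_tensor g_tensor d.t_mult ab.t_mult)
  from someI_ex[OF this]
  show "star_hom (max_tensor (max_tensor A A) (max_tensor B B)) ?D (tensor_interchange A B)"
    and "a \<in> carrier A \<Longrightarrow> a' \<in> carrier A \<Longrightarrow> b \<in> carrier B \<Longrightarrow> b' \<in> carrier B \<Longrightarrow>
      tensor_interchange A B (tensor (max_tensor A A) (max_tensor B B) (tensor A A a a') (tensor B B b b')) =
      ?t (tensor A B a b) (tensor A B a' b')"
    by (simp_all add: tensor_interchange_def cstar_hom_iff)
qed

text \<open>An elementary tensor is the product of \<open>a \<otimes> 1\<close> and
  \<open>1 \<otimes> b\<close>, and a property stable under limits passes along each leg because the
  map of that leg is contractive.\<close>

lemma generates_tensor:
  assumes A: "cstar_algebra A" and B: "cstar_algebra B" and S: "generates A S" and T: "generates B T"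
  shows "generates (max_tensor A B) ((\<lambda>a. tensor A B a \<one>\<^bsub>B\<^esub>) ` S \<union> tensor A B \<one>\<^bsub>A\<^esub> ` T)"
proof (rule generatesI)
  interpret t: tensor_rep A B "max_tensor A B" "tensor A B" by (intro tensor_tensor_rep A B)
  interpret l: cstar_map A "max_tensor A B" "\<lambda>a. tensor A B a \<one>\<^bsub>B\<^esub>" by (intro cstar_mapI A t.C.cstar t.left_hom)
  interpret r: cstar_map B "max_tensor A B" "tensor A B \<one>\<^bsub>A\<^esub>" by (intro cstar_mapI B t.C.cstar t.right_hom)
  show "(\<lambda>a. tensor A B a \<one>\<^bsub>B\<^esub>) ` S \<union> tensor A B \<one>\<^bsub>A\<^esub> ` T \<subseteq> carrier (max_tensor A B)"
    using generates_subset[OF S] generates_subset[OF T] by auto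
  let ?U = "max_tensor A B"
  fix P x
  assume base: "\<And>x. x \<in> (\<lambda>a. tensor A B a \<one>\<^bsub>B\<^esub>) ` S \<union> tensor A B \<one>\<^bsub>A\<^esub> ` T \<Longrightarrow> P x" and one: "P \<one>\<^bsub>?U\<^esub>"
    and add: "\<And>x y. x \<in> carrier ?U \<Longrightarrow> y \<in> carrier ?U \<Longrightarrow> P x \<Longrightarrow> P y \<Longrightarrow> P (x \<oplus>\<^bsub>?U\<^esub> y)"
    and mult: "\<And>x y. x \<in> carrier ?U \<Longrightarrow> y \<in> carrier ?U \<Longrightarrow> P x \<Longrightarrow> P y \<Longrightarrow> P (x \<otimes>\<^bsub>?U\<^esub> y)"
    and scale: "\<And>x c. x \<in> carrier ?U \<Longrightarrow> P x \<Longrightarrow> P (c \<odot>\<^bsub>?U\<^esub> x)"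
    and star: "\<And>x. x \<in> carrier ?U \<Longrightarrow> P x \<Longrightarrow> P (star ?U x)"
    and lim: "\<And>s x. t.C.converges s x \<Longrightarrow> (\<And>n. P (s n)) \<Longrightarrow> P x"
    and x: "x \<in> carrier ?U"
  have left: "P (tensor A B a \<one>\<^bsub>B\<^esub>)" if "a \<in> carrier A" for a using S that
  proof (induction rule: generates_induct)
    case (limit s x)
    then show ?case using lim[OF l.converges] by blast
  qed (auto simp: base one add mult scale star)
  have right: "P (tensor A B \<one>\<^bsub>A\<^esub> b)" if "b \<in> carrier B" for b using T that
  proof (induction rule: generates_induct)
    case (limit s x)
    then show ?case using lim[OF r.converges] by blast
  qed (auto simp: base one add mult scale star)
  show "P x" using max_tensor_generates[OF A B] x
  proof (induction rule: generates_induct)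
    case (base x)
    then obtain a b where "x = tensor A B a b" "a \<in> carrier A" "b \<in> carrier B" by blast
    then show ?case using mult[OF _ _ left right, of a b] t.split[of a b] by auto
  qed (auto simp: one add mult scale star intro: lim)
qed

lemma generates_star_span:
  assumes A: "cstar_algebra A" and S: "generates A S" and T: "T \<subseteq> carrier A" and sub: "S \<subseteq> star_span A T"
  shows "generates A T"
proof (rule generatesI)
  interpret cstar_algebra A by (rule A)
  fix P x
  assume base: "\<And>x. x \<in> T \<Longrightarrow> P x" and one: "P \<one>\<^bsub>A\<^esub>"
    and add: "\<And>x y. x \<in> carrier A \<Longrightarrow> y \<in> carrier A \<Longrightarrow> P x \<Longrightarrow> P y \<Longrightarrow> P (x \<oplus>\<^bsub>A\<^esub> y)"
    and mult: "\<And>x y. x \<in> carrier A \<Longrightarrow> y \<in> carrier A \<Longrightarrow> P x \<Longrightarrow> P y \<Longrightarrow> P (x \<otimes>\<^bsub>A\<^esub> y)"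
    and scale: "\<And>x c. x \<in> carrier A \<Longrightarrow> P x \<Longrightarrow> P (c \<odot>\<^bsub>A\<^esub> x)"
    and star: "\<And>x. x \<in> carrier A \<Longrightarrow> P x \<Longrightarrow> P (star A x)"
    and lim: "\<And>s x. converges s x \<Longrightarrow> (\<And>n. P (s n)) \<Longrightarrow> P x"
    and x: "x \<in> carrier A"
  have "x \<in> carrier A \<and> P x" if "x \<in> star_span A T" for x
    using that by induction (use base one add mult scale star T in auto)
  then have "P x" if "x \<in> S" for x using sub that by blast
  then show "P x"
    using generates_induct[OF S x, of P] one add mult scale star lim by blast
qed (rule T)

section \<open>Finite sums\<close>

context star_algebra begin

lemma finsum_eq: "(\<And>i. i \<in> I \<Longrightarrow> f i = g i) \<Longrightarrow> (\<And>i. i \<in> I \<Longrightarrow> g i \<in> carrier F) \<Longrightarrow>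
    (\<Oplus>i\<in>I. f i) = (\<Oplus>i\<in>I. g i)"
  by (rule finsum_cong') auto

lemma finsum_add: "(\<And>i. i \<in> I \<Longrightarrow> f i \<in> carrier F) \<Longrightarrow> (\<And>i. i \<in> I \<Longrightarrow> g i \<in> carrier F) \<Longrightarrow>
    (\<Oplus>i\<in>I. f i \<oplus> g i) = (\<Oplus>i\<in>I. f i) \<oplus> (\<Oplus>i\<in>I. g i)"
  by (rule finsum_addf) auto

lemma finsum_swap:
  assumes "finite I" "finite J" "\<And>i j. i \<in> I \<Longrightarrow> j \<in> J \<Longrightarrow> f i j \<in> carrier F"
  shows "(\<Oplus>i\<in>I. \<Oplus>j\<in>J. f i j) = (\<Oplus>j\<in>J. \<Oplus>i\<in>I. f i j)"
  using assms(1,3)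
proof (induction I rule: finite_induct)
  case (insert i I)
  have "(\<Oplus>i\<in>insert i I. \<Oplus>j\<in>J. f i j) = (\<Oplus>j\<in>J. f i j) \<oplus> (\<Oplus>j\<in>J. \<Oplus>i\<in>I. f i j)"
    using insert by (simp add: Pi_def)
  also have "\<dots> = (\<Oplus>j\<in>J. f i j \<oplus> (\<Oplus>i\<in>I. f i j))"
    using insert by (intro finsum_add[symmetric]) auto
  also have "\<dots> = (\<Oplus>j\<in>J. \<Oplus>i\<in>insert i I. f i j)"
    using insert by (intro finsum_eq) (auto simp: Pi_def)
  finally show ?case .
qed simp

lemma finsum_cartesian:
  assumes "finite I" "finite J" "\<And>i j. i \<in> I \<Longrightarrow> j \<in> J \<Longrightarrow> f i j \<in> carrier F"
  shows "(\<Oplus>x\<in>I \<times> J. f (fst x) (snd x)) = (\<Oplus>i\<in>I. \<Oplus>j\<in>J. f i j)"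
  using assms(1,3)
proof (induction I rule: finite_induct)
  case (insert i I)
  have "insert i I \<times> J = Pair i ` J \<union> I \<times> J" by auto
  then have "(\<Oplus>x\<in>insert i I \<times> J. f (fst x) (snd x)) =
    (\<Oplus>x\<in>Pair i ` J. f (fst x) (snd x)) \<oplus> (\<Oplus>x\<in>I \<times> J. f (fst x) (snd x))"
    using insert assms(2) by (simp only:, intro finsum_Un_disjoint) auto
  also have "(\<Oplus>x\<in>Pair i ` J. f (fst x) (snd x)) = (\<Oplus>j\<in>J. f i j)"
    using insert by (subst finsum_reindex) (auto simp: inj_on_def)
  finally show ?case using insert by (simp add: Pi_def)
qed simp

lemma finsum_mult:
  assumes "finite I" "finite J" "\<And>i. i \<in> I \<Longrightarrow> f i \<in> carrier F" "\<And>j. j \<in> J \<Longrightarrow> g j \<in> carrier F"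
  shows "(\<Oplus>i\<in>I. f i) \<otimes> (\<Oplus>j\<in>J. g j) = (\<Oplus>i\<in>I. \<Oplus>j\<in>J. f i \<otimes> g j)"
proof -
  have "(\<Oplus>i\<in>I. f i) \<otimes> (\<Oplus>j\<in>J. g j) = (\<Oplus>i\<in>I. f i \<otimes> (\<Oplus>j\<in>J. g j))"
    using assms by (intro finsum_ldistr) auto
  also have "\<dots> = (\<Oplus>i\<in>I. \<Oplus>j\<in>J. f i \<otimes> g j)"
    using assms by (intro finsum_eq finsum_rdistr) auto
  finally show ?thesis .
qed

lemma finsum_reindex':
  "inj_on h I \<Longrightarrow> (\<And>i. i \<in> I \<Longrightarrow> f (h i) \<in> carrier F) \<Longrightarrow> (\<Oplus>k\<in>h ` I. f k) = (\<Oplus>i\<in>I. f (h i))"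
  by (rule finsum_reindex) auto

lemma finsum_delta:
  "finite I \<Longrightarrow> i \<in> I \<Longrightarrow> f i \<in> carrier F \<Longrightarrow> (\<Oplus>j\<in>I. if i = j then f j else \<zero>) = f i"
  by (subst add.finprod_mono_neutral_cong_right[of _ "{i}" _ "\<lambda>_. f i"]) auto

lemma finsum_delta':
  "finite I \<Longrightarrow> i \<in> I \<Longrightarrow> f i \<in> carrier F \<Longrightarrow> (\<Oplus>j\<in>I. if j = i then f j else \<zero>) = f i"
  by (subst add.finprod_mono_neutral_cong_right[of _ "{i}" _ "\<lambda>_. f i"]) auto

end

section \<open>Hopf C*-algebras generated by matrix coefficients\<close>

text \<open>Fits both the graph algebras and the tensor product of two of them, so that the Hopf
  axioms are verified once. Row and column orthogonality are the antipode axioms on the generators,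
  given that \<open>antipode H\<close> transposes \<open>u\<close>.\<close>

locale matrix_hopf =
  fixes H :: "'x hopf_cstar" and u :: "'i::finite \<Rightarrow> 'i \<Rightarrow> 'x"
  assumes alg_cstar: "cstar_algebra (alg H)"
    and u_star: "\<And>i j. star (alg H) (u i j) = u i j"
    and u_generates: "generates (alg H) (range (case_prod u))"
    and column_orth: "\<And>i j. (\<Oplus>\<^bsub>alg H\<^esub>k\<in>UNIV. u k i \<otimes>\<^bsub>alg H\<^esub> u k j) = of_bool (i = j) \<odot>\<^bsub>alg H\<^esub> \<one>\<^bsub>alg H\<^esub>"
    and row_orth: "\<And>i j. (\<Oplus>\<^bsub>alg H\<^esub>k\<in>UNIV. u i k \<otimes>\<^bsub>alg H\<^esub> u j k) = of_bool (i = j) \<odot>\<^bsub>alg H\<^esub> \<one>\<^bsub>alg H\<^esub>"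
    and comult_star_hom: "star_hom (alg H) (max_tensor (alg H) (alg H)) (comult H)"
    and comult_u: "\<And>i j. comult H (u i j) = (\<Oplus>\<^bsub>max_tensor (alg H) (alg H)\<^esub>k\<in>UNIV. tensor (alg H) (alg H) (u i k) (u k j))"
    and counit_star_hom: "star_hom (alg H) complex_cstar (counit H)"
    and counit_u: "\<And>i j. counit H (u i j) = of_bool (i = j)"
    and antipode_star_hom: "star_hom (alg H) (opposite (alg H)) (antipode H)"
    and antipode_u: "\<And>i j. antipode H (u i j) = u j i"
begin

abbreviation "A \<equiv> alg H"
abbreviation "AA \<equiv> max_tensor A A"

sublocale A: cstar_algebra A by (rule alg_cstar)
sublocale t: tensor_rep A A AA "tensor A A" by (intro tensor_tensor_rep alg_cstar)
sublocale \<Delta>: cstar_map A AA "comult H" by (intro cstar_mapI alg_cstar t.C.cstar comult_star_hom)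
sublocale \<epsilon>: cstar_map A complex_cstar "counit H"
  by (intro cstar_mapI alg_cstar complex_cstar_algebra counit_star_hom)
sublocale S: cstar_map A "opposite A" "antipode H"
  by (intro cstar_mapI alg_cstar opposite_cstar_algebra antipode_star_hom)

lemma u_closed [simp, intro]: "u i j \<in> carrier A"
  using generates_subset[OF u_generates] by auto

lemma u_in_range: "u i j \<in> range (case_prod u)"
  by (rule image_eqI[of _ _ "(i, j)"]) auto

lemma antipode_closed [simp, intro]: "x \<in> carrier A \<Longrightarrow> antipode H x \<in> carrier A"
  using S.closed by simp

lemma eq_on_u:
  assumes "cstar_algebra B" "star_hom A B f" "star_hom A B g" "\<And>i j. f (u i j) = g (u i j)" "x \<in> carrier A"
  shows "f x = g x"
  by (rule hom_eq_on_generators[OF alg_cstar assms(1-3) u_generates _ assms(5)]) (use assms(4) in auto)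

text \<open>On a generator both sides are the double sum of
  \<open>u i k \<otimes> u k m \<otimes> u m j\<close>, taken in different orders.\<close>

lemma coassociative:
  assumes "x \<in> carrier A"
  shows "tensor_assoc A A A (tensor_map A A AA A (comult H) id (comult H x)) =
    tensor_map A A A AA id (comult H) (comult H x)"
proof -
  let ?AA_A = "max_tensor AA A" and ?A_AA = "max_tensor A AA"
  interpret l: tensor_rep AA A ?AA_A "tensor AA A" by (intro tensor_tensor_rep alg_cstar t.C.cstar)
  interpret r: tensor_rep A AA ?A_AA "tensor A AA" by (intro tensor_tensor_rep alg_cstar t.C.cstar)
  note hl = tensor_map_hom[OF alg_cstar alg_cstar t.C.cstar alg_cstar comult_star_hom star_hom_id]
    and hr = tensor_map_hom[OF alg_cstar alg_cstar alg_cstar t.C.cstar star_hom_id comult_star_hom]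
    and ha = tensor_assoc_hom[OF alg_cstar alg_cstar alg_cstar]
  note vl = tensor_map_tensor[OF alg_cstar alg_cstar t.C.cstar alg_cstar comult_star_hom star_hom_id]
    and vr = tensor_map_tensor[OF alg_cstar alg_cstar alg_cstar t.C.cstar star_hom_id comult_star_hom]
    and va = tensor_assoc_tensor[OF alg_cstar alg_cstar alg_cstar]
  interpret hl: cstar_map AA ?AA_A "tensor_map A A AA A (comult H) id"
    by (intro cstar_mapI t.C.cstar l.C.cstar hl)
  interpret hr: cstar_map AA ?A_AA "tensor_map A A A AA id (comult H)"
    by (intro cstar_mapI t.C.cstar r.C.cstar hr)
  interpret ha: cstar_map ?AA_A ?A_AA "tensor_assoc A A A"
    by (intro cstar_mapI l.C.cstar r.C.cstar ha)
  let ?s = "\<lambda>i j k m. tensor A AA (u i k) (tensor A A (u k m) (u m j))"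
  show ?thesis
  proof (rule eq_on_u[OF r.C.cstar _ _ _ assms])
    show "star_hom A ?A_AA (\<lambda>x. tensor_assoc A A A (tensor_map A A AA A (comult H) id (comult H x)))"
      by (rule star_hom_comp[OF star_hom_comp[OF comult_star_hom hl] ha])
    show "star_hom A ?A_AA (\<lambda>x. tensor_map A A A AA id (comult H) (comult H x))"
      by (rule star_hom_comp[OF comult_star_hom hr])
    fix i j
    have "tensor_assoc A A A (tensor_map A A AA A (comult H) id (comult H (u i j))) =
      (\<Oplus>\<^bsub>?A_AA\<^esub>m\<in>UNIV. \<Oplus>\<^bsub>?A_AA\<^esub>k\<in>UNIV. ?s i j k m)"
      unfolding comult_u
      by (auto simp: hl.finsum ha.finsum vl comult_u l.t_finsum_left va intro!: r.C.finsum_eq)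
    also have "\<dots> = (\<Oplus>\<^bsub>?A_AA\<^esub>k\<in>UNIV. \<Oplus>\<^bsub>?A_AA\<^esub>m\<in>UNIV. ?s i j k m)"
      by (rule r.C.finsum_swap) auto
    also have "\<dots> = tensor_map A A A AA id (comult H) (comult H (u i j))"
      unfolding comult_u
      by (auto simp: hr.finsum vr comult_u r.t_finsum_right intro!: r.C.finsum_eq)
    finally show "tensor_assoc A A A (tensor_map A A AA A (comult H) id (comult H (u i j))) =
      tensor_map A A A AA id (comult H) (comult H (u i j))" .
  qed
qed

lemma counital:
  assumes "x \<in> carrier A"
  shows counital_left: "tensor_map A A complex_cstar A (counit H) id (comult H x) = tensor complex_cstar A 1 x"
    and counital_right: "tensor_map A A A complex_cstar id (counit H) (comult H x) = tensor A complex_cstar x 1"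
proof -
  let ?C = complex_cstar
  note C = complex_cstar_algebra
  interpret l: tensor_rep ?C A "max_tensor ?C A" "tensor ?C A" by (intro tensor_tensor_rep alg_cstar C)
  interpret r: tensor_rep A ?C "max_tensor A ?C" "tensor A ?C" by (intro tensor_tensor_rep alg_cstar C)
  note hl = tensor_map_hom[OF alg_cstar alg_cstar C alg_cstar counit_star_hom star_hom_id]
    and vl = tensor_map_tensor[OF alg_cstar alg_cstar C alg_cstar counit_star_hom star_hom_id]
    and hr = tensor_map_hom[OF alg_cstar alg_cstar alg_cstar C star_hom_id counit_star_hom]
    and vr = tensor_map_tensor[OF alg_cstar alg_cstar alg_cstar C star_hom_id counit_star_hom]
  interpret hl: cstar_map AA "max_tensor ?C A" "tensor_map A A ?C A (counit H) id"
    by (intro cstar_mapI t.C.cstar l.C.cstar hl)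
  interpret hr: cstar_map AA "max_tensor A ?C" "tensor_map A A A ?C id (counit H)"
    by (intro cstar_mapI t.C.cstar r.C.cstar hr)
  show "tensor_map A A ?C A (counit H) id (comult H x) = tensor ?C A 1 x"
  proof (rule eq_on_u[OF l.C.cstar star_hom_comp[OF comult_star_hom hl] l.right_hom[simplified] _ assms])
    fix i j
    have "tensor ?C A (of_bool (i = k)) (u k j) = (if i = k then tensor ?C A 1 (u k j) else \<zero>\<^bsub>max_tensor ?C A\<^esub>)" for k
      using l.t_scale_left[of 1 "u k j" 0] by simp
    then show "tensor_map A A ?C A (counit H) id (comult H (u i j)) = tensor ?C A 1 (u i j)"
      unfolding comult_u by (simp add: hl.finsum vl counit_u l.C.finsum_delta)
  qed
  show "tensor_map A A A ?C id (counit H) (comult H x) = tensor A ?C x 1"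
  proof (rule eq_on_u[OF r.C.cstar star_hom_comp[OF comult_star_hom hr] r.left_hom[simplified] _ assms])
    fix i j
    have "tensor A ?C (u i k) (of_bool (k = j)) = (if k = j then tensor A ?C (u i k) 1 else \<zero>\<^bsub>max_tensor A ?C\<^esub>)" for k
      using r.t_scale_right[of "u i k" 1 0] by simp
    then show "tensor_map A A A ?C id (counit H) (comult H (u i j)) = tensor A ?C (u i j) 1"
      unfolding comult_u by (simp add: hr.finsum vr counit_u r.C.finsum_delta')
  qed
qed

lemma antipode_antipode: "x \<in> carrier A \<Longrightarrow> antipode H (antipode H x) = x"
proof (rule eq_on_u[OF alg_cstar _ star_hom_id, simplified])
  show "star_hom A A (\<lambda>x. antipode H (antipode H x))"
    by (rule star_homI) auto
qed (auto simp: antipode_u)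

section \<open>The antipode axiom on a dense subalgebra\<close>

abbreviation "D \<equiv> star_span A (range (case_prod u))"

lemma D_closed: "x \<in> D \<Longrightarrow> x \<in> carrier A"
  by (rule A.star_span_closed) auto

text \<open>
  The axiom's witnesses for a product in \<open>D\<close> come from those of the factors, but not so for
  adjoints; since the generators are self-adjoint, induction over \<open>D\<close> can avoid adjoints.
\<close>

lemma D_induct [consumes 1, case_names base one add mult scale]:
  assumes x: "x \<in> D"
    and base: "\<And>i j. P (u i j)"
    and one: "P \<one>\<^bsub>A\<^esub>"
    and add: "\<And>x y. x \<in> D \<Longrightarrow> y \<in> D \<Longrightarrow> P x \<Longrightarrow> P y \<Longrightarrow> P (x \<oplus>\<^bsub>A\<^esub> y)"
    and mult: "\<And>x y. x \<in> D \<Longrightarrow> y \<in> D \<Longrightarrow> P x \<Longrightarrow> P y \<Longrightarrow> P (x \<otimes>\<^bsub>A\<^esub> y)"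
    and scale: "\<And>x c. x \<in> D \<Longrightarrow> P x \<Longrightarrow> P (c \<odot>\<^bsub>A\<^esub> x)"
  shows "P x"
proof -
  have "P x \<and> P (star A x)" using x
  proof induction
    case (base x)
    then show ?case using assms(2) by (auto simp: u_star)
  next
    case (add x y)
    then show ?case using assms(4)[of "star A x" "star A y"] assms(4)[of x y]
      by (auto simp: A.adj_add D_closed star_span.star)
  next
    case (mult x y)
    then show ?case using assms(5)[of "star A y" "star A x"] assms(5)[of x y]
      by (auto simp: A.adj_mult D_closed star_span.star)
  next
    case (scale x c)
    then show ?case using assms(6)[of "star A x" "cnj c"] assms(6)[of x c]
      by (auto simp: A.adj_scale D_closed star_span.star)
  next
    case (star x)
    then show ?case by (simp add: D_closed)
  qed (simp add: one)
  then show ?thesis by simp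
qed

lemma antipode_D: "x \<in> D \<Longrightarrow> antipode H x \<in> D"
  by (induction rule: D_induct)
    (auto simp: antipode_u D_closed intro: star_span.intros)

text \<open>The condition of the antipode axiom for a single element, isolated so that it can be
  propagated by induction over \<open>D\<close>.\<close>

definition antipodal :: "'x \<Rightarrow> bool" where
  "antipodal x \<longleftrightarrow> (\<exists>(n::nat) a b. (\<forall>k<n. a k \<in> D \<and> b k \<in> D) \<and>
     comult H x = (\<Oplus>\<^bsub>AA\<^esub>k\<in>{..<n}. tensor A A (a k) (b k)) \<and>
     (\<Oplus>\<^bsub>A\<^esub>k\<in>{..<n}. antipode H (a k) \<otimes>\<^bsub>A\<^esub> b k) = counit H x \<odot>\<^bsub>A\<^esub> \<one>\<^bsub>A\<^esub> \<and>
     (\<Oplus>\<^bsub>A\<^esub>k\<in>{..<n}. a k \<otimes>\<^bsub>A\<^esub> antipode H (b k)) = counit H x \<odot>\<^bsub>A\<^esub> \<one>\<^bsub>A\<^esub>)"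

text \<open>Any finite index set may replace an initial segment of the natural numbers: the
  witnesses for a generator, a sum and a product are indexed by \<open>UNIV\<close>, a disjoint
  union and a product set.\<close>

lemma antipodalI:
  assumes "finite I" and ab: "\<And>k. k \<in> I \<Longrightarrow> a k \<in> D" "\<And>k. k \<in> I \<Longrightarrow> b k \<in> D"
    and "comult H x = (\<Oplus>\<^bsub>AA\<^esub>k\<in>I. tensor A A (a k) (b k))"
    and "(\<Oplus>\<^bsub>A\<^esub>k\<in>I. antipode H (a k) \<otimes>\<^bsub>A\<^esub> b k) = counit H x \<odot>\<^bsub>A\<^esub> \<one>\<^bsub>A\<^esub>"
    and "(\<Oplus>\<^bsub>A\<^esub>k\<in>I. a k \<otimes>\<^bsub>A\<^esub> antipode H (b k)) = counit H x \<odot>\<^bsub>A\<^esub> \<one>\<^bsub>A\<^esub>"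
  shows "antipodal x"
proof -
  obtain h where "bij_betw h {0..<card I} I" using ex_bij_betw_nat_finite[OF assms(1)] by blast
  then have h: "inj_on h {..<card I}" "h ` {..<card I} = I" by (auto simp: bij_betw_def lessThan_atLeast0)
  then have hI: "h k \<in> I" if "k < card I" for k using that by blast
  have reA: "(\<Oplus>\<^bsub>A\<^esub>k\<in>I. f k) = (\<Oplus>\<^bsub>A\<^esub>k\<in>{..<card I}. f (h k))" if "\<And>k. k \<in> I \<Longrightarrow> f k \<in> carrier A" for f
    using A.finsum_reindex[of f h "{..<card I}"] h that by auto
  have reAA: "(\<Oplus>\<^bsub>AA\<^esub>k\<in>I. f k) = (\<Oplus>\<^bsub>AA\<^esub>k\<in>{..<card I}. f (h k))" if "\<And>k. k \<in> I \<Longrightarrow> f k \<in> carrier AA" for f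
    using t.C.finsum_reindex[of f h "{..<card I}"] h that by auto
  show ?thesis
    unfolding antipodal_def
    by (rule exI[of _ "card I"], rule exI[of _ "\<lambda>k. a (h k)"], rule exI[of _ "\<lambda>k. b (h k)"])
      (use assms(4-6) ab hI D_closed in \<open>auto simp: reA reAA\<close>)
qed

lemma antipodalE:
  assumes "antipodal x"
  obtains n a b where "\<forall>k<n. a k \<in> D" "\<forall>k<n. b k \<in> D"
    "comult H x = (\<Oplus>\<^bsub>AA\<^esub>k\<in>{..<(n::nat)}. tensor A A (a k) (b k))"
    "(\<Oplus>\<^bsub>A\<^esub>k\<in>{..<n}. antipode H (a k) \<otimes>\<^bsub>A\<^esub> b k) = counit H x \<odot>\<^bsub>A\<^esub> \<one>\<^bsub>A\<^esub>"
    "(\<Oplus>\<^bsub>A\<^esub>k\<in>{..<n}. a k \<otimes>\<^bsub>A\<^esub> antipode H (b k)) = counit H x \<odot>\<^bsub>A\<^esub> \<one>\<^bsub>A\<^esub>"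
  using assms unfolding antipodal_def by blast

lemma antipodal_u: "antipodal (u i j)"
  by (rule antipodalI[of "UNIV :: 'i set" "\<lambda>k. u i k" "\<lambda>k. u k j"])
    (auto simp: comult_u antipode_u counit_u column_orth row_orth intro: star_span.base u_in_range)

lemma antipodal_one: "antipodal \<one>\<^bsub>A\<^esub>"
  by (rule antipodalI[of "{()}" "\<lambda>_. \<one>\<^bsub>A\<^esub>" "\<lambda>_. \<one>\<^bsub>A\<^esub>"])
    (auto intro: star_span.one)

lemma antipodal_scale:
  assumes "antipodal x" "x \<in> carrier A" shows "antipodal (c \<odot>\<^bsub>A\<^esub> x)"
proof -
  from assms(1) obtain n a b where *: "\<forall>k<n. a k \<in> D" "\<forall>k<n. b k \<in> D"
    "comult H x = (\<Oplus>\<^bsub>AA\<^esub>k\<in>{..<n::nat}. tensor A A (a k) (b k))"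
    "(\<Oplus>\<^bsub>A\<^esub>k\<in>{..<n}. antipode H (a k) \<otimes>\<^bsub>A\<^esub> b k) = counit H x \<odot>\<^bsub>A\<^esub> \<one>\<^bsub>A\<^esub>"
    "(\<Oplus>\<^bsub>A\<^esub>k\<in>{..<n}. a k \<otimes>\<^bsub>A\<^esub> antipode H (b k)) = counit H x \<odot>\<^bsub>A\<^esub> \<one>\<^bsub>A\<^esub>"
    by (rule antipodalE)
  have c: "a k \<in> carrier A" "b k \<in> carrier A" if "k < n" for k using * that D_closed by auto
  show ?thesis
  proof (rule antipodalI[of "{..<n}" "\<lambda>k. c \<odot>\<^bsub>A\<^esub> a k" b])
    show "comult H (c \<odot>\<^bsub>A\<^esub> x) = (\<Oplus>\<^bsub>AA\<^esub>k\<in>{..<n}. tensor A A (c \<odot>\<^bsub>A\<^esub> a k) (b k))"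
    proof -
      have "comult H (c \<odot>\<^bsub>A\<^esub> x) = c \<odot>\<^bsub>AA\<^esub> (\<Oplus>\<^bsub>AA\<^esub>k\<in>{..<n}. tensor A A (a k) (b k))"
        using assms(2) by (simp add: *(3))
      also have "\<dots> = (\<Oplus>\<^bsub>AA\<^esub>k\<in>{..<n}. c \<odot>\<^bsub>AA\<^esub> tensor A A (a k) (b k))"
        using c by (intro t.C.scale_finsum) auto
      also have "\<dots> = (\<Oplus>\<^bsub>AA\<^esub>k\<in>{..<n}. tensor A A (c \<odot>\<^bsub>A\<^esub> a k) (b k))"
        using c by (intro t.C.finsum_eq) (auto simp: t.t_scale_left)
      finally show ?thesis .
    qed
    show "(\<Oplus>\<^bsub>A\<^esub>k\<in>{..<n}. antipode H (c \<odot>\<^bsub>A\<^esub> a k) \<otimes>\<^bsub>A\<^esub> b k) = counit H (c \<odot>\<^bsub>A\<^esub> x) \<odot>\<^bsub>A\<^esub> \<one>\<^bsub>A\<^esub>"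
    proof -
      have "(\<Oplus>\<^bsub>A\<^esub>k\<in>{..<n}. antipode H (c \<odot>\<^bsub>A\<^esub> a k) \<otimes>\<^bsub>A\<^esub> b k) =
        (\<Oplus>\<^bsub>A\<^esub>k\<in>{..<n}. c \<odot>\<^bsub>A\<^esub> (antipode H (a k) \<otimes>\<^bsub>A\<^esub> b k))"
        using c by (intro A.finsum_eq) auto
      also have "\<dots> = c \<odot>\<^bsub>A\<^esub> (\<Oplus>\<^bsub>A\<^esub>k\<in>{..<n}. antipode H (a k) \<otimes>\<^bsub>A\<^esub> b k)"
        using c by (intro A.scale_finsum[symmetric]) auto
      finally show ?thesis using assms(2) by (simp add: *(4))
    qed
    show "(\<Oplus>\<^bsub>A\<^esub>k\<in>{..<n}. c \<odot>\<^bsub>A\<^esub> a k \<otimes>\<^bsub>A\<^esub> antipode H (b k)) = counit H (c \<odot>\<^bsub>A\<^esub> x) \<odot>\<^bsub>A\<^esub> \<one>\<^bsub>A\<^esub>"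
    proof -
      have "(\<Oplus>\<^bsub>A\<^esub>k\<in>{..<n}. c \<odot>\<^bsub>A\<^esub> a k \<otimes>\<^bsub>A\<^esub> antipode H (b k)) =
        (\<Oplus>\<^bsub>A\<^esub>k\<in>{..<n}. c \<odot>\<^bsub>A\<^esub> (a k \<otimes>\<^bsub>A\<^esub> antipode H (b k)))"
        using c by (intro A.finsum_eq) auto
      also have "\<dots> = c \<odot>\<^bsub>A\<^esub> (\<Oplus>\<^bsub>A\<^esub>k\<in>{..<n}. a k \<otimes>\<^bsub>A\<^esub> antipode H (b k))"
        using c by (intro A.scale_finsum[symmetric]) auto
      finally show ?thesis using assms(2) by (simp add: *(5))
    qed
  qed (use * in \<open>auto intro: star_span.scale\<close>)
qed

lemma antipodal_add:
  assumes "antipodal x" "x \<in> carrier A" "antipodal y" "y \<in> carrier A" shows "antipodal (x \<oplus>\<^bsub>A\<^esub> y)"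
proof -
  from assms(1) obtain n a b where *: "\<forall>k<n. a k \<in> D" "\<forall>k<n. b k \<in> D"
    "comult H x = (\<Oplus>\<^bsub>AA\<^esub>k\<in>{..<n::nat}. tensor A A (a k) (b k))"
    "(\<Oplus>\<^bsub>A\<^esub>k\<in>{..<n}. antipode H (a k) \<otimes>\<^bsub>A\<^esub> b k) = counit H x \<odot>\<^bsub>A\<^esub> \<one>\<^bsub>A\<^esub>"
    "(\<Oplus>\<^bsub>A\<^esub>k\<in>{..<n}. a k \<otimes>\<^bsub>A\<^esub> antipode H (b k)) = counit H x \<odot>\<^bsub>A\<^esub> \<one>\<^bsub>A\<^esub>"
    by (rule antipodalE)
  from assms(3) obtain m c d where **: "\<forall>k<m. c k \<in> D" "\<forall>k<m. d k \<in> D"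
    "comult H y = (\<Oplus>\<^bsub>AA\<^esub>k\<in>{..<m::nat}. tensor A A (c k) (d k))"
    "(\<Oplus>\<^bsub>A\<^esub>k\<in>{..<m}. antipode H (c k) \<otimes>\<^bsub>A\<^esub> d k) = counit H y \<odot>\<^bsub>A\<^esub> \<one>\<^bsub>A\<^esub>"
    "(\<Oplus>\<^bsub>A\<^esub>k\<in>{..<m}. c k \<otimes>\<^bsub>A\<^esub> antipode H (d k)) = counit H y \<odot>\<^bsub>A\<^esub> \<one>\<^bsub>A\<^esub>"
    by (rule antipodalE)
  have cl: "a k \<in> carrier A" "b k \<in> carrier A" if "k < n" for k using * that D_closed by auto
  have cl': "c k \<in> carrier A" "d k \<in> carrier A" if "k < m" for k using ** that D_closed by auto
  \<comment> \<open>Disjoint union of the index sets, since the two families of witnesses use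
    overlapping ranges of numbers.\<close>
  define I where "I = Inl ` {..<n} \<union> Inr ` {..<m}"
  have sumA: "(\<Oplus>\<^bsub>A\<^esub>k\<in>I. f k) = (\<Oplus>\<^bsub>A\<^esub>k\<in>{..<n}. f (Inl k)) \<oplus>\<^bsub>A\<^esub> (\<Oplus>\<^bsub>A\<^esub>k\<in>{..<m}. f (Inr k))"
    if "\<And>k. k < n \<Longrightarrow> f (Inl k) \<in> carrier A" "\<And>k. k < m \<Longrightarrow> f (Inr k) \<in> carrier A" for f
  proof -
    have "(\<Oplus>\<^bsub>A\<^esub>k\<in>I. f k) = (\<Oplus>\<^bsub>A\<^esub>k\<in>Inl ` {..<n}. f k) \<oplus>\<^bsub>A\<^esub> (\<Oplus>\<^bsub>A\<^esub>k\<in>Inr ` {..<m}. f k)"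
      unfolding I_def using that by (intro A.finsum_Un_disjoint) auto
    also have "(\<Oplus>\<^bsub>A\<^esub>k\<in>Inl ` {..<n}. f k) = (\<Oplus>\<^bsub>A\<^esub>k\<in>{..<n}. f (Inl k))"
      using that by (intro A.finsum_reindex') auto
    also have "(\<Oplus>\<^bsub>A\<^esub>k\<in>Inr ` {..<m}. f k) = (\<Oplus>\<^bsub>A\<^esub>k\<in>{..<m}. f (Inr k))"
      using that by (intro A.finsum_reindex') auto
    finally show ?thesis .
  qed
  have sumAA: "(\<Oplus>\<^bsub>AA\<^esub>k\<in>I. f k) = (\<Oplus>\<^bsub>AA\<^esub>k\<in>{..<n}. f (Inl k)) \<oplus>\<^bsub>AA\<^esub> (\<Oplus>\<^bsub>AA\<^esub>k\<in>{..<m}. f (Inr k))"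
    if "\<And>k. k < n \<Longrightarrow> f (Inl k) \<in> carrier AA" "\<And>k. k < m \<Longrightarrow> f (Inr k) \<in> carrier AA" for f
  proof -
    have "(\<Oplus>\<^bsub>AA\<^esub>k\<in>I. f k) = (\<Oplus>\<^bsub>AA\<^esub>k\<in>Inl ` {..<n}. f k) \<oplus>\<^bsub>AA\<^esub> (\<Oplus>\<^bsub>AA\<^esub>k\<in>Inr ` {..<m}. f k)"
      unfolding I_def using that by (intro t.C.finsum_Un_disjoint) auto
    also have "(\<Oplus>\<^bsub>AA\<^esub>k\<in>Inl ` {..<n}. f k) = (\<Oplus>\<^bsub>AA\<^esub>k\<in>{..<n}. f (Inl k))"
      using that by (intro t.C.finsum_reindex') auto
    also have "(\<Oplus>\<^bsub>AA\<^esub>k\<in>Inr ` {..<m}. f k) = (\<Oplus>\<^bsub>AA\<^esub>k\<in>{..<m}. f (Inr k))"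
      using that by (intro t.C.finsum_reindex') auto
    finally show ?thesis .
  qed
  show ?thesis
  proof (rule antipodalI[of I "case_sum a c" "case_sum b d"])
    show "finite I" by (simp add: I_def)
    show "case_sum a c k \<in> D" "case_sum b d k \<in> D" if "k \<in> I" for k
      using that * ** by (auto simp: I_def)
  qed (use assms * ** cl cl' in \<open>simp_all add: sumA sumAA A.scale_add_left\<close>)
qed

text \<open>The antipode \<open>S\<close> reverses products: in
  \<open>S (c l) (S (a k) b k) d l\<close> the inner sum over \<open>k\<close> collapses to the
  scalar \<open>counit H x\<close>, then the sum over \<open>l\<close> to \<open>counit H y\<close>.
  For the other identity the nesting is \<open>a k (c l S (d l)) S (b k)\<close>, so the sum over
  \<open>l\<close> collapses first.\<close>

lemma antipodal_mult:
  assumes "antipodal x" "x \<in> carrier A" "antipodal y" "y \<in> carrier A" shows "antipodal (x \<otimes>\<^bsub>A\<^esub> y)"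
proof -
  from assms(1) obtain n a b where *: "\<forall>k<n. a k \<in> D" "\<forall>k<n. b k \<in> D"
    "comult H x = (\<Oplus>\<^bsub>AA\<^esub>k\<in>{..<n::nat}. tensor A A (a k) (b k))"
    "(\<Oplus>\<^bsub>A\<^esub>k\<in>{..<n}. antipode H (a k) \<otimes>\<^bsub>A\<^esub> b k) = counit H x \<odot>\<^bsub>A\<^esub> \<one>\<^bsub>A\<^esub>"
    "(\<Oplus>\<^bsub>A\<^esub>k\<in>{..<n}. a k \<otimes>\<^bsub>A\<^esub> antipode H (b k)) = counit H x \<odot>\<^bsub>A\<^esub> \<one>\<^bsub>A\<^esub>"
    by (rule antipodalE)
  from assms(3) obtain m c d where **: "\<forall>k<m. c k \<in> D" "\<forall>k<m. d k \<in> D"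
    "comult H y = (\<Oplus>\<^bsub>AA\<^esub>k\<in>{..<m::nat}. tensor A A (c k) (d k))"
    "(\<Oplus>\<^bsub>A\<^esub>k\<in>{..<m}. antipode H (c k) \<otimes>\<^bsub>A\<^esub> d k) = counit H y \<odot>\<^bsub>A\<^esub> \<one>\<^bsub>A\<^esub>"
    "(\<Oplus>\<^bsub>A\<^esub>k\<in>{..<m}. c k \<otimes>\<^bsub>A\<^esub> antipode H (d k)) = counit H y \<odot>\<^bsub>A\<^esub> \<one>\<^bsub>A\<^esub>"
    by (rule antipodalE)
  have cl: "a k \<in> carrier A" "b k \<in> carrier A" if "k < n" for k using * that D_closed by auto
  have cl': "c k \<in> carrier A" "d k \<in> carrier A" if "k < m" for k using ** that D_closed by auto
  let ?I = "{..<n} \<times> {..<m}"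
  have sandwich: "(\<Oplus>\<^bsub>A\<^esub>i\<in>I. p \<otimes>\<^bsub>A\<^esub> f i \<otimes>\<^bsub>A\<^esub> q) = p \<otimes>\<^bsub>A\<^esub> (\<Oplus>\<^bsub>A\<^esub>i\<in>I. f i) \<otimes>\<^bsub>A\<^esub> q"
    if "finite I" "p \<in> carrier A" "q \<in> carrier A" "\<And>i. i \<in> I \<Longrightarrow> f i \<in> carrier A" for I :: "nat set" and f p q
    using that by (simp add: A.finsum_ldistr A.finsum_rdistr Pi_def)
  show ?thesis
  proof (rule antipodalI[of ?I "\<lambda>k. a (fst k) \<otimes>\<^bsub>A\<^esub> c (snd k)" "\<lambda>k. b (fst k) \<otimes>\<^bsub>A\<^esub> d (snd k)"])
    have "comult H (x \<otimes>\<^bsub>A\<^esub> y) = (\<Oplus>\<^bsub>AA\<^esub>k\<in>{..<n}. \<Oplus>\<^bsub>AA\<^esub>l\<in>{..<m}. tensor A A (a k) (b k) \<otimes>\<^bsub>AA\<^esub> tensor A A (c l) (d l))"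
      using assms cl cl' by (simp add: *(3) **(3), intro t.C.finsum_mult) auto
    also have "\<dots> = (\<Oplus>\<^bsub>AA\<^esub>k\<in>{..<n}. \<Oplus>\<^bsub>AA\<^esub>l\<in>{..<m}. tensor A A (a k \<otimes>\<^bsub>A\<^esub> c l) (b k \<otimes>\<^bsub>A\<^esub> d l))"
      using cl cl' by (intro t.C.finsum_eq) (auto simp: t.t_mult)
    also have "\<dots> = (\<Oplus>\<^bsub>AA\<^esub>k\<in>?I. tensor A A (a (fst k) \<otimes>\<^bsub>A\<^esub> c (snd k)) (b (fst k) \<otimes>\<^bsub>A\<^esub> d (snd k)))"
      using cl cl' by (intro t.C.finsum_cartesian[symmetric]) auto
    finally show "comult H (x \<otimes>\<^bsub>A\<^esub> y) = \<dots>" .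
  next
    have "(\<Oplus>\<^bsub>A\<^esub>k\<in>?I. antipode H (a (fst k) \<otimes>\<^bsub>A\<^esub> c (snd k)) \<otimes>\<^bsub>A\<^esub> (b (fst k) \<otimes>\<^bsub>A\<^esub> d (snd k))) =
      (\<Oplus>\<^bsub>A\<^esub>k\<in>{..<n}. \<Oplus>\<^bsub>A\<^esub>l\<in>{..<m}. antipode H (a k \<otimes>\<^bsub>A\<^esub> c l) \<otimes>\<^bsub>A\<^esub> (b k \<otimes>\<^bsub>A\<^esub> d l))"
      using cl cl' by (intro A.finsum_cartesian[of _ _ "\<lambda>k l. antipode H (a k \<otimes>\<^bsub>A\<^esub> c l) \<otimes>\<^bsub>A\<^esub> (b k \<otimes>\<^bsub>A\<^esub> d l)"]) auto
    also have "\<dots> = (\<Oplus>\<^bsub>A\<^esub>l\<in>{..<m}. \<Oplus>\<^bsub>A\<^esub>k\<in>{..<n}. antipode H (a k \<otimes>\<^bsub>A\<^esub> c l) \<otimes>\<^bsub>A\<^esub> (b k \<otimes>\<^bsub>A\<^esub> d l))"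
      using cl cl' by (intro A.finsum_swap) auto
    also have "\<dots> = (\<Oplus>\<^bsub>A\<^esub>l\<in>{..<m}. \<Oplus>\<^bsub>A\<^esub>k\<in>{..<n}. antipode H (c l) \<otimes>\<^bsub>A\<^esub> (antipode H (a k) \<otimes>\<^bsub>A\<^esub> b k) \<otimes>\<^bsub>A\<^esub> d l)"
      using cl cl' by (intro A.finsum_eq) (auto simp: A.m_assoc)
    also have "\<dots> = (\<Oplus>\<^bsub>A\<^esub>l\<in>{..<m}. counit H x \<odot>\<^bsub>A\<^esub> (antipode H (c l) \<otimes>\<^bsub>A\<^esub> d l))"
    proof (rule A.finsum_eq)
      fix l assume "l \<in> {..<m}"
      then show "(\<Oplus>\<^bsub>A\<^esub>k\<in>{..<n}. antipode H (c l) \<otimes>\<^bsub>A\<^esub> (antipode H (a k) \<otimes>\<^bsub>A\<^esub> b k) \<otimes>\<^bsub>A\<^esub> d l) =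
        counit H x \<odot>\<^bsub>A\<^esub> (antipode H (c l) \<otimes>\<^bsub>A\<^esub> d l)"
        using cl cl' by (subst sandwich) (auto simp: *(4))
    qed (use cl' in auto)
    also have "\<dots> = counit H x \<odot>\<^bsub>A\<^esub> (\<Oplus>\<^bsub>A\<^esub>l\<in>{..<m}. antipode H (c l) \<otimes>\<^bsub>A\<^esub> d l)"
      using cl cl' by (intro A.scale_finsum[symmetric]) auto
    finally show "(\<Oplus>\<^bsub>A\<^esub>k\<in>?I. antipode H (a (fst k) \<otimes>\<^bsub>A\<^esub> c (snd k)) \<otimes>\<^bsub>A\<^esub> (b (fst k) \<otimes>\<^bsub>A\<^esub> d (snd k))) =
        counit H (x \<otimes>\<^bsub>A\<^esub> y) \<odot>\<^bsub>A\<^esub> \<one>\<^bsub>A\<^esub>"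
      using assms by (simp add: **(4))
  next
    have "(\<Oplus>\<^bsub>A\<^esub>k\<in>?I. (a (fst k) \<otimes>\<^bsub>A\<^esub> c (snd k)) \<otimes>\<^bsub>A\<^esub> antipode H (b (fst k) \<otimes>\<^bsub>A\<^esub> d (snd k))) =
      (\<Oplus>\<^bsub>A\<^esub>k\<in>{..<n}. \<Oplus>\<^bsub>A\<^esub>l\<in>{..<m}. (a k \<otimes>\<^bsub>A\<^esub> c l) \<otimes>\<^bsub>A\<^esub> antipode H (b k \<otimes>\<^bsub>A\<^esub> d l))"
      using cl cl' by (intro A.finsum_cartesian[of _ _ "\<lambda>k l. (a k \<otimes>\<^bsub>A\<^esub> c l) \<otimes>\<^bsub>A\<^esub> antipode H (b k \<otimes>\<^bsub>A\<^esub> d l)"]) auto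
    also have "\<dots> = (\<Oplus>\<^bsub>A\<^esub>k\<in>{..<n}. \<Oplus>\<^bsub>A\<^esub>l\<in>{..<m}. a k \<otimes>\<^bsub>A\<^esub> (c l \<otimes>\<^bsub>A\<^esub> antipode H (d l)) \<otimes>\<^bsub>A\<^esub> antipode H (b k))"
      using cl cl' by (intro A.finsum_eq) (auto simp: A.m_assoc)
    also have "\<dots> = (\<Oplus>\<^bsub>A\<^esub>k\<in>{..<n}. counit H y \<odot>\<^bsub>A\<^esub> (a k \<otimes>\<^bsub>A\<^esub> antipode H (b k)))"
    proof (rule A.finsum_eq)
      fix k assume "k \<in> {..<n}"
      then show "(\<Oplus>\<^bsub>A\<^esub>l\<in>{..<m}. a k \<otimes>\<^bsub>A\<^esub> (c l \<otimes>\<^bsub>A\<^esub> antipode H (d l)) \<otimes>\<^bsub>A\<^esub> antipode H (b k)) =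
        counit H y \<odot>\<^bsub>A\<^esub> (a k \<otimes>\<^bsub>A\<^esub> antipode H (b k))"
        using cl cl' by (subst sandwich) (auto simp: **(5))
    qed (use cl in auto)
    also have "\<dots> = counit H y \<odot>\<^bsub>A\<^esub> (\<Oplus>\<^bsub>A\<^esub>k\<in>{..<n}. a k \<otimes>\<^bsub>A\<^esub> antipode H (b k))"
      using cl cl' by (intro A.scale_finsum[symmetric]) auto
    finally show "(\<Oplus>\<^bsub>A\<^esub>k\<in>?I. (a (fst k) \<otimes>\<^bsub>A\<^esub> c (snd k)) \<otimes>\<^bsub>A\<^esub> antipode H (b (fst k) \<otimes>\<^bsub>A\<^esub> d (snd k))) =
        counit H (x \<otimes>\<^bsub>A\<^esub> y) \<odot>\<^bsub>A\<^esub> \<one>\<^bsub>A\<^esub>"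
      using assms by (simp add: *(5) mult.commute)
  qed (use * ** in \<open>auto intro: star_span.mult\<close>)
qed

lemma antipodal: "x \<in> D \<Longrightarrow> antipodal x"
  by (induction rule: D_induct)
    (auto intro: antipodal_u antipodal_one antipodal_add antipodal_mult antipodal_scale D_closed)

theorem hopf: "hopf_cstar_algebra H"
proof -
  have "star_subalgebra D A" "dense_in D A" "antipode H ` D \<subseteq> D"
    using A.star_subalgebra_star_span[OF generates_subset[OF u_generates]] A.dense_star_span[OF u_generates]
      antipode_D by auto
  then show ?thesis
    unfolding hopf_cstar_algebra_def
    using comult_star_hom counit_star_hom antipode_star_hom antipodal[unfolded antipodal_def]
    by (intro conjI allI impI alg_cstar coassociative counital_left counital_right antipode_antipode
        exI[of _ D] ballI) (simp_all add: cstar_hom_iff)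
qed

end

section \<open>Magic unitaries\<close>

locale magic = star_algebra A for A :: "('x, 'm) star_alg_scheme" (structure) +
  fixes u :: "'i::finite \<Rightarrow> 'i \<Rightarrow> 'x"
  assumes u_closed [simp, intro]: "u i j \<in> carrier A"
    and u_star: "star A (u i j) = u i j"
    and row_mult: "u i j \<otimes> u i k = (if j = k then u i j else \<zero>)"
    and column_mult: "u i j \<otimes> u k j = (if i = k then u i j else \<zero>)"
    and row_sum: "(\<Oplus>j\<in>UNIV. u i j) = \<one>"
    and column_sum: "(\<Oplus>i\<in>UNIV. u i j) = \<one>"
begin

lemma row_orth: "(\<Oplus>k\<in>UNIV. u i k \<otimes> u j k) = of_bool (i = j) \<odot> \<one>"
  by (cases "i = j") (simp_all add: column_mult row_sum)

lemma column_orth: "(\<Oplus>k\<in>UNIV. u k i \<otimes> u k j) = of_bool (i = j) \<odot> \<one>"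
  by (cases "i = j") (simp_all add: row_mult column_sum)

end

definition intertwines :: "('x, 'm) star_alg_scheme \<Rightarrow> ('i::finite \<Rightarrow> 'i \<Rightarrow> complex) \<Rightarrow> ('i \<Rightarrow> 'i \<Rightarrow> 'x) \<Rightarrow> bool" where
  "intertwines A d u \<longleftrightarrow>
     (\<forall>i j. (\<Oplus>\<^bsub>A\<^esub>k\<in>UNIV. d i k \<odot>\<^bsub>A\<^esub> u k j) = (\<Oplus>\<^bsub>A\<^esub>k\<in>UNIV. d k j \<odot>\<^bsub>A\<^esub> u i k))"

abbreviation adj :: "('a::finite \<Rightarrow> 'a \<Rightarrow> bool) \<Rightarrow> 'a \<Rightarrow> 'a \<Rightarrow> complex" where
  "adj X \<equiv> \<lambda>i j. of_bool (X i j)"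

text \<open>With \<open>t\<close> the tensor product this is what makes the comultiplication exist.
  In a product of two entries of one row, the relations of \<open>u\<close> force equal inner
  indices and those of \<open>v\<close> then decide; for columns the roles are exchanged.\<close>

lemma magic_convolution:
  fixes u v :: "'i::finite \<Rightarrow> 'i \<Rightarrow> _"
  assumes "tensor_rep A B C t" "magic A u" "magic B v"
  shows "magic C (\<lambda>i j. \<Oplus>\<^bsub>C\<^esub>k\<in>UNIV. t (u i k) (v k j))"
proof -
  interpret t: tensor_rep A B C t by fact
  interpret u: magic A u by fact
  interpret v: magic B v by fact
  note [simp] = t.t_mult
  note [simp] = t.t_zero_left t.t_zero_right
  show ?thesis
  proof unfold_locales
    fix i j
    show "(\<Oplus>\<^bsub>C\<^esub>k\<in>UNIV. t (u i k) (v k j)) \<in> carrier C" by auto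
    show "star C (\<Oplus>\<^bsub>C\<^esub>k\<in>UNIV. t (u i k) (v k j)) = (\<Oplus>\<^bsub>C\<^esub>k\<in>UNIV. t (u i k) (v k j))"
      by (simp add: t.C.adj_finsum t.t_star u.u_star v.u_star)
  next
    fix i j l
    have "(\<Oplus>\<^bsub>C\<^esub>k\<in>UNIV. t (u i k) (v k j)) \<otimes>\<^bsub>C\<^esub> (\<Oplus>\<^bsub>C\<^esub>m\<in>UNIV. t (u i m) (v m l)) =
      (\<Oplus>\<^bsub>C\<^esub>k\<in>UNIV. \<Oplus>\<^bsub>C\<^esub>m\<in>UNIV. if k = m then t (u i k) (v k j \<otimes>\<^bsub>B\<^esub> v m l) else \<zero>\<^bsub>C\<^esub>)"
      by (subst t.C.finsum_mult) (auto simp: u.row_mult intro!: t.C.finsum_eq)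
    also have "\<dots> = (\<Oplus>\<^bsub>C\<^esub>k\<in>UNIV. if j = l then t (u i k) (v k j) else \<zero>\<^bsub>C\<^esub>)"
      by (intro t.C.finsum_eq) (auto simp: t.C.finsum_delta v.row_mult)
    finally show "(\<Oplus>\<^bsub>C\<^esub>k\<in>UNIV. t (u i k) (v k j)) \<otimes>\<^bsub>C\<^esub> (\<Oplus>\<^bsub>C\<^esub>m\<in>UNIV. t (u i m) (v m l)) =
      (if j = l then \<Oplus>\<^bsub>C\<^esub>k\<in>UNIV. t (u i k) (v k j) else \<zero>\<^bsub>C\<^esub>)"
      by auto
  next
    fix i j l
    have "(\<Oplus>\<^bsub>C\<^esub>k\<in>UNIV. t (u i k) (v k j)) \<otimes>\<^bsub>C\<^esub> (\<Oplus>\<^bsub>C\<^esub>m\<in>UNIV. t (u l m) (v m j)) =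
      (\<Oplus>\<^bsub>C\<^esub>k\<in>UNIV. \<Oplus>\<^bsub>C\<^esub>m\<in>UNIV. if k = m then t (u i k \<otimes>\<^bsub>A\<^esub> u l m) (v k j) else \<zero>\<^bsub>C\<^esub>)"
      by (subst t.C.finsum_mult) (auto simp: v.column_mult intro!: t.C.finsum_eq)
    also have "\<dots> = (\<Oplus>\<^bsub>C\<^esub>k\<in>UNIV. if i = l then t (u i k) (v k j) else \<zero>\<^bsub>C\<^esub>)"
      by (intro t.C.finsum_eq) (auto simp: t.C.finsum_delta u.column_mult)
    finally show "(\<Oplus>\<^bsub>C\<^esub>k\<in>UNIV. t (u i k) (v k j)) \<otimes>\<^bsub>C\<^esub> (\<Oplus>\<^bsub>C\<^esub>m\<in>UNIV. t (u l m) (v m j)) =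
      (if i = l then \<Oplus>\<^bsub>C\<^esub>k\<in>UNIV. t (u i k) (v k j) else \<zero>\<^bsub>C\<^esub>)"
      by auto
  next
    fix i
    have "(\<Oplus>\<^bsub>C\<^esub>j\<in>UNIV. \<Oplus>\<^bsub>C\<^esub>k\<in>UNIV. t (u i k) (v k j)) = (\<Oplus>\<^bsub>C\<^esub>k\<in>UNIV. \<Oplus>\<^bsub>C\<^esub>j\<in>UNIV. t (u i k) (v k j))"
      by (rule t.C.finsum_swap) auto
    also have "\<dots> = (\<Oplus>\<^bsub>C\<^esub>k\<in>UNIV. t (u i k) \<one>\<^bsub>B\<^esub>)"
      by (intro t.C.finsum_eq) (auto simp: v.row_sum simp flip: t.t_finsum_right)
    also have "\<dots> = \<one>\<^bsub>C\<^esub>" by (simp add: u.row_sum flip: t.t_finsum_left)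
    finally show "(\<Oplus>\<^bsub>C\<^esub>j\<in>UNIV. \<Oplus>\<^bsub>C\<^esub>k\<in>UNIV. t (u i k) (v k j)) = \<one>\<^bsub>C\<^esub>" .
  next
    fix j
    have "(\<Oplus>\<^bsub>C\<^esub>i\<in>UNIV. \<Oplus>\<^bsub>C\<^esub>k\<in>UNIV. t (u i k) (v k j)) = (\<Oplus>\<^bsub>C\<^esub>k\<in>UNIV. \<Oplus>\<^bsub>C\<^esub>i\<in>UNIV. t (u i k) (v k j))"
      by (rule t.C.finsum_swap) auto
    also have "\<dots> = (\<Oplus>\<^bsub>C\<^esub>k\<in>UNIV. t \<one>\<^bsub>A\<^esub> (v k j))"
      by (intro t.C.finsum_eq) (auto simp: u.column_sum simp flip: t.t_finsum_left)
    also have "\<dots> = \<one>\<^bsub>C\<^esub>" by (simp add: v.column_sum flip: t.t_finsum_right)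
    finally show "(\<Oplus>\<^bsub>C\<^esub>i\<in>UNIV. \<Oplus>\<^bsub>C\<^esub>k\<in>UNIV. t (u i k) (v k j)) = \<one>\<^bsub>C\<^esub>" .
  qed
qed

text \<open>\<open>d\<close> is moved past \<open>u\<close> in the left leg, carried as a scalar to
  the right leg and moved past \<open>v\<close> there.\<close>

lemma intertwines_convolution:
  fixes u v :: "'i::finite \<Rightarrow> 'i \<Rightarrow> _"
  assumes "tensor_rep A B C t" "magic A u" "magic B v"
    and ud: "intertwines A d u" and vd: "intertwines B d v"
  shows "intertwines C d (\<lambda>i j. \<Oplus>\<^bsub>C\<^esub>k\<in>UNIV. t (u i k) (v k j))"
  unfolding intertwines_def
proof (intro allI)
  interpret t: tensor_rep A B C t by fact
  interpret u: magic A u by fact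
  interpret v: magic B v by fact
  fix i j
  have "(\<Oplus>\<^bsub>C\<^esub>k\<in>UNIV. d i k \<odot>\<^bsub>C\<^esub> (\<Oplus>\<^bsub>C\<^esub>m\<in>UNIV. t (u k m) (v m j))) =
    (\<Oplus>\<^bsub>C\<^esub>k\<in>UNIV. \<Oplus>\<^bsub>C\<^esub>m\<in>UNIV. t (d i k \<odot>\<^bsub>A\<^esub> u k m) (v m j))"
    by (intro t.C.finsum_eq) (auto simp: t.C.scale_finsum t.t_scale_left)
  also have "\<dots> = (\<Oplus>\<^bsub>C\<^esub>m\<in>UNIV. \<Oplus>\<^bsub>C\<^esub>k\<in>UNIV. t (d i k \<odot>\<^bsub>A\<^esub> u k m) (v m j))"
    by (rule t.C.finsum_swap) auto
  also have "\<dots> = (\<Oplus>\<^bsub>C\<^esub>m\<in>UNIV. t (\<Oplus>\<^bsub>A\<^esub>k\<in>UNIV. d i k \<odot>\<^bsub>A\<^esub> u k m) (v m j))"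
    by (intro t.C.finsum_eq t.t_finsum_left[symmetric]) auto
  also have "\<dots> = (\<Oplus>\<^bsub>C\<^esub>m\<in>UNIV. t (\<Oplus>\<^bsub>A\<^esub>k\<in>UNIV. d k m \<odot>\<^bsub>A\<^esub> u i k) (v m j))"
    using ud by (simp add: intertwines_def)
  also have "\<dots> = (\<Oplus>\<^bsub>C\<^esub>m\<in>UNIV. \<Oplus>\<^bsub>C\<^esub>k\<in>UNIV. t (u i k) (d k m \<odot>\<^bsub>B\<^esub> v m j))"
    by (intro t.C.finsum_eq) (auto simp: t.t_finsum_left t.t_scale_left t.t_scale_right)
  also have "\<dots> = (\<Oplus>\<^bsub>C\<^esub>k\<in>UNIV. \<Oplus>\<^bsub>C\<^esub>m\<in>UNIV. t (u i k) (d k m \<odot>\<^bsub>B\<^esub> v m j))"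
    by (rule t.C.finsum_swap) auto
  also have "\<dots> = (\<Oplus>\<^bsub>C\<^esub>k\<in>UNIV. t (u i k) (\<Oplus>\<^bsub>B\<^esub>m\<in>UNIV. d k m \<odot>\<^bsub>B\<^esub> v m j))"
    by (intro t.C.finsum_eq t.t_finsum_right[symmetric]) auto
  also have "\<dots> = (\<Oplus>\<^bsub>C\<^esub>k\<in>UNIV. t (u i k) (\<Oplus>\<^bsub>B\<^esub>m\<in>UNIV. d m j \<odot>\<^bsub>B\<^esub> v k m))"
    using vd by (simp add: intertwines_def)
  also have "\<dots> = (\<Oplus>\<^bsub>C\<^esub>k\<in>UNIV. \<Oplus>\<^bsub>C\<^esub>m\<in>UNIV. d m j \<odot>\<^bsub>C\<^esub> t (u i k) (v k m))"
    by (intro t.C.finsum_eq) (auto simp: t.t_finsum_right t.t_scale_right)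
  also have "\<dots> = (\<Oplus>\<^bsub>C\<^esub>m\<in>UNIV. \<Oplus>\<^bsub>C\<^esub>k\<in>UNIV. d m j \<odot>\<^bsub>C\<^esub> t (u i k) (v k m))"
    by (rule t.C.finsum_swap) auto
  also have "\<dots> = (\<Oplus>\<^bsub>C\<^esub>m\<in>UNIV. d m j \<odot>\<^bsub>C\<^esub> (\<Oplus>\<^bsub>C\<^esub>k\<in>UNIV. t (u i k) (v k m)))"
    by (intro t.C.finsum_eq) (auto simp: t.C.scale_finsum)
  finally show "(\<Oplus>\<^bsub>C\<^esub>k\<in>UNIV. d i k \<odot>\<^bsub>C\<^esub> (\<Oplus>\<^bsub>C\<^esub>m\<in>UNIV. t (u k m) (v m j))) =
    (\<Oplus>\<^bsub>C\<^esub>m\<in>UNIV. d m j \<odot>\<^bsub>C\<^esub> (\<Oplus>\<^bsub>C\<^esub>k\<in>UNIV. t (u i k) (v k m)))" .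
qed

text \<open>The entries are indexed by pairs, as in a Kronecker product. A sum of elementary tensors
  over all pairs factors into the two separate sums.\<close>

lemma magic_pairing:
  fixes u :: "'i::finite \<Rightarrow> 'i \<Rightarrow> _" and v :: "'j::finite \<Rightarrow> 'j \<Rightarrow> _"
  assumes "tensor_rep A B C t" "magic A u" "magic B v"
  shows "magic C (\<lambda>x y. t (u (fst x) (fst y)) (v (snd x) (snd y)))"
proof -
  interpret t: tensor_rep A B C t by fact
  interpret u: magic A u by fact
  interpret v: magic B v by fact
  note [simp] = t.t_zero_left t.t_zero_right
  have sum: "(\<Oplus>\<^bsub>C\<^esub>y\<in>UNIV. t (f (fst y)) (g (snd y))) = t (\<Oplus>\<^bsub>A\<^esub>i\<in>UNIV. f i) (\<Oplus>\<^bsub>B\<^esub>j\<in>UNIV. g j)"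
    if "\<And>i. f i \<in> carrier A" "\<And>j. g j \<in> carrier B" for f :: "'i \<Rightarrow> _" and g :: "'j \<Rightarrow> _"
  proof -
    have "(\<Oplus>\<^bsub>C\<^esub>y\<in>UNIV \<times> UNIV. t (f (fst y)) (g (snd y))) = (\<Oplus>\<^bsub>C\<^esub>i\<in>UNIV. \<Oplus>\<^bsub>C\<^esub>j\<in>UNIV. t (f i) (g j))"
      using that by (intro t.C.finsum_cartesian) auto
    also have "\<dots> = (\<Oplus>\<^bsub>C\<^esub>i\<in>UNIV. t (f i) (\<Oplus>\<^bsub>B\<^esub>j\<in>UNIV. g j))"
      using that by (intro t.C.finsum_eq t.t_finsum_right[symmetric]) auto
    also have "\<dots> = t (\<Oplus>\<^bsub>A\<^esub>i\<in>UNIV. f i) (\<Oplus>\<^bsub>B\<^esub>j\<in>UNIV. g j)"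
      using that by (intro t.t_finsum_left[symmetric]) auto
    finally show ?thesis by simp
  qed
  show ?thesis
    by unfold_locales
      (auto simp: t.t_star u.u_star v.u_star t.t_mult u.row_mult v.row_mult u.column_mult v.column_mult
        prod_eq_iff sum u.row_sum v.row_sum u.column_sum v.column_sum
        sum[of "\<lambda>i. u i _" "\<lambda>j. v j _"])
qed

section \<open>The Hopf algebra of a graph\<close>

lemma graph_relations_iff:
  fixes X :: "'a::finite \<Rightarrow> 'a \<Rightarrow> bool"
  defines "F \<equiv> free_star_alg (UNIV :: ('a \<times> 'a) set)" and "g \<equiv> \<lambda>i j :: 'a. gen (i, j)"
  shows "(\<forall>(l, r)\<in>graph_relations X. P l r) \<longleftrightarrow>
    (\<forall>i j. P (g i j \<otimes>\<^bsub>F\<^esub> g i j) (g i j)) \<and>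
    (\<forall>i j. P (star F (g i j)) (g i j)) \<and>
    (\<forall>i j k. j \<noteq> k \<longrightarrow> P (g i j \<otimes>\<^bsub>F\<^esub> g i k) \<zero>\<^bsub>F\<^esub>) \<and>
    (\<forall>i j k. i \<noteq> k \<longrightarrow> P (g i j \<otimes>\<^bsub>F\<^esub> g k j) \<zero>\<^bsub>F\<^esub>) \<and>
    (\<forall>i. P (\<Oplus>\<^bsub>F\<^esub>j\<in>UNIV. g i j) \<one>\<^bsub>F\<^esub>) \<and>
    (\<forall>j. P (\<Oplus>\<^bsub>F\<^esub>i\<in>UNIV. g i j) \<one>\<^bsub>F\<^esub>) \<and>
    (\<forall>i j. P (\<Oplus>\<^bsub>F\<^esub>k\<in>UNIV. adj X i k \<odot>\<^bsub>F\<^esub> g k j) (\<Oplus>\<^bsub>F\<^esub>k\<in>UNIV. adj X k j \<odot>\<^bsub>F\<^esub> g i k))"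
  unfolding graph_relations_def magic_unitary_relations_def commutation_relations_def
    ball_Un adjacency_def vec_lambda_beta F_def g_def
  by (simp add: conj_assoc, intro conj_cong) (blast+)?

locale graph_presentation =
  fixes X :: "'a::finite \<Rightarrow> 'a \<Rightarrow> bool"
begin

abbreviation "F \<equiv> free_star_alg (UNIV :: ('a \<times> 'a) set)"

sublocale F: star_algebra F by (rule free_star_algebra)

lemmas relations_iff = graph_relations_iff[of X]

lemma respects_relations_iff:
  assumes "star_algebra B" "star_hom F B e"
  shows "(\<forall>(l, r)\<in>graph_relations X. e l = e r) \<longleftrightarrow>
    magic B (\<lambda>i j. e (gen (i, j))) \<and> intertwines B (adj X) (\<lambda>i j. e (gen (i, j)))"
proof -
  interpret B: star_algebra B by fact
  interpret e: star_map F B e by unfold_locales fact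
  show ?thesis
    unfolding relations_iff magic_def magic_axioms_def intertwines_def
    by (simp add: e.finsum B.star_algebra_axioms) (safe; metis)
qed

sublocale U: bounded_relations "UNIV :: ('a \<times> 'a) set" "graph_relations X"
proof
  have "\<forall>(l, r)\<in>graph_relations X. l \<in> carrier F \<and> r \<in> carrier F"
    unfolding relations_iff by auto
  then show "l \<in> carrier F \<and> r \<in> carrier F" if "(l, r) \<in> graph_relations X" for l r
    using that by blast
  fix g :: "'a \<times> 'a"
  \<comment> \<open>Up to \<open>p\<close> the generator is a projection, so the C*-identity gives
    \<open>(p (gen g))\<^sup>2 = p (gen g)\<close>.\<close>
  have "p (gen g) \<le> 1" if p: "admissible UNIV (graph_relations X) p" for p
  proof -
    interpret p: star_seminorm F p by unfold_locales (use p in \<open>simp add: admissible_def\<close>)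
    obtain i j where g: "g = (i, j)" by fastforce
    have "\<forall>(l, r)\<in>graph_relations X. p (l \<ominus>\<^bsub>F\<^esub> r) = 0" using p by (simp add: admissible_def)
    then have r: "p (gen g \<otimes>\<^bsub>F\<^esub> gen g \<ominus>\<^bsub>F\<^esub> gen g) = 0" "p (star F (gen g) \<ominus>\<^bsub>F\<^esub> gen g) = 0"
      unfolding relations_iff g by auto
    have c: "gen g \<in> carrier F" by auto
    have "p (star F (gen g) \<otimes>\<^bsub>F\<^esub> gen g \<ominus>\<^bsub>F\<^esub> gen g \<otimes>\<^bsub>F\<^esub> gen g) \<le> 0"
      using p.p_mult_diff[of "star F (gen g)" "gen g" "gen g" "gen g"] r c by simp
    moreover have "\<bar>p (star F (gen g) \<otimes>\<^bsub>F\<^esub> gen g) - p (gen g \<otimes>\<^bsub>F\<^esub> gen g)\<bar> \<le>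
        p (star F (gen g) \<otimes>\<^bsub>F\<^esub> gen g \<ominus>\<^bsub>F\<^esub> gen g \<otimes>\<^bsub>F\<^esub> gen g)"
      "\<bar>p (gen g \<otimes>\<^bsub>F\<^esub> gen g) - p (gen g)\<bar> \<le> p (gen g \<otimes>\<^bsub>F\<^esub> gen g \<ominus>\<^bsub>F\<^esub> gen g)"
      using c by (intro p.p_abs_diff; simp)+
    ultimately have "(p (gen g))\<^sup>2 = p (gen g)"
      using p.p_star_mult[OF c] r(1) by linarith
    then show ?thesis
      by (metis dual_order.refl less_eq_real_def mult_cancel_right1 power2_eq_square zero_le_one)
  qed
  then show "\<exists>C. \<forall>p. admissible UNIV (graph_relations X) p \<longrightarrow> p (gen g) \<le> C" by blast
qed

end

lemma graph_cstar_algebra: "cstar_algebra (graph_cstar X)"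
proof -
  interpret graph_presentation X .
  show ?thesis unfolding graph_cstar_def by (rule U.U_cstar)
qed

lemma graph_gen:
  shows graph_gen_magic: "magic (graph_cstar X) (graph_gen X)"
    and graph_gen_intertwines: "intertwines (graph_cstar X) (adj X) (graph_gen X)"
proof -
  interpret graph_presentation X .
  have "magic U.U (\<lambda>i j. U.image (gen (i, j))) \<and> intertwines U.U (adj X) (\<lambda>i j. U.image (gen (i, j)))"
    using U.image_relation
    by (subst respects_relations_iff[OF U.U.star_algebra_axioms U.image_hom, symmetric]) auto
  then show "magic (graph_cstar X) (graph_gen X)" "intertwines (graph_cstar X) (adj X) (graph_gen X)"
    by (simp_all add: U.image_gen graph_cstar_def graph_gen_def[abs_def])
qed

lemma graph_generates: "generates (graph_cstar X) (range (case_prod (graph_gen X)))"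
proof -
  interpret graph_presentation X .
  have "range (case_prod (graph_gen X)) = range (universal_gen UNIV (graph_relations X))"
    by (rule image_cong) (auto simp: graph_gen_def)
  then show ?thesis using U.U_generates by (simp add: graph_cstar_def)
qed

lemma graph_hom_ex:
  assumes B: "cstar_algebra B" and b: "magic B b" "intertwines B (adj X) b"
  shows "\<exists>f. f \<in> cstar_hom (graph_cstar X) B \<and> (\<forall>i j. f (graph_gen X i j) = b i j)"
proof -
  interpret graph_presentation X .
  interpret B: cstar_algebra B by (rule B)
  interpret b: magic B b by (rule b)
  interpret E: free_eval UNIV B "case_prod b" by unfold_locales auto
  have eq: "E.eval_at (gen (i, j)) = b i j" for i j by (simp add: E.eval_gen)
  have "\<forall>(l, r)\<in>graph_relations X. E.eval_at l = E.eval_at r"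
    using b by (subst respects_relations_iff[OF B.star_algebra_axioms E.eval_hom]) (simp add: eq)
  then obtain f where f: "star_hom U.U B f" "\<And>x. x \<in> carrier F \<Longrightarrow> f (U.image x) = E.eval_at x"
    using U.universal_property[OF B E.eval_hom] by blast
  have "f (graph_gen X i j) = b i j" for i j
    using f(2)[of "gen (i, j)"] by (simp add: eq graph_gen_def U.image_gen)
  then show ?thesis using f by (auto simp: cstar_hom_iff graph_cstar_def)
qed

lemma magic_identity: "magic complex_cstar (\<lambda>i j :: 'i::finite. of_bool (i = j))"
proof -
  interpret cstar_algebra complex_cstar by (rule complex_cstar_algebra)
  show ?thesis by unfold_locales auto
qed

lemma intertwines_identity: "intertwines complex_cstar d (\<lambda>i j :: 'i::finite. of_bool (i = j))"
  by (simp add: intertwines_def)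

lemma magic_transpose: assumes "cstar_algebra A" "magic A u" shows "magic (opposite A) (\<lambda>i j. u j i)"
proof -
  interpret u: magic A u by fact
  interpret O: cstar_algebra "opposite A" by (rule opposite_cstar_algebra) fact
  show ?thesis
    by unfold_locales (auto simp: u.u_star u.row_mult u.column_mult u.row_sum u.column_sum)
qed

text \<open>Transposition turns the relation for the matrix of \<open>X\<close> into that for its
  transpose, which is the same matrix as \<open>X\<close> is symmetric.\<close>

lemma intertwines_transpose:
  assumes "symp X" "intertwines A (adj X) u" shows "intertwines (opposite A) (adj X) (\<lambda>i j. u j i)"
proof -
  have "adj X i j = adj X j i" for i j using assms(1) by (auto dest: sympD)
  then show ?thesis using assms(2) by (simp add: intertwines_def)
qed

text \<open>The choices by \<open>SOME\<close> in \<open>graph_hopf\<close> are met because the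
  convolution of \<open>u\<close> with itself, the identity matrix and the transpose of
  \<open>u\<close> are again magic unitaries intertwining the adjacency matrix.\<close>

lemma graph_matrix_hopf:
  assumes X: "symp X"
  shows "matrix_hopf (graph_hopf X) (graph_gen X)"
proof -
  let ?A = "graph_cstar X" and ?u = "graph_gen X"
  interpret A: cstar_algebra ?A by (rule graph_cstar_algebra)
  interpret u: magic ?A ?u by (rule graph_gen_magic)
  note d = graph_gen_intertwines[of X]
  have t: "tensor_rep ?A ?A (max_tensor ?A ?A) (tensor ?A ?A)" by (intro tensor_tensor_rep A.cstar)
  have AA: "cstar_algebra (max_tensor ?A ?A)" by (intro max_tensor_cstar_algebra A.cstar)
  note comult = someI_ex[OF graph_hom_ex[OF AA magic_convolution[OF t u.magic_axioms u.magic_axioms]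
    intertwines_convolution[OF t u.magic_axioms u.magic_axioms d d]]]
    and counit = someI_ex[OF graph_hom_ex[OF complex_cstar_algebra magic_identity intertwines_identity, of X]]
    and antipode = someI_ex[OF graph_hom_ex[OF opposite_cstar_algebra[OF A.cstar]
      magic_transpose[OF A.cstar u.magic_axioms] intertwines_transpose[OF X d]]]
  have alg: "alg (graph_hopf X) = ?A" by (simp add: graph_hopf_def Let_def)
  show ?thesis
    unfolding matrix_hopf_def alg
    using comult counit antipode A.cstar u.u_star graph_generates u.column_orth u.row_orth
    by (simp add: graph_hopf_def Let_def cstar_hom_iff)
qed

section \<open>Eigenvectors of Hermitian matrices\<close>

text \<open>\<open>p(M) v\<close> by Horner's scheme; no powers of the matrix are formed.\<close>

definition poly_act :: "complex^'n^'n \<Rightarrow> complex poly \<Rightarrow> complex^'n \<Rightarrow> complex^'n" where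
  "poly_act M p v = fold_coeffs (\<lambda>a w. a *s v + M *v w) p 0"

lemma matrix_vector_scale: "M *v (c *s v) = c *s (M *v (v :: complex^'n))"
  by (rule vec.linear_scale[OF matrix_vector_mul_linear_gen])

lemma poly_act_0 [simp]: "poly_act M 0 v = 0"
  by (simp add: poly_act_def)

lemma poly_act_pCons [simp]: "poly_act M (pCons a p) v = a *s v + M *v poly_act M p v"
  by (cases "p = 0 \<and> a = 0") (auto simp: poly_act_def)

lemma poly_act_add: "poly_act M (p + q) v = poly_act M p v + poly_act M q v"
  by (induction p q rule: poly_induct2)
    (simp_all add: matrix_vector_right_distrib vec.scale_left_distrib)

lemma poly_act_smult: "poly_act M (Polynomial.smult c p) v = c *s poly_act M p v"
  by (induction p) (simp_all add: vec.scale_right_distrib matrix_vector_scale)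

lemma poly_act_apply: "poly_act M p (M *v v - a *s v) = M *v poly_act M p v - a *s poly_act M p v"
proof (induction p)
  case (pCons c p)
  show ?case
    unfolding poly_act_pCons pCons.IH
    by (simp add: matrix_vector_right_distrib matrix_vector_mult_diff_distrib matrix_vector_scale
        vec.scale_right_distrib vec.scale_right_diff_distrib algebra_simps)
qed simp

lemma poly_act_linear_factor:
  "poly_act M ([:- a, 1:] * q) v = poly_act M q (M *v v - a *s v)"
proof -
  have "[:- a, 1:] * q = pCons 0 q + Polynomial.smult (- a) q" by simp
  then show ?thesis
    by (simp only: poly_act_add poly_act_smult poly_act_apply poly_act_pCons) simp
qed

lemma poly_act_monom: "poly_act M (Polynomial.monom 1 i) v = ((*v) M ^^ i) v"
  by (induction i) (simp_all add: monom_Suc monom_0)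

text \<open>Otherwise the vectors \<open>v\<close>, \<open>M v\<close>, \<open>M (M v)\<close> and
  so on would be independent in any number, more than the dimension allows.\<close>

lemma annihilating_poly: "\<exists>p. p \<noteq> 0 \<and> poly_act M p (v :: complex^'n) = 0"
proof (rule ccontr)
  assume none: "\<not> ?thesis"
  let ?w = "\<lambda>i. ((*v) M ^^ i) v"
  \<comment> \<open>The cardinality is part of the induction, as independence of the image set alone
    would tolerate repeated vectors.\<close>
  have "vec.independent (?w ` {..<k}) \<and> card (?w ` {..<k}) = k" for k
  proof (induction k)
    case 0
    show ?case by (simp add: vec.independent_empty)
  next
    case (Suc k)
    have rep: "\<exists>q. (\<forall>j\<ge>k. Polynomial.coeff q j = 0) \<and> x = poly_act M q v" if "x \<in> vec.span (?w ` {..<k})" for x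
      using that
    proof (induction rule: vec.span_induct_alt)
      case base
      show ?case by (rule exI[of _ 0]) simp
    next
      case (step c x y)
      then obtain q i where q: "\<forall>j\<ge>k. Polynomial.coeff q j = 0" "y = poly_act M q v" "i < k" "x = ?w i" by auto
      then show ?case
        by (intro exI[of _ "Polynomial.smult c (Polynomial.monom 1 i) + q"])
          (auto simp: poly_act_add poly_act_smult poly_act_monom)
    qed
    have "?w k \<notin> vec.span (?w ` {..<k})"
    proof
      assume "?w k \<in> vec.span (?w ` {..<k})"
      then obtain q where q: "\<forall>j\<ge>k. Polynomial.coeff q j = 0" "?w k = poly_act M q v" using rep by blast
      \<comment> \<open>The coefficients of \<open>q\<close> stop below \<open>k\<close>, so
        subtracting \<open>q\<close> leaves the leading term intact and the annihilating polynomial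
        is not zero.\<close>
      have "Polynomial.coeff (Polynomial.monom 1 k + Polynomial.smult (-1) q) k = 1" using q by simp
      then have "Polynomial.monom 1 k + Polynomial.smult (-1) q \<noteq> 0" by (metis coeff_0 zero_neq_one)
      moreover have "poly_act M (Polynomial.monom 1 k + Polynomial.smult (-1) q) v = 0"
        by (simp only: poly_act_add poly_act_smult poly_act_monom q(2)) simp
      ultimately show False using none by blast
    qed
    then have "vec.independent (insert (?w k) (?w ` {..<k}))"
      using Suc by (intro vec.independent_insertI) auto
    moreover have "?w k \<notin> ?w ` {..<k}"
      using \<open>?w k \<notin> vec.span (?w ` {..<k})\<close> by (rule contrapos_nn) (rule vec.span_base)
    ultimately show ?case using Suc by (simp add: lessThan_Suc)
  qed
  from this[of "Suc (vec.dim (UNIV :: (complex^'n) set))"] show False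
    using vec.independent_card_le_dim[of "?w ` {..<Suc (vec.dim (UNIV :: (complex^'n) set))}" UNIV] by simp
qed

text \<open>A Hermitian matrix has no generalised eigenvectors beyond the eigenvectors. With the
  Hermitian form \<open>H\<close>, \<open>H e e = (cnj a - a) * H z e\<close>, while
  \<open>(a - cnj a) * H e e = 0\<close>; for real \<open>a\<close> the first equation and for other
  \<open>a\<close> the second gives \<open>H e e = 0\<close>.\<close>

lemma hermitian_kernel_square:
  fixes M :: "complex^'n^'n"
  assumes herm: "\<And>i j. M $ i $ j = cnj (M $ j $ i)"
    and e: "M *v e = a *s e" and z: "M *v z - a *s z = e"
  shows "e = 0"
proof -
  define H where "H v w = (\<Sum>i\<in>UNIV. v $ i * cnj (w $ i))" for v w :: "complex^'n"
  have H_pos: "w = 0" if "H w w = 0" for w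
  proof -
    have "H w w = of_real (\<Sum>i\<in>UNIV. (cmod (w $ i))\<^sup>2)"
      unfolding H_def of_real_sum by (intro sum.cong) (auto simp: complex_norm_square[symmetric])
    then have "(\<Sum>i\<in>UNIV. (cmod (w $ i))\<^sup>2) = 0" using that by (metis of_real_eq_0_iff)
    then show ?thesis by (subst (asm) sum_nonneg_eq_0_iff) (auto simp: vec_eq_iff)
  qed
  have H_sym: "H (M *v v) w = H v (M *v w)" for v w
  proof -
    have "H (M *v v) w = (\<Sum>i\<in>UNIV. \<Sum>j\<in>UNIV. M $ i $ j * v $ j * cnj (w $ i))"
      by (simp add: H_def matrix_vector_mult_def sum_distrib_right)
    also have "\<dots> = (\<Sum>j\<in>UNIV. \<Sum>i\<in>UNIV. M $ i $ j * v $ j * cnj (w $ i))" by (rule sum.swap)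
    also have "\<dots> = H v (M *v w)"
      unfolding H_def matrix_vector_mult_def
      by (intro sum.cong) (auto simp: sum_distrib_left herm[symmetric] mult_ac)
    finally show ?thesis .
  qed
  have H_lin: "H (v - w) x = H v x - H w x" "H (c *s v) x = c * H v x"
    "H x (c *s v) = cnj c * H x v" for v w x c
    by (simp_all add: H_def algebra_simps sum_subtractf sum_distrib_left)
  have "a * H e e = cnj a * H e e"
    using H_sym[of e e] by (simp add: e H_lin)
  moreover have "H e e = H (M *v z) e - a * H z e"
    by (subst (1) z[symmetric]) (simp add: H_lin)
  then have "H e e = (cnj a - a) * H z e"
    by (simp add: H_sym e H_lin algebra_simps)
  ultimately have "H e e = 0" by auto
  then show ?thesis by (rule H_pos)
qed

text \<open>Induction on the degree of an annihilating polynomial: split off a factor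
  \<open>X - a\<close>, decompose \<open>(M - a) v\<close>, and divide its components for
  \<open>l \<noteq> a\<close> by \<open>l - a\<close>. What remains of \<open>v\<close> is mapped by
  \<open>M - a\<close> into the kernel of \<open>M - a\<close>, hence to zero by
  \<open>hermitian_kernel_square\<close>. Components may be zero, so \<open>S\<close> may contain
  numbers outside the spectrum.\<close>

lemma hermitian_eigenvector_sum:
  fixes M :: "complex^'n^'n"
  assumes herm: "\<And>i j. M $ i $ j = cnj (M $ j $ i)"
  shows "\<exists>S x. finite S \<and> (\<forall>l\<in>S. M *v x l = l *s x l) \<and> v = (\<Sum>l\<in>S. x l)"
proof -
  have "\<exists>S x. finite S \<and> (\<forall>l\<in>S. M *v x l = l *s x l) \<and> v = (\<Sum>l\<in>S. x l)"
    if "p \<noteq> 0" "poly_act M p v = 0" for p v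
    using that
  proof (induction "degree p" arbitrary: p v rule: less_induct)
    case less
    show ?case
    proof (cases "degree p = 0")
      case True
      then obtain c where "p = [:c:]" by (metis degree_eq_zeroE)
      then have "v = 0" using less.prems by simp
      then show ?thesis by (intro exI[of _ "{}"]) auto
    next
      case False
      then have "\<not> constant (poly p)" by (simp add: constant_degree)
      then obtain a where "poly p a = 0" using fundamental_theorem_of_algebra by blast
      then obtain q where p: "p = [:- a, 1:] * q" by (auto simp: poly_eq_0_iff_dvd)
      have "q \<noteq> 0" using less.prems p by auto
      then have "degree q < degree p" by (simp add: p degree_mult_eq del: mult_pCons_left)
      moreover have "poly_act M q (M *v v - a *s v) = 0"
        using less.prems unfolding p poly_act_linear_factor by simp
      ultimately obtain S x where S: "finite S" "\<forall>l\<in>S. M *v x l = l *s x l"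
        "M *v v - a *s v = (\<Sum>l\<in>S. x l)"
        using less.hyps[OF _ \<open>q \<noteq> 0\<close>] by meson
      \<comment> \<open>Solves \<open>(M - a) (y l) = x l\<close> for \<open>l \<noteq> a\<close>;
        at \<open>l = a\<close> the inverse of \<open>0\<close> makes \<open>y a\<close> zero, and
        this value is later replaced by \<open>z\<close>.\<close>
      define y where "y l = inverse (l - a) *s x l" for l
      define z where "z = v - (\<Sum>l\<in>S - {a}. y l)"
      \<comment> \<open>Zero when \<open>a\<close> is no index, so that both cases are treated
        together.\<close>
      define e where "e = (if a \<in> S then x a else 0)"
      have y: "M *v y l = l *s y l" if "l \<in> S" for l
        using S(2) that by (simp add: y_def matrix_vector_scale vec.scale_left_commute)
      have "M *v y l - a *s y l = x l" if "l \<in> S - {a}" for l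
      proof -
        have "M *v y l - a *s y l = (l - a) *s y l" using y that by (simp add: vec.scale_left_diff_distrib)
        then show ?thesis using that by (simp add: y_def)
      qed
      then have "(\<Sum>l\<in>S - {a}. M *v y l - a *s y l) = (\<Sum>l\<in>S - {a}. x l)" by (intro sum.cong) auto
      moreover have "M *v (\<Sum>l\<in>S - {a}. y l) = (\<Sum>l\<in>S - {a}. M *v y l)"
        by (rule vec.linear_sum[OF matrix_vector_mul_linear_gen])
      ultimately have "M *v (\<Sum>l\<in>S - {a}. y l) - a *s (\<Sum>l\<in>S - {a}. y l) = (\<Sum>l\<in>S - {a}. x l)"
        by (simp add: vec.scale_sum_right sum_subtractf)
      moreover have "M *v z - a *s z =
        (M *v v - a *s v) - (M *v (\<Sum>l\<in>S - {a}. y l) - a *s (\<Sum>l\<in>S - {a}. y l))"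
        by (simp add: z_def matrix_vector_mult_diff_distrib vec.scale_right_diff_distrib)
      ultimately have "M *v z - a *s z = (M *v v - a *s v) - (\<Sum>l\<in>S - {a}. x l)"
        by (simp only:)
      also have "\<dots> = e"
        unfolding S(3) e_def using S(1) by (simp add: sum_diff1)
      finally have z: "M *v z - a *s z = e" .
      have "M *v e = a *s e" using S(2) by (simp add: e_def)
      then have "e = 0" using hermitian_kernel_square[OF herm _ z] by blast
      then have "M *v z = a *s z" using z by simp
      then have "\<forall>l\<in>insert a S. M *v (y(a := z)) l = l *s (y(a := z)) l" using y by auto
      moreover have "v = (\<Sum>l\<in>insert a S. (y(a := z)) l)"
      proof -
        have "(\<Sum>l\<in>insert a S. (y(a := z)) l) = z + (\<Sum>l\<in>S - {a}. (y(a := z)) l)"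
          using S(1) by (subst sum.insert_remove) auto
        also have "(\<Sum>l\<in>S - {a}. (y(a := z)) l) = (\<Sum>l\<in>S - {a}. y l)" by (rule sum.cong) auto
        finally show ?thesis by (simp add: z_def)
      qed
      ultimately show ?thesis using S(1) by (intro exI[of _ "insert a S"] exI[of _ "y(a := z)"]) auto
    qed
  qed
  then show ?thesis using annihilating_poly[of M v] by blast
qed

section \<open>Eigenfunctions of a graph\<close>

definition eigenfunction :: "('a::finite \<Rightarrow> 'a \<Rightarrow> bool) \<Rightarrow> complex \<Rightarrow> ('a \<Rightarrow> complex) \<Rightarrow> bool" where
  "eigenfunction X l f \<longleftrightarrow> (\<forall>i. (\<Sum>j\<in>UNIV. adj X i j * f j) = l * f i)"

lemma eigenfunction_iff: "eigenfunction X l f \<longleftrightarrow> adjacency X *v (\<chi> i. f i) = l *s (\<chi> i. f i)"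
  by (simp add: eigenfunction_def adjacency_def matrix_vector_mult_def vec_eq_iff)

lemma eigenfunction_spectrum:
  assumes "eigenfunction X l f" "f i \<noteq> 0" shows "l \<in> graph_spectrum X"
proof -
  have "(\<chi> i. f i) \<noteq> 0" using assms(2) by (auto simp: vec_eq_iff)
  then show ?thesis using assms(1) by (auto simp: spectrum_def eigenfunction_iff)
qed

lemma eigenfunction_sum_unit:
  fixes X :: "'a::finite \<Rightarrow> 'a \<Rightarrow> bool"
  assumes "symp X"
  obtains S x where "finite S" "\<And>l. l \<in> S \<Longrightarrow> eigenfunction X l (x l)" "\<And>j. of_bool (j = i) = (\<Sum>l\<in>S. x l j)"
proof -
  have "adjacency X $ i $ j = cnj (adjacency X $ j $ i)" for i j
    using assms by (auto simp: adjacency_def dest: sympD)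
  from hermitian_eigenvector_sum[OF this, of "\<chi> j. of_bool (j = i)"]
  obtain S x where S: "finite S" "\<forall>l\<in>S. adjacency X *v x l = l *s x l" "(\<chi> j. of_bool (j = i)) = (\<Sum>l\<in>S. x l)"
    by blast
  have "eigenfunction X l (\<lambda>j. x l $ j)" if "l \<in> S" for l using S(2) that by (simp add: eigenfunction_iff)
  moreover have "of_bool (j = i) = (\<Sum>l\<in>S. x l $ j)" for j
    using arg_cong[OF S(3), of "\<lambda>v. v $ j"] by simp
  ultimately show ?thesis using S(1) that[of S "\<lambda>l j. x l $ j"] by blast
qed

text \<open>
  On a connected regular graph of degree \<open>k\<close> the eigenfunctions for \<open>k\<close> are constant, since
  \<open>\<Sum>\<^bsub>i \<sim> j\<^esub> \<bar>f i - f j\<bar>\<^sup>2 = 0\<close>, and the others are orthogonal to the constants.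
\<close>

lemma eigenfunction_total:
  fixes X :: "'a::finite \<Rightarrow> 'a \<Rightarrow> bool"
  assumes sym: "symp X" and con: "connected_graph X" and reg: "regular_graph X"
  obtains s where "\<And>l f i. eigenfunction X l f \<Longrightarrow> (\<Sum>j\<in>UNIV. f j) = s l * f i"
proof -
  obtain k where k: "\<And>i. card {j. X i j} = k" using reg by (auto simp: regular_graph_def)
  have adj_sym: "adj X i j = adj X j i" for i j using sym by (auto dest: sympD)
  have row: "(\<Sum>j\<in>UNIV. adj X i j) = of_nat k" for i
    using k[of i] by simp
  \<comment> \<open>The scalar by which the all-ones matrix acts: the number of vertices for
    \<open>l = k\<close>, where \<open>f\<close> is constant, and \<open>0\<close> for every other
    eigenvalue.\<close>
  have total: "(\<Sum>j\<in>UNIV. f j) = (if l = of_nat k then of_nat CARD('a) else 0) * f i"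
    if f: "eigenfunction X l f" for l f i
  proof (cases "l = of_nat k")
    case False
    \<comment> \<open>Summing the eigenvalue equation over all vertices counts each
      \<open>f j\<close> exactly \<open>k\<close> times, so \<open>l\<close> times the total equals
      \<open>k\<close> times the total.\<close>
    have "l * (\<Sum>i\<in>UNIV. f i) = (\<Sum>i\<in>UNIV. \<Sum>j\<in>UNIV. adj X i j * f j)"
      using f by (simp add: eigenfunction_def sum_distrib_left)
    also have "\<dots> = (\<Sum>j\<in>UNIV. \<Sum>i\<in>UNIV. adj X j i * f j)" by (subst sum.swap) (simp only: adj_sym)
    also have "\<dots> = of_nat k * (\<Sum>j\<in>UNIV. f j)"
      by (simp only: sum_distrib_right[symmetric] row sum_distrib_left)
    finally show ?thesis using False by simp
  next
    case True
    have inner: "(\<Sum>j\<in>UNIV. adj X i j * f j) = of_nat k * f i" for i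
      using f True by (simp add: eigenfunction_def)
    have inner': "(\<Sum>j\<in>UNIV. adj X i j * cnj (f j)) = of_nat k * cnj (f i)" for i
      using arg_cong[OF inner[of i], of cnj] by simp
    have "of_real (\<Sum>i\<in>UNIV. \<Sum>j\<in>UNIV. of_bool (X i j) * (cmod (f i - f j))\<^sup>2) =
      (\<Sum>i\<in>UNIV. \<Sum>j\<in>UNIV. adj X i j * ((f i - f j) * cnj (f i - f j)))"
      unfolding of_real_sum
    proof (intro sum.cong refl)
      fix i j
      show "of_real (of_bool (X i j) * (cmod (f i - f j))\<^sup>2) = adj X i j * ((f i - f j) * cnj (f i - f j))"
        using complex_norm_square[of "f i - f j"] by (cases "X i j") simp_all
    qed
    also have "\<dots> = (\<Sum>i\<in>UNIV. \<Sum>j\<in>UNIV. adj X i j * (f i * cnj (f i))) + (\<Sum>i\<in>UNIV. \<Sum>j\<in>UNIV. adj X i j * (f j * cnj (f j)))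
        - (\<Sum>i\<in>UNIV. \<Sum>j\<in>UNIV. f i * (adj X i j * cnj (f j))) - (\<Sum>i\<in>UNIV. \<Sum>j\<in>UNIV. cnj (f i) * (adj X i j * f j))"
      unfolding sum.distrib[symmetric] sum_subtractf[symmetric]
      by (intro sum.cong refl) (simp only: complex_cnj_diff; simp add: algebra_simps)
    also have "(\<Sum>i\<in>UNIV. \<Sum>j\<in>UNIV. adj X i j * (f j * cnj (f j))) = (\<Sum>i\<in>UNIV. \<Sum>j\<in>UNIV. adj X i j * (f i * cnj (f i)))"
      by (subst sum.swap) (simp only: adj_sym)
    \<comment> \<open>Each of the four double sums is \<open>k\<close> times the sum of the squared
      moduli, and they cancel.\<close>
    finally have "of_real (\<Sum>i\<in>UNIV. \<Sum>j\<in>UNIV. of_bool (X i j) * (cmod (f i - f j))\<^sup>2) = (0 :: complex)"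
      by (simp only: sum_distrib_left[symmetric] sum_distrib_right[symmetric] row inner inner')
        (simp add: mult_ac sum_distrib_left sum_negf)
    then have "(\<Sum>i\<in>UNIV. \<Sum>j\<in>UNIV. of_bool (X i j) * (cmod (f i - f j))\<^sup>2) = 0"
      by (simp only: of_real_eq_0_iff)
    then have edge: "f i = f j" if "X i j" for i j
      using that by (simp add: sum_nonneg_eq_0_iff sum_nonneg)
    have const: "f j = f i" for j
    proof -
      have "X\<^sup>*\<^sup>* i j" using con by (simp add: connected_graph_def)
      then show ?thesis by induction (auto simp: edge)
    qed
    have "(\<Sum>j\<in>UNIV. f j) = (\<Sum>j\<in>(UNIV :: 'a set). f i)" by (intro sum.cong refl const)
    then show ?thesis using True by simp
  qed
  then show ?thesis by (rule that)
qed

section \<open>Transfer of intertwining relations\<close>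

text \<open>The linear span as an inductive set whose step is exactly the combination in
  \<open>linear_into\<close>, so that two linear maps are compared by induction.\<close>

inductive_set coefficient_span :: "('k \<Rightarrow> complex) set \<Rightarrow> ('k \<Rightarrow> complex) set" for S where
  zero: "(\<lambda>_. 0) \<in> coefficient_span S"
| step: "f \<in> S \<Longrightarrow> K \<in> coefficient_span S \<Longrightarrow> (\<lambda>k. c * f k + K k) \<in> coefficient_span S"

lemma coefficient_span_add:
  assumes "K \<in> coefficient_span S" "L \<in> coefficient_span S" shows "(\<lambda>k. K k + L k) \<in> coefficient_span S"
  using assms(1)
proof induction
  case (step f K c)
  then show ?case using coefficient_span.step[OF step(1) step(3), of c] by (simp add: add.assoc)
qed (use assms(2) in simp)

lemma coefficient_span_sum:
  "(\<And>i. i \<in> I \<Longrightarrow> K i \<in> coefficient_span S) \<Longrightarrow> (\<lambda>k. \<Sum>i\<in>I. K i k) \<in> coefficient_span S"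
  by (induction I rule: infinite_finite_induct)
    (auto intro: coefficient_span.zero coefficient_span_add)

lemma coefficient_span_base: "f \<in> S \<Longrightarrow> f \<in> coefficient_span S"
  using coefficient_span.step[OF _ coefficient_span.zero, of f S 1] by simp

definition linear_into :: "('x, 'm) star_alg_scheme \<Rightarrow> (('k \<Rightarrow> complex) \<Rightarrow> 'x) \<Rightarrow> bool" where
  "linear_into A \<Phi> \<longleftrightarrow> (\<forall>K. \<Phi> K \<in> carrier A) \<and>
     (\<forall>c K L. \<Phi> (\<lambda>k. c * K k + L k) = c \<odot>\<^bsub>A\<^esub> \<Phi> K \<oplus>\<^bsub>A\<^esub> \<Phi> L)"

lemma linear_into_zero:
  assumes "star_algebra A" "linear_into A \<Phi>" shows "\<Phi> (\<lambda>_. 0) = \<zero>\<^bsub>A\<^esub>"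
proof -
  interpret star_algebra A by fact
  have "\<Phi> (\<lambda>k. c * K k + L k) = c \<odot>\<^bsub>A\<^esub> \<Phi> K \<oplus>\<^bsub>A\<^esub> \<Phi> L" for c K L
    using assms(2) by (simp add: linear_into_def)
  from this[of "-1" "\<lambda>_. 0" "\<lambda>_. 0"]
  have "\<Phi> (\<lambda>_. 0) = (-1) \<odot>\<^bsub>A\<^esub> \<Phi> (\<lambda>_. 0) \<oplus>\<^bsub>A\<^esub> \<Phi> (\<lambda>_. 0)"
    by simp
  moreover have "\<Phi> (\<lambda>_. 0) \<in> carrier A" using assms(2) by (simp add: linear_into_def)
  ultimately show ?thesis by (simp add: l_neg flip: neg_eq)
qed

lemma linear_into_scale:
  assumes "star_algebra A" "linear_into A \<Phi>" shows "\<Phi> (\<lambda>k. c * K k) = c \<odot>\<^bsub>A\<^esub> \<Phi> K"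
proof -
  interpret star_algebra A by fact
  have "\<Phi> (\<lambda>k. c * K k + L k) = c \<odot>\<^bsub>A\<^esub> \<Phi> K \<oplus>\<^bsub>A\<^esub> \<Phi> L" for c K L
    using assms(2) by (simp add: linear_into_def)
  from this[of c K "\<lambda>_. 0"] show ?thesis
    using assms(2) linear_into_zero[OF assms] by (simp add: linear_into_def)
qed

lemma linear_into_eq_on_span:
  assumes "star_algebra A" "linear_into A \<Phi>" "linear_into A \<Psi>"
    and "\<And>f. f \<in> S \<Longrightarrow> \<Phi> f = \<Psi> f" and "K \<in> coefficient_span S"
  shows "\<Phi> K = \<Psi> K"
  using assms(5)
proof induction
  case zero
  show ?case using linear_into_zero assms by metis
next
  case (step f K c)
  then show ?case using assms(2-4) by (simp add: linear_into_def)
qed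

lemma unit_coefficient_span:
  "(K :: 'n::finite \<times> 'n \<Rightarrow> complex) \<in> coefficient_span {\<lambda>k. of_bool (fst k = x) * of_bool (snd k = y) | x y. True}"
    (is "_ \<in> coefficient_span ?S")
proof -
  have "(\<lambda>k. K z * of_bool (k = z)) \<in> coefficient_span ?S" for z
  proof -
    have "(\<lambda>k. of_bool (k = z) :: complex) = (\<lambda>k. of_bool (fst k = fst z) * of_bool (snd k = snd z))"
      by (auto simp: prod_eq_iff)
    then have "(\<lambda>k. of_bool (k = z)) \<in> ?S" by blast
    then show ?thesis using coefficient_span.step[OF _ coefficient_span.zero, of _ ?S "K z"] by simp
  qed
  then have "(\<lambda>k. \<Sum>z\<in>UNIV. K z * of_bool (k = z)) \<in> coefficient_span ?S"
    by (intro coefficient_span_sum)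
  also have "(\<lambda>k. \<Sum>z\<in>UNIV. K z * of_bool (k = z)) = K"
    by (simp add: of_bool_def if_distrib sum.delta cong: if_cong)
  finally show ?thesis .
qed

section \<open>Contraction of scalar matrices with a matrix over an algebra\<close>

lemma sum_unit: "(\<Sum>z\<in>UNIV. of_bool (z = x) * g z) = (g x :: complex)" for x :: "'n::finite"
  by simp

text \<open>The pairing of a scalar matrix with the matrix \<open>w\<close>. A linear relation
  between entries of \<open>w\<close> becomes an equation between linear maps on scalar matrices,
  which can be tested on any spanning set.\<close>

definition contract :: "('x, 'm) star_alg_scheme \<Rightarrow> ('n::finite \<Rightarrow> 'n \<Rightarrow> 'x) \<Rightarrow> ('n \<times> 'n \<Rightarrow> complex) \<Rightarrow> 'x" where
  "contract A w K = (\<Oplus>\<^bsub>A\<^esub>k\<in>UNIV. K k \<odot>\<^bsub>A\<^esub> w (fst k) (snd k))"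

text \<open>
  \<open>mult_left D K\<close> is \<open>D\<^sup>T K\<close> and \<open>mult_right D K\<close> is \<open>K D\<^sup>T\<close>; the transposes make \<open>D w = w D\<close> equivalent to
  the equality of the two contractions with \<open>w\<close>, for all \<open>K\<close>.
\<close>

abbreviation mult_left :: "('n::finite \<Rightarrow> 'n \<Rightarrow> complex) \<Rightarrow> ('n \<times> 'n \<Rightarrow> complex) \<Rightarrow> 'n \<times> 'n \<Rightarrow> complex" where
  "mult_left D K \<equiv> \<lambda>k. \<Sum>x\<in>UNIV. D x (fst k) * K (x, snd k)"

abbreviation mult_right :: "('n::finite \<Rightarrow> 'n \<Rightarrow> complex) \<Rightarrow> ('n \<times> 'n \<Rightarrow> complex) \<Rightarrow> 'n \<times> 'n \<Rightarrow> complex" where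
  "mult_right D K \<equiv> \<lambda>k. \<Sum>y\<in>UNIV. K (fst k, y) * D (snd k) y"

context star_algebra begin

lemma linear_into_contract:
  assumes "\<And>x y. w x y \<in> carrier F" shows "linear_into F (contract F w)"
  unfolding linear_into_def
proof (intro conjI allI)
  show "contract F w K \<in> carrier F" for K using assms by (auto simp: contract_def)
  fix c K L
  have "contract F w (\<lambda>k. c * K k + L k) =
    (\<Oplus>k\<in>UNIV. c \<odot> (K k \<odot> w (fst k) (snd k)) \<oplus> L k \<odot> w (fst k) (snd k))"
    unfolding contract_def using assms by (intro finsum_eq) (auto simp: scale_add_left)
  also have "\<dots> = c \<odot> contract F w K \<oplus> contract F w L"
    unfolding contract_def using assms by (simp add: finsum_add scale_finsum)
  finally show "contract F w (\<lambda>k. c * K k + L k) = c \<odot> contract F w K \<oplus> contract F w L" .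
qed

text \<open>At a matrix unit the contraction gives an entry of \<open>D w\<close>;
  \<open>contract_unit_right\<close> gives the same entry of \<open>w D\<close>.\<close>

lemma contract_unit_left:
  assumes w: "\<And>x y. w x y \<in> carrier F"
  shows "contract F w (mult_left D (\<lambda>k. of_bool (fst k = x) * of_bool (snd k = y))) = (\<Oplus>z\<in>UNIV. D x z \<odot> w z y)"
proof -
  have "mult_left D (\<lambda>k. of_bool (fst k = x) * of_bool (snd k = y)) = (\<lambda>k. D x (fst k) * of_bool (snd k = y))"
  proof
    fix k
    have "mult_left D (\<lambda>k. of_bool (fst k = x) * of_bool (snd k = y)) k =
      (\<Sum>z\<in>UNIV. of_bool (z = x) * (D z (fst k) * of_bool (snd k = y)))"
      by (simp only: fst_conv snd_conv mult_ac)
    then show "mult_left D (\<lambda>k. of_bool (fst k = x) * of_bool (snd k = y)) k = D x (fst k) * of_bool (snd k = y)"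
      by (simp only: sum_unit)
  qed
  then have "contract F w (mult_left D (\<lambda>k. of_bool (fst k = x) * of_bool (snd k = y))) =
      (\<Oplus>k\<in>UNIV \<times> UNIV. (D x (fst k) * of_bool (snd k = y)) \<odot> w (fst k) (snd k))"
    by (simp add: contract_def)
  also have "\<dots> = (\<Oplus>z\<in>UNIV. \<Oplus>u\<in>UNIV. (D x z * of_bool (u = y)) \<odot> w z u)"
    using w by (intro finsum_cartesian) auto
  also have "\<dots> = (\<Oplus>z\<in>UNIV. \<Oplus>u\<in>UNIV. if u = y then D x z \<odot> w z u else \<zero>)"
    using w by (intro finsum_eq) auto
  also have "\<dots> = (\<Oplus>z\<in>UNIV. D x z \<odot> w z y)"
    using w by (intro finsum_eq) (auto simp: finsum_delta')
  finally show ?thesis .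
qed

lemma contract_unit_right:
  assumes w: "\<And>x y. w x y \<in> carrier F"
  shows "contract F w (mult_right D (\<lambda>k. of_bool (fst k = x) * of_bool (snd k = y))) = (\<Oplus>z\<in>UNIV. D z y \<odot> w x z)"
proof -
  have "mult_right D (\<lambda>k. of_bool (fst k = x) * of_bool (snd k = y)) = (\<lambda>k. of_bool (fst k = x) * D (snd k) y)"
  proof
    fix k
    have "mult_right D (\<lambda>k. of_bool (fst k = x) * of_bool (snd k = y)) k =
      (\<Sum>z\<in>UNIV. of_bool (z = y) * (of_bool (fst k = x) * D (snd k) z))"
      by (simp only: fst_conv snd_conv mult_ac)
    then show "mult_right D (\<lambda>k. of_bool (fst k = x) * of_bool (snd k = y)) k = of_bool (fst k = x) * D (snd k) y"
      by (simp only: sum_unit)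
  qed
  then have "contract F w (mult_right D (\<lambda>k. of_bool (fst k = x) * of_bool (snd k = y))) =
      (\<Oplus>k\<in>UNIV \<times> UNIV. (of_bool (fst k = x) * D (snd k) y) \<odot> w (fst k) (snd k))"
    by (simp add: contract_def)
  also have "\<dots> = (\<Oplus>u\<in>UNIV. \<Oplus>z\<in>UNIV. (of_bool (u = x) * D z y) \<odot> w u z)"
    using w by (intro finsum_cartesian) auto
  also have "\<dots> = (\<Oplus>u\<in>UNIV. if u = x then (\<Oplus>z\<in>UNIV. D z y \<odot> w u z) else \<zero>)"
    using w by (intro finsum_eq) auto
  also have "\<dots> = (\<Oplus>z\<in>UNIV. D z y \<odot> w x z)"
    using w by (auto simp: finsum_delta')
  finally show ?thesis .
qed

lemma linear_into_mult:
  assumes w: "\<And>x y. w x y \<in> carrier F"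
  shows linear_into_mult_left: "linear_into F (\<lambda>K. contract F w (mult_left D K))"
    and linear_into_mult_right: "linear_into F (\<lambda>K. contract F w (mult_right D K))"
proof -
  have "linear_into F (contract F w)" by (rule linear_into_contract) (rule w)
  note L = this[unfolded linear_into_def]
  have "mult_left D (\<lambda>k. c * K k + K' k) = (\<lambda>k. c * mult_left D K k + mult_left D K' k)"
    "mult_right D (\<lambda>k. c * K k + K' k) = (\<lambda>k. c * mult_right D K k + mult_right D K' k)" for c K K'
    by (auto simp: sum_distrib_left algebra_simps sum.distrib)
  then show "linear_into F (\<lambda>K. contract F w (mult_left D K))" "linear_into F (\<lambda>K. contract F w (mult_right D K))"
    using L unfolding linear_into_def by auto
qed

lemma intertwines_iff_contract:
  assumes w: "\<And>x y. w x y \<in> carrier F"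
  shows "intertwines F D w \<longleftrightarrow> (\<forall>K. contract F w (mult_left D K) = contract F w (mult_right D K))"
proof
  assume D: "intertwines F D w"
  show "\<forall>K. contract F w (mult_left D K) = contract F w (mult_right D K)"
  proof
    fix K
    show "contract F w (mult_left D K) = contract F w (mult_right D K)"
      by (rule linear_into_eq_on_span[OF star_algebra_axioms linear_into_mult_left[of w, OF w] linear_into_mult_right[of w, OF w]
            _ unit_coefficient_span])
        (use D in \<open>auto simp only: intertwines_def contract_unit_left[of w, OF w] contract_unit_right[of w, OF w]\<close>)
  qed
next
  assume eq: "\<forall>K. contract F w (mult_left D K) = contract F w (mult_right D K)"
  show "intertwines F D w"
    unfolding intertwines_def
  proof (intro allI)
    fix x y
    show "(\<Oplus>k\<in>UNIV. D x k \<odot> w k y) = (\<Oplus>k\<in>UNIV. D k y \<odot> w x k)"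
      unfolding contract_unit_left[of w, OF w, symmetric] contract_unit_right[of w, OF w, symmetric]
      by (rule eq[rule_format])
  qed
qed

end

text \<open>The rank one matrix formed by the column \<open>f \<otimes> g\<close> and the row
  \<open>f' \<otimes> g'\<close>, without complex conjugation.\<close>

abbreviation rank_one ::
    "('a \<Rightarrow> complex) \<Rightarrow> ('b \<Rightarrow> complex) \<Rightarrow> ('a \<Rightarrow> complex) \<Rightarrow> ('b \<Rightarrow> complex) \<Rightarrow> ('a \<times> 'b) \<times> ('a \<times> 'b) \<Rightarrow> complex" where
  "rank_one f g f' g' \<equiv> \<lambda>k. (f (fst (fst k)) * g (snd (fst k))) * (f' (fst (snd k)) * g' (snd (snd k)))"

text \<open>A matrix unit is a rank one matrix of four unit vectors, and each unit vector is a sum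
  of eigenfunctions because adjacency matrices are Hermitian.\<close>

lemma eigenfunction_coefficient_span:
  fixes X :: "'a::finite \<Rightarrow> 'a \<Rightarrow> bool" and Y :: "'b::finite \<Rightarrow> 'b \<Rightarrow> bool"
  assumes "symp X" "symp Y"
  defines "S \<equiv> {rank_one f g f' g' | f g f' g' l m l' m'.
      eigenfunction X l f \<and> eigenfunction Y m g \<and> eigenfunction X l' f' \<and> eigenfunction Y m' g'}"
  shows "K \<in> coefficient_span S"
proof -
  have unit: "(\<lambda>k. of_bool (fst k = x) * of_bool (snd k = y)) \<in> coefficient_span S" for x y :: "'a \<times> 'b"
  proof -
    obtain i a j b where xy: "x = (i, a)" "y = (j, b)" by fastforce
    obtain S1 x1 where 1: "finite S1" "\<And>l. l \<in> S1 \<Longrightarrow> eigenfunction X l (x1 l)" "\<And>j. of_bool (j = i) = (\<Sum>l\<in>S1. x1 l j)"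
      using eigenfunction_sum_unit[OF assms(1), of i] by blast
    obtain S2 x2 where 2: "finite S2" "\<And>l. l \<in> S2 \<Longrightarrow> eigenfunction Y l (x2 l)" "\<And>j. of_bool (j = a) = (\<Sum>l\<in>S2. x2 l j)"
      using eigenfunction_sum_unit[OF assms(2), of a] by blast
    obtain S3 x3 where 3: "finite S3" "\<And>l. l \<in> S3 \<Longrightarrow> eigenfunction X l (x3 l)" "\<And>i. of_bool (i = j) = (\<Sum>l\<in>S3. x3 l i)"
      using eigenfunction_sum_unit[OF assms(1), of j] by blast
    obtain S4 x4 where 4: "finite S4" "\<And>l. l \<in> S4 \<Longrightarrow> eigenfunction Y l (x4 l)" "\<And>j. of_bool (j = b) = (\<Sum>l\<in>S4. x4 l j)"
      using eigenfunction_sum_unit[OF assms(2), of b] by blast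
    \<comment> \<open>The order of the four sums is the one in which \<open>sum_product\<close>
      expands the product.\<close>
    have "(\<lambda>k. \<Sum>l1\<in>S1. \<Sum>l3\<in>S3. \<Sum>l2\<in>S2. \<Sum>l4\<in>S4.
        rank_one (x1 l1) (x2 l2) (x3 l3) (x4 l4) k) \<in> coefficient_span S"
      unfolding S_def
      by (intro coefficient_span_sum coefficient_span_base) (use 1(2) 2(2) 3(2) 4(2) in blast)
    also have "(\<lambda>k. \<Sum>l1\<in>S1. \<Sum>l3\<in>S3. \<Sum>l2\<in>S2. \<Sum>l4\<in>S4.
        rank_one (x1 l1) (x2 l2) (x3 l3) (x4 l4) k) =
      (\<lambda>k. of_bool (fst k = x) * of_bool (snd k = y))"
    proof
      fix k :: "('a \<times> 'b) \<times> ('a \<times> 'b)"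
      have "of_bool (fst k = x) * of_bool (snd k = y) =
        (of_bool (fst (fst k) = i) * of_bool (snd (fst k) = a)) * (of_bool (fst (snd k) = j) * of_bool (snd (snd k) = b) :: complex)"
        by (auto simp: xy prod_eq_iff)
      also have "\<dots> = (\<Sum>l1\<in>S1. \<Sum>l3\<in>S3. \<Sum>l2\<in>S2. \<Sum>l4\<in>S4.
        rank_one (x1 l1) (x2 l2) (x3 l3) (x4 l4) k)"
        unfolding 1(3) 2(3) 3(3) 4(3)
        by (simp only: sum_product)
      finally show "(\<Sum>l1\<in>S1. \<Sum>l3\<in>S3. \<Sum>l2\<in>S2. \<Sum>l4\<in>S4.
        rank_one (x1 l1) (x2 l2) (x3 l3) (x4 l4) k) =
        of_bool (fst k = x) * of_bool (snd k = y)" by simp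
    qed
    finally show ?thesis .
  qed
  have "coefficient_span {\<lambda>k. of_bool (fst k = x) * of_bool (snd k = y) | x y. True} \<subseteq> coefficient_span S"
  proof
    fix K assume "K \<in> coefficient_span {\<lambda>k :: ('a \<times> 'b) \<times> ('a \<times> 'b). of_bool (fst k = x) * of_bool (snd k = y) | x y. True}"
    then show "K \<in> coefficient_span S"
    proof induction
      case (step f K c)
      then have "f \<in> coefficient_span S" using unit by auto
      then have "(\<lambda>k. c * f k) \<in> coefficient_span S"
      proof induction
        case (step g L d)
        then show ?case using coefficient_span.step[OF step(1) step(3), of "c * d"] by (simp add: algebra_simps)
      qed (simp add: coefficient_span.zero)
      then show ?case using step by (intro coefficient_span_add)
    qed (rule coefficient_span.zero)
  qed
  then show ?thesis using unit_coefficient_span by blast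
qed

text \<open>Symmetry allows the same scalar to be read off where \<open>D\<close> acts through its
  transpose, as in \<open>mult_left\<close>.\<close>

definition acts_by :: "('a::finite \<Rightarrow> 'a \<Rightarrow> bool) \<Rightarrow> ('b::finite \<Rightarrow> 'b \<Rightarrow> bool) \<Rightarrow>
    ('a \<times> 'b \<Rightarrow> 'a \<times> 'b \<Rightarrow> complex) \<Rightarrow> (complex \<Rightarrow> complex \<Rightarrow> complex) \<Rightarrow> bool" where
  "acts_by X Y D s \<longleftrightarrow> (\<forall>x z. D x z = D z x) \<and>
     (\<forall>l m f g z. eigenfunction X l f \<longrightarrow> eigenfunction Y m g \<longrightarrow>
        (\<Sum>x\<in>UNIV. D z x * (f (fst x) * g (snd x))) = s l m * (f (fst z) * g (snd z)))"

text \<open>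
  If \<open>D\<close> separates the pairs of eigenvalues, then \<open>w\<close> vanishes between products of eigenfunctions
  with different eigenvalues, so it intertwines every matrix that is diagonal in such products.
\<close>

lemma intertwines_transfer:
  fixes X :: "'a::finite \<Rightarrow> 'a \<Rightarrow> bool" and Y :: "'b::finite \<Rightarrow> 'b \<Rightarrow> bool"
  assumes A: "star_algebra A" and w: "\<And>x y. w x y \<in> carrier A"
    and sym: "symp X" "symp Y"
    and D: "acts_by X Y D s" and T: "acts_by X Y T t"
    and inj: "\<And>l m l' m'. l \<in> graph_spectrum X \<Longrightarrow> l' \<in> graph_spectrum X \<Longrightarrow> m \<in> graph_spectrum Y \<Longrightarrow>
      m' \<in> graph_spectrum Y \<Longrightarrow> s l m = s l' m' \<Longrightarrow> l = l' \<and> m = m'"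
    and Dw: "intertwines A D w"
  shows "intertwines A T w"
proof -
  interpret star_algebra A by (rule A)
  note lin = linear_into_contract[of w, OF w]
  have closed: "contract A w K \<in> carrier A" for K using lin by (simp add: linear_into_def)
  \<comment> \<open>From the left the scalar is that of the first pair of eigenvalues, from the
    right that of the second. This is used for \<open>D\<close> and for \<open>T\<close>
    alike.\<close>
  have left: "contract A w (mult_left E (rank_one f g f' g')) =
      e l m \<odot>\<^bsub>A\<^esub> contract A w (rank_one f g f' g')"
    and right: "contract A w (mult_right E (rank_one f g f' g')) =
      e l' m' \<odot>\<^bsub>A\<^esub> contract A w (rank_one f g f' g')"
    if E: "acts_by X Y E e" and eig: "eigenfunction X l f" "eigenfunction Y m g" "eigenfunction X l' f'" "eigenfunction Y m' g'"
    for E e l m l' m' f g f' g'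
  proof -
    have E_sym: "E x z = E z x" for x z using E unfolding acts_by_def by blast
    have E_eig: "(\<Sum>x\<in>UNIV. E z x * (f (fst x) * g (snd x))) = e l m * (f (fst z) * g (snd z))"
      "(\<Sum>x\<in>UNIV. E z x * (f' (fst x) * g' (snd x))) = e l' m' * (f' (fst z) * g' (snd z))" for z
      using E eig unfolding acts_by_def by blast+
    have "(\<Sum>x\<in>UNIV. E x z * ((f (fst x) * g (snd x)) * c)) = e l m * ((f (fst z) * g (snd z)) * c)" for z c
    proof -
      have "(\<Sum>x\<in>UNIV. E x z * ((f (fst x) * g (snd x)) * c)) = (\<Sum>x\<in>UNIV. E z x * (f (fst x) * g (snd x))) * c"
        unfolding sum_distrib_right by (intro sum.cong refl) (simp add: E_sym[of _ z] mult.assoc)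
      then show ?thesis by (simp add: E_eig mult.assoc)
    qed
    then show "contract A w (mult_left E (rank_one f g f' g')) =
      e l m \<odot>\<^bsub>A\<^esub> contract A w (rank_one f g f' g')"
      by (simp add: linear_into_scale[OF A lin])
    have "(\<Sum>y\<in>UNIV. (c * (f' (fst y) * g' (snd y))) * E z y) = e l' m' * (c * (f' (fst z) * g' (snd z)))" for z c
    proof -
      have "(\<Sum>y\<in>UNIV. (c * (f' (fst y) * g' (snd y))) * E z y) = c * (\<Sum>y\<in>UNIV. E z y * (f' (fst y) * g' (snd y)))"
        unfolding sum_distrib_left by (intro sum.cong refl) (simp add: mult_ac)
      then show ?thesis by (simp add: E_eig mult_ac)
    qed
    then show "contract A w (mult_right E (rank_one f g f' g')) =
      e l' m' \<odot>\<^bsub>A\<^esub> contract A w (rank_one f g f' g')"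
      by (simp add: linear_into_scale[OF A lin])
  qed
  have "contract A w (mult_left T K) = contract A w (mult_right T K)" for K
  proof (rule linear_into_eq_on_span[OF A linear_into_mult_left[of w, OF w] linear_into_mult_right[of w, OF w]
        _ eigenfunction_coefficient_span[OF sym]])
    fix h assume "h \<in> {rank_one f g f' g' | f g f' g' l m l' m'.
      eigenfunction X l f \<and> eigenfunction Y m g \<and> eigenfunction X l' f' \<and> eigenfunction Y m' g'}"
    then obtain f g f' g' l m l' m' where h: "h = (rank_one f g f' g')"
      and eig: "eigenfunction X l f" "eigenfunction Y m g" "eigenfunction X l' f'" "eigenfunction Y m' g'"
      by blast
    have eqD: "s l m \<odot>\<^bsub>A\<^esub> contract A w h = s l' m' \<odot>\<^bsub>A\<^esub> contract A w h"
      using Dw[unfolded intertwines_iff_contract[of w, OF w], rule_format, of h]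
      unfolding h left[OF D eig] right[OF D eig] .
    have "t l m \<odot>\<^bsub>A\<^esub> contract A w h = t l' m' \<odot>\<^bsub>A\<^esub> contract A w h"
    \<comment> \<open>For \<open>h = 0\<close> the four eigenvalues need not lie in the spectra, and
      \<open>inj\<close> says nothing about them; otherwise a nonzero value of \<open>h\<close> puts
      all four into the spectra.\<close>
    proof (cases "h = (\<lambda>_. 0)")
      case True
      then show ?thesis by (simp add: linear_into_zero[OF A lin])
    next
      case False
      then obtain k where "h k \<noteq> 0" unfolding fun_eq_iff by blast
      then have nz: "f (fst (fst k)) \<noteq> 0" "g (snd (fst k)) \<noteq> 0" "f' (fst (snd k)) \<noteq> 0" "g' (snd (snd k)) \<noteq> 0"
        by (auto simp: h)
      show ?thesis
      proof (cases "s l m = s l' m'")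
        case True
        then show ?thesis
          using inj eigenfunction_spectrum[OF eig(1) nz(1)] eigenfunction_spectrum[OF eig(2) nz(2)]
            eigenfunction_spectrum[OF eig(3) nz(3)] eigenfunction_spectrum[OF eig(4) nz(4)] by metis
      next
        case False
        have "(s l m - s l' m') \<odot>\<^bsub>A\<^esub> contract A w h = \<zero>\<^bsub>A\<^esub>"
          using eqD closed[of h] scale_add_left[of "contract A w h" "s l m" "- s l' m'"]
            scale_add_left[of "contract A w h" "s l' m'" "- s l' m'"] by simp
        then have "inverse (s l m - s l' m') \<odot>\<^bsub>A\<^esub> ((s l m - s l' m') \<odot>\<^bsub>A\<^esub> contract A w h) = \<zero>\<^bsub>A\<^esub>" by simp
        then have "contract A w h = \<zero>\<^bsub>A\<^esub>" using False closed[of h] by (simp del: left_minus)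
        then show ?thesis by simp
      qed
    qed
    then show "contract A w (mult_left T h) = contract A w (mult_right T h)"
      unfolding h left[OF T eig] right[OF T eig] .
  qed
  then show ?thesis by (simp add: intertwines_iff_contract[of w, OF w])
qed

section \<open>Factoring a magic unitary on a product\<close>

text \<open>Used for the two projections of a product of vertex sets. The matrix in
  \<open>fibres\<close> is then \<open>1 \<otimes> J\<close> or \<open>J \<otimes> 1\<close>, with
  \<open>J\<close> the all-ones matrix.\<close>

locale quotient_magic = magic A w for A (structure) and w :: "'n::finite \<Rightarrow> 'n \<Rightarrow> 'x" +
  fixes \<pi> :: "'n \<Rightarrow> 'i::finite"
  assumes surj: "surj \<pi>"
    and fibres: "intertwines A (\<lambda>x y. of_bool (\<pi> x = \<pi> y)) w"
begin

text \<open>\<open>inv_into\<close> chooses some row above \<open>i\<close>; by \<open>fibres\<close> the choice does not matter.\<close>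

definition quotient :: "'i \<Rightarrow> 'i \<Rightarrow> 'x" where
  "quotient i j = (\<Oplus>z\<in>UNIV. if \<pi> z = j then w (inv_into UNIV \<pi> i) z else \<zero>)"

lemma of_bool_scale [simp]: "x \<in> carrier A \<Longrightarrow> of_bool b \<odot> x = (if b then x else \<zero>)"
  by simp

text \<open>One side depends on \<open>x\<close> through \<open>\<pi> x\<close> alone, the other on
  \<open>y\<close> through \<open>\<pi> y\<close> alone, so the common value belongs to a pair of
  fibres and can be computed along a row or along a column.\<close>

lemma fibre_sums: "(\<Oplus>z\<in>UNIV. if \<pi> x = \<pi> z then w z y else \<zero>) = (\<Oplus>z\<in>UNIV. if \<pi> z = \<pi> y then w x z else \<zero>)"
  using fibres by (simp add: intertwines_def del: of_bool_eq_iff)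

lemma quotient_column: "quotient i (\<pi> y) = (\<Oplus>z\<in>UNIV. if i = \<pi> z then w z y else \<zero>)"
  using fibre_sums[of "inv_into UNIV \<pi> i" y] by (simp add: quotient_def surj_f_inv_f[OF surj])

lemma quotient_row: "quotient (\<pi> x) j = (\<Oplus>z\<in>UNIV. if \<pi> z = j then w x z else \<zero>)"
proof -
  obtain y where y: "j = \<pi> y" using surj by (metis surjD)
  show ?thesis unfolding y quotient_column fibre_sums ..
qed

lemma quotient_closed [simp, intro]: "quotient i j \<in> carrier A"
  by (auto simp: quotient_def)

text \<open>For \<open>\<pi> = fst\<close> the assumption is commutation with
  \<open>d \<otimes> J\<close>. Summing over fibres turns it into commutation with
  \<open>d\<close>.\<close>

lemma quotient_intertwines:
  assumes "intertwines A (\<lambda>x y. d (\<pi> x) (\<pi> y)) w" shows "intertwines A d quotient"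
  unfolding intertwines_def
proof (intro allI)
  fix i j
  obtain x y where x: "i = \<pi> x" and y: "j = \<pi> y" using surj by (metis surjD)
  have "(\<Oplus>k\<in>UNIV. d (\<pi> x) k \<odot> quotient k (\<pi> y)) = (\<Oplus>k\<in>UNIV. \<Oplus>z\<in>UNIV. if k = \<pi> z then d (\<pi> x) k \<odot> w z y else \<zero>)"
    by (intro finsum_eq) (auto simp: quotient_column scale_finsum intro!: finsum_eq)
  also have "\<dots> = (\<Oplus>z\<in>UNIV. \<Oplus>k\<in>UNIV. if k = \<pi> z then d (\<pi> x) k \<odot> w z y else \<zero>)"
    by (rule finsum_swap) auto
  also have "\<dots> = (\<Oplus>z\<in>UNIV. d (\<pi> x) (\<pi> z) \<odot> w z y)"
    by (intro finsum_eq) (auto simp: finsum_delta')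
  also have "\<dots> = (\<Oplus>z\<in>UNIV. d (\<pi> z) (\<pi> y) \<odot> w x z)"
    using assms by (simp add: intertwines_def)
  also have "\<dots> = (\<Oplus>z\<in>UNIV. \<Oplus>k\<in>UNIV. if \<pi> z = k then d k (\<pi> y) \<odot> w x z else \<zero>)"
    by (intro finsum_eq) (auto simp: finsum_delta)
  also have "\<dots> = (\<Oplus>k\<in>UNIV. \<Oplus>z\<in>UNIV. if \<pi> z = k then d k (\<pi> y) \<odot> w x z else \<zero>)"
    by (rule finsum_swap) auto
  also have "\<dots> = (\<Oplus>k\<in>UNIV. d k (\<pi> y) \<odot> quotient (\<pi> x) k)"
    by (intro finsum_eq) (auto simp: quotient_row scale_finsum intro!: finsum_eq)
  finally show "(\<Oplus>k\<in>UNIV. d i k \<odot> quotient k j) = (\<Oplus>k\<in>UNIV. d k j \<odot> quotient i k)"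
    unfolding x y .
qed

text \<open>Products within a row use the entries as partial row sums of \<open>w\<close>, products
  within a column use them as partial column sums; either way they reduce to the orthogonality
  relations of \<open>w\<close>.\<close>

lemma quotient_magic: "magic A quotient"
proof unfold_locales
  fix i j
  show "star A (quotient i j) = quotient i j"
    unfolding quotient_def by (subst adj_finsum) (auto simp: u_star intro!: finsum_eq)
next
  fix i j k
  obtain x where x: "i = \<pi> x" using surj by (metis surjD)
  have "quotient (\<pi> x) j \<otimes> quotient (\<pi> x) k =
    (\<Oplus>z\<in>UNIV. \<Oplus>z'\<in>UNIV. if z = z' then (if j = k \<and> \<pi> z' = j then w x z else \<zero>) else \<zero>)"
    unfolding quotient_row by (subst finsum_mult) (auto simp: row_mult intro!: finsum_eq)
  also have "\<dots> = (\<Oplus>z\<in>UNIV. if j = k \<and> \<pi> z = j then w x z else \<zero>)"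
    by (intro finsum_eq) (auto simp: finsum_delta)
  also have "\<dots> = (if j = k then quotient (\<pi> x) j else \<zero>)"
    unfolding quotient_row by auto
  finally show "quotient i j \<otimes> quotient i k = (if j = k then quotient i j else \<zero>)" unfolding x .
next
  fix i j k
  obtain y where y: "j = \<pi> y" using surj by (metis surjD)
  have "quotient i (\<pi> y) \<otimes> quotient k (\<pi> y) =
    (\<Oplus>z\<in>UNIV. \<Oplus>z'\<in>UNIV. if z = z' then (if i = k \<and> i = \<pi> z' then w z y else \<zero>) else \<zero>)"
    unfolding quotient_column by (subst finsum_mult) (auto simp: column_mult intro!: finsum_eq)
  also have "\<dots> = (\<Oplus>z\<in>UNIV. if i = k \<and> i = \<pi> z then w z y else \<zero>)"
    by (intro finsum_eq) (auto simp: finsum_delta)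
  also have "\<dots> = (if i = k then quotient i (\<pi> y) else \<zero>)"
    unfolding quotient_column by auto
  finally show "quotient i j \<otimes> quotient k j = (if i = k then quotient i j else \<zero>)" unfolding y .
next
  fix i
  have "(\<Oplus>j\<in>UNIV. quotient i j) = (\<Oplus>z\<in>UNIV. \<Oplus>j\<in>UNIV. if \<pi> z = j then w (inv_into UNIV \<pi> i) z else \<zero>)"
    unfolding quotient_def by (rule finsum_swap) auto
  also have "\<dots> = (\<Oplus>z\<in>UNIV. w (inv_into UNIV \<pi> i) z)"
    by (intro finsum_eq) (auto simp: finsum_delta)
  finally show "(\<Oplus>j\<in>UNIV. quotient i j) = \<one>" by (simp add: row_sum)
next
  fix j
  obtain y where y: "j = \<pi> y" using surj by (metis surjD)
  have "(\<Oplus>i\<in>UNIV. quotient i (\<pi> y)) = (\<Oplus>z\<in>UNIV. \<Oplus>i\<in>UNIV. if i = \<pi> z then w z y else \<zero>)"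
    unfolding quotient_column by (rule finsum_swap) auto
  also have "\<dots> = (\<Oplus>z\<in>UNIV. w z y)"
    by (intro finsum_eq) (auto simp: finsum_delta')
  finally show "(\<Oplus>i\<in>UNIV. quotient i j) = \<one>" by (simp add: column_sum y)
qed auto

end

text \<open>Both factors may be computed in the same row \<open>x\<close> of \<open>w\<close>.
  Orthogonality there leaves only the entries that occur in both sums, and \<open>fst\<close> and
  \<open>snd\<close> together single out \<open>y\<close>. The argument is the same for either
  order, which gives commutation of the factors.\<close>

lemma quotient_product:
  fixes w :: "'a::finite \<times> 'b::finite \<Rightarrow> 'a \<times> 'b \<Rightarrow> 'x" and A (structure)
  assumes "quotient_magic A w fst" "quotient_magic A w snd"
  shows "quotient_magic.quotient A w fst (fst x) (fst y) \<otimes> quotient_magic.quotient A w snd (snd x) (snd y) = w x y" (is ?L)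
    and "quotient_magic.quotient A w snd (snd x) (snd y) \<otimes> quotient_magic.quotient A w fst (fst x) (fst y) = w x y" (is ?R)
proof -
  interpret U: quotient_magic A w fst by fact
  interpret V: quotient_magic A w snd by fact
  have "U.quotient (fst x) (fst y) \<otimes> V.quotient (snd x) (snd y) =
    (\<Oplus>z\<in>UNIV. \<Oplus>z'\<in>UNIV. if z = z' then (if z' = y then w x z else \<zero>) else \<zero>)"
    unfolding U.quotient_row V.quotient_row
    by (subst U.finsum_mult) (auto simp: U.row_mult prod_eq_iff intro!: U.finsum_eq)
  also have "\<dots> = w x y" by (simp add: U.finsum_delta U.finsum_delta' Pi_def)
  finally show ?L .
  have "V.quotient (snd x) (snd y) \<otimes> U.quotient (fst x) (fst y) =
    (\<Oplus>z\<in>UNIV. \<Oplus>z'\<in>UNIV. if z = z' then (if z' = y then w x z else \<zero>) else \<zero>)"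
    unfolding U.quotient_row V.quotient_row
    by (subst U.finsum_mult) (auto simp: U.row_mult prod_eq_iff intro!: U.finsum_eq)
  also have "\<dots> = w x y" by (simp add: U.finsum_delta U.finsum_delta' Pi_def)
  finally show ?R .
qed

section \<open>Tensor products of matrix Hopf algebras\<close>

lemma (in star_algebra) star_span_finsum:
  "finite I \<Longrightarrow> S \<subseteq> carrier F \<Longrightarrow> (\<And>i. i \<in> I \<Longrightarrow> f i \<in> S) \<Longrightarrow> (\<Oplus>i\<in>I. f i) \<in> star_span F S"
proof (induction I rule: finite_induct)
  case empty
  have "0 \<odot> \<one> \<in> star_span F S" by (intro star_span.scale star_span.one)
  then show ?case by simp
next
  case (insert i I)
  then have "(\<Oplus>i\<in>insert i I. f i) = f i \<oplus> (\<Oplus>i\<in>I. f i)" by (intro finsum_insert) auto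
  then show ?case using insert by (auto intro: star_span.add star_span.base)
qed

text \<open>A generator of one leg is recovered by summing \<open>u i j \<otimes> v a b\<close> over
  a row of the other magic unitary, as rows sum to one.\<close>

lemma generates_pairing:
  fixes u :: "'i::finite \<Rightarrow> 'i \<Rightarrow> 'x" and v :: "'j::finite \<Rightarrow> 'j \<Rightarrow> 'y"
  assumes A: "cstar_algebra A" and B: "cstar_algebra B" and u: "magic A u" and v: "magic B v"
    and Au: "generates A (range (case_prod u))" and Bv: "generates B (range (case_prod v))"
  shows "generates (max_tensor A B)
    (range (case_prod (\<lambda>x y. tensor A B (u (fst x) (fst y)) (v (snd x) (snd y)))))"
    (is "generates _ ?T")
proof (rule generates_star_span[OF max_tensor_cstar_algebra[OF A B] generates_tensor[OF A B Au Bv]])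
  interpret u: magic A u by (rule u)
  interpret v: magic B v by (rule v)
  interpret t: tensor_rep A B "max_tensor A B" "tensor A B" by (intro tensor_tensor_rep A B)
  show T: "?T \<subseteq> carrier (max_tensor A B)" by auto
  have inT: "tensor A B (u i j) (v a b) \<in> ?T" for i j a b
    by (rule image_eqI[of _ _ "((i, a), (j, b))"]) auto
  have "tensor A B (u i j) \<one>\<^bsub>B\<^esub> \<in> star_span (max_tensor A B) ?T" for i j
  proof -
    \<comment> \<open>Every row of \<open>v\<close> sums to \<open>\<one>\<close>;
      \<open>undefined\<close> names an arbitrary one.\<close>
    have "tensor A B (u i j) \<one>\<^bsub>B\<^esub> = (\<Oplus>\<^bsub>max_tensor A B\<^esub>b\<in>UNIV. tensor A B (u i j) (v undefined b))"
      by (simp add: v.row_sum flip: t.t_finsum_right)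
    also have "\<dots> \<in> star_span (max_tensor A B) ?T"
      by (rule t.C.star_span_finsum[OF _ T inT]) simp
    finally show ?thesis .
  qed
  moreover have "tensor A B \<one>\<^bsub>A\<^esub> (v a b) \<in> star_span (max_tensor A B) ?T" for a b
  proof -
    have "tensor A B \<one>\<^bsub>A\<^esub> (v a b) = (\<Oplus>\<^bsub>max_tensor A B\<^esub>j\<in>UNIV. tensor A B (u undefined j) (v a b))"
      by (simp add: u.row_sum flip: t.t_finsum_left)
    also have "\<dots> \<in> star_span (max_tensor A B) ?T"
      by (rule t.C.star_span_finsum[OF _ T inT]) simp
    finally show ?thesis .
  qed
  ultimately show "(\<lambda>a. tensor A B a \<one>\<^bsub>B\<^esub>) ` range (case_prod u) \<union> tensor A B \<one>\<^bsub>A\<^esub> ` range (case_prod v)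
    \<subseteq> star_span (max_tensor A B) ?T" by auto
qed

lemma star_hom_opposite: "star_hom A B f \<Longrightarrow> star_hom (opposite A) (opposite B) f"
  by (rule star_homI) (auto simp: star_hom_def ring_hom_closed ring_hom_mult ring_hom_add ring_hom_one)

text \<open>The structure maps are evaluated on the products of generators; the comultiplication
  becomes a convolution over pairs because \<open>tensor_interchange\<close> regroups the four
  legs.\<close>

lemma hopf_tensor_matrix_hopf:
  fixes u :: "'i::finite \<Rightarrow> 'i \<Rightarrow> 'x" and v :: "'j::finite \<Rightarrow> 'j \<Rightarrow> 'y"
  assumes Hu: "matrix_hopf H u" and Kv: "matrix_hopf K v"
    and mu: "magic (alg H) u" and mv: "magic (alg K) v"
  shows "matrix_hopf (H \<otimes>\<^sub>H K) (\<lambda>x y. tensor (alg H) (alg K) (u (fst x) (fst y)) (v (snd x) (snd y)))"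
proof -
  interpret H: matrix_hopf H u by (rule Hu)
  interpret K: matrix_hopf K v by (rule Kv)
  let ?A = "alg H" and ?B = "alg K"
  let ?AB = "max_tensor ?A ?B"
  interpret t: tensor_rep ?A ?B ?AB "tensor ?A ?B" by (intro tensor_tensor_rep H.alg_cstar K.alg_cstar)
  interpret w: magic ?AB "\<lambda>x y. tensor ?A ?B (u (fst x) (fst y)) (v (snd x) (snd y))"
    by (rule magic_pairing[OF t.tensor_rep_axioms mu mv])
  let ?D = "max_tensor ?AB ?AB"
  interpret d: tensor_rep ?AB ?AB ?D "tensor ?AB ?AB" by (intro tensor_tensor_rep t.C.cstar)
  let ?E = "max_tensor H.AA K.AA"
  interpret e: tensor_rep H.AA K.AA ?E "tensor H.AA K.AA" by (intro tensor_tensor_rep H.t.C.cstar K.t.C.cstar)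
  note ih = tensor_interchange_hom[OF H.alg_cstar K.alg_cstar]
    and iv = tensor_interchange_tensor[OF H.alg_cstar K.alg_cstar]
  interpret i: cstar_map ?E ?D "tensor_interchange ?A ?B"
    by (intro cstar_mapI e.C.cstar d.C.cstar ih)
  note mh = tensor_map_hom[OF H.alg_cstar K.alg_cstar H.t.C.cstar K.t.C.cstar H.comult_star_hom K.comult_star_hom]
    and mv = tensor_map_tensor[OF H.alg_cstar K.alg_cstar H.t.C.cstar K.t.C.cstar H.comult_star_hom K.comult_star_hom]
  have comult_rep: "star_hom ?AB ?D (comult (H \<otimes>\<^sub>H K))"
    using star_hom_comp[OF mh ih] by (simp add: hopf_tensor_def comp_def)
  have counit_rep: "tensor_rep ?A ?B complex_cstar (\<lambda>a b. counit H a * counit K b)"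
    using tensor_rep_commuting[OF H.alg_cstar K.alg_cstar complex_cstar_algebra H.counit_star_hom K.counit_star_hom]
    by (simp add: mult.commute)
  \<comment> \<open>The target is an opposite algebra; since the two legs commute, their product is
    the tensor of the two antipodes in either order.\<close>
  have antipode_rep: "tensor_rep ?A ?B (opposite ?AB) (\<lambda>a b. tensor ?A ?B (antipode H a) (antipode K b))"
  proof -
    have "tensor_rep ?A ?B (opposite ?AB) (\<lambda>a b. tensor ?A ?B (antipode H a) \<one>\<^bsub>?B\<^esub> \<otimes>\<^bsub>opposite ?AB\<^esub> tensor ?A ?B \<one>\<^bsub>?A\<^esub> (antipode K b))"
    proof (rule tensor_rep_commuting[OF H.alg_cstar K.alg_cstar opposite_cstar_algebra[OF t.C.cstar]])
      show "star_hom ?A (opposite ?AB) (\<lambda>a. tensor ?A ?B (antipode H a) \<one>\<^bsub>?B\<^esub>)"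
        by (rule star_hom_comp[OF H.antipode_star_hom star_hom_opposite[OF t.left_hom]])
      show "star_hom ?B (opposite ?AB) (\<lambda>b. tensor ?A ?B \<one>\<^bsub>?A\<^esub> (antipode K b))"
        by (rule star_hom_comp[OF K.antipode_star_hom star_hom_opposite[OF t.right_hom]])
    qed (simp add: t.t_mult)
    then show ?thesis
      unfolding tensor_rep_def tensor_rep_axioms_def by (simp add: t.t_mult)
  qed
  have alg: "alg (H \<otimes>\<^sub>H K) = ?AB" by (simp add: hopf_tensor_def)
  show ?thesis
  proof (rule matrix_hopf.intro, unfold alg)
    show "cstar_algebra ?AB" by (rule t.C.cstar)
    show "generates ?AB (range (case_prod (\<lambda>x y. tensor ?A ?B (u (fst x) (fst y)) (v (snd x) (snd y)))))"
      by (rule generates_pairing[OF H.alg_cstar K.alg_cstar mu \<open>magic ?B v\<close> H.u_generates K.u_generates])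
    show "star_hom ?AB ?D (comult (H \<otimes>\<^sub>H K))" by (rule comult_rep)
    show "star_hom ?AB complex_cstar (counit (H \<otimes>\<^sub>H K))"
      using tensor_lift_hom[OF counit_rep] by (simp add: hopf_tensor_def)
    show "star_hom ?AB (opposite ?AB) (antipode (H \<otimes>\<^sub>H K))"
      using tensor_lift_hom[OF antipode_rep] by (simp add: hopf_tensor_def)
    fix x y :: "'i \<times> 'j"
    show "star ?AB (tensor ?A ?B (u (fst x) (fst y)) (v (snd x) (snd y))) = tensor ?A ?B (u (fst x) (fst y)) (v (snd x) (snd y))"
      by (rule w.u_star)
    show "counit (H \<otimes>\<^sub>H K) (tensor ?A ?B (u (fst x) (fst y)) (v (snd x) (snd y))) = of_bool (x = y)"
      by (auto simp: hopf_tensor_def tensor_lift_tensor[OF counit_rep] H.counit_u K.counit_u prod_eq_iff)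
    show "antipode (H \<otimes>\<^sub>H K) (tensor ?A ?B (u (fst x) (fst y)) (v (snd x) (snd y))) = tensor ?A ?B (u (fst y) (fst x)) (v (snd y) (snd x))"
      by (simp add: hopf_tensor_def tensor_lift_tensor[OF antipode_rep] H.antipode_u K.antipode_u)
    let ?s = "\<lambda>k l. tensor ?AB ?AB (tensor ?A ?B (u (fst x) k) (v (snd x) l)) (tensor ?A ?B (u k (fst y)) (v l (snd y)))"
    have "comult (H \<otimes>\<^sub>H K) (tensor ?A ?B (u (fst x) (fst y)) (v (snd x) (snd y))) =
      tensor_interchange ?A ?B (tensor H.AA K.AA (comult H (u (fst x) (fst y))) (comult K (v (snd x) (snd y))))"
      by (simp add: hopf_tensor_def mv)
    also have "\<dots> = tensor_interchange ?A ?B (\<Oplus>\<^bsub>?E\<^esub>k\<in>UNIV. \<Oplus>\<^bsub>?E\<^esub>l\<in>UNIV.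
        tensor H.AA K.AA (tensor ?A ?A (u (fst x) k) (u k (fst y))) (tensor ?B ?B (v (snd x) l) (v l (snd y))))"
      unfolding H.comult_u K.comult_u
      by (subst e.t_finsum_left; (intro arg_cong[of _ _ "tensor_interchange ?A ?B"] e.C.finsum_eq e.t_finsum_right)?) auto
    also have "\<dots> = (\<Oplus>\<^bsub>?D\<^esub>k\<in>UNIV. \<Oplus>\<^bsub>?D\<^esub>l\<in>UNIV. ?s k l)"
      by (auto simp: i.finsum iv intro!: d.C.finsum_eq)
    also have "\<dots> = (\<Oplus>\<^bsub>?D\<^esub>z\<in>UNIV \<times> UNIV. ?s (fst z) (snd z))"
      by (rule d.C.finsum_cartesian[symmetric]) auto
    finally show "comult (H \<otimes>\<^sub>H K) (tensor ?A ?B (u (fst x) (fst y)) (v (snd x) (snd y))) =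
      (\<Oplus>\<^bsub>?D\<^esub>z\<in>UNIV. tensor ?AB ?AB (tensor ?A ?B (u (fst x) (fst z)) (v (snd x) (snd z)))
        (tensor ?A ?B (u (fst z) (fst y)) (v (snd z) (snd y))))"
      by simp
  qed (rule w.column_orth w.row_orth)+
qed

text \<open>The compatibility conditions are equations between homomorphisms that agree on
  \<open>u\<close>; for the antipodes these are homomorphisms into the opposite algebra.\<close>

lemma matrix_hopf_isomorphic:
  assumes Hu: "matrix_hopf H u" and Kv: "matrix_hopf K v"
    and f: "star_hom (alg H) (alg K) f" "\<And>i j. f (u i j) = v i j"
    and g: "star_hom (alg K) (alg H) g" "\<And>i j. g (v i j) = u i j"
  shows "H \<cong>\<^sub>H K"
proof -
  interpret H: matrix_hopf H u by (rule Hu)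
  interpret K: matrix_hopf K v by (rule Kv)
  interpret f: cstar_map "alg H" "alg K" f by (intro cstar_mapI H.alg_cstar K.alg_cstar f)
  interpret g: cstar_map "alg K" "alg H" g by (intro cstar_mapI H.alg_cstar K.alg_cstar g)
  have "g (f x) = x" if "x \<in> carrier (alg H)" for x
    using H.eq_on_u[OF H.alg_cstar star_hom_comp[OF f(1) g(1)] star_hom_id _ that] by (simp add: f g)
  moreover have "f (g x) = x" if "x \<in> carrier (alg K)" for x
    using K.eq_on_u[OF K.alg_cstar star_hom_comp[OF g(1) f(1)] star_hom_id _ that] by (simp add: f g)
  ultimately have bij: "bij_betw f (carrier (alg H)) (carrier (alg K))"
    by (intro bij_betwI[of _ _ _ g]) auto
  note mh = tensor_map_hom[OF H.alg_cstar H.alg_cstar K.alg_cstar K.alg_cstar f(1) f(1)]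
    and mv = tensor_map_tensor[OF H.alg_cstar H.alg_cstar K.alg_cstar K.alg_cstar f(1) f(1)]
  interpret m: cstar_map H.AA K.AA "tensor_map (alg H) (alg H) (alg K) (alg K) f f"
    by (intro cstar_mapI H.t.C.cstar K.t.C.cstar mh)
  have "comult K (f x) = tensor_map (alg H) (alg H) (alg K) (alg K) f f (comult H x)" if "x \<in> carrier (alg H)" for x
    by (rule H.eq_on_u[OF K.t.C.cstar star_hom_comp[OF f(1) K.comult_star_hom] star_hom_comp[OF H.comult_star_hom mh] _ that])
      (simp add: f H.comult_u K.comult_u m.finsum mv)
  moreover have "counit K (f x) = counit H x" if "x \<in> carrier (alg H)" for x
    by (rule H.eq_on_u[OF complex_cstar_algebra star_hom_comp[OF f(1) K.counit_star_hom] H.counit_star_hom _ that])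
      (simp add: f H.counit_u K.counit_u)
  moreover have "antipode K (f x) = f (antipode H x)" if "x \<in> carrier (alg H)" for x
    by (rule H.eq_on_u[OF opposite_cstar_algebra[OF K.alg_cstar] star_hom_comp[OF f(1) K.antipode_star_hom]
          star_hom_comp[OF H.antipode_star_hom star_hom_opposite[OF f(1)]] _ that])
      (simp add: f H.antipode_u K.antipode_u)
  ultimately have "f \<in> hopf_cstar_iso H K"
    using f(1) bij by (simp add: hopf_cstar_iso_def cstar_hom_iff)
  then show ?thesis using H.hopf K.hopf by (auto simp: hopf_cstar_isomorphic_def)
qed

section \<open>Products of graphs\<close>

text \<open>\<open>d \<otimes> e\<close> commutes with the Kronecker product of \<open>u\<close> and
  \<open>v\<close> because each factor acts in its own leg.\<close>

lemma intertwines_pairing: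
  fixes u :: "'i::finite \<Rightarrow> 'i \<Rightarrow> 'x" and v :: "'j::finite \<Rightarrow> 'j \<Rightarrow> 'y"
  assumes "tensor_rep A B C t" "magic A u" "magic B v" and ud: "intertwines A d u" and ve: "intertwines B e v"
  shows "intertwines C (\<lambda>x y. d (fst x) (fst y) * e (snd x) (snd y))
    (\<lambda>x y. t (u (fst x) (fst y)) (v (snd x) (snd y)))"
  unfolding intertwines_def
proof (intro allI)
  interpret t: tensor_rep A B C t by fact
  interpret u: magic A u by fact
  interpret v: magic B v by fact
  have sum: "(\<Oplus>\<^bsub>C\<^esub>z\<in>UNIV. (f (fst z) * g (snd z)) \<odot>\<^bsub>C\<^esub> t (a (fst z)) (b (snd z))) =
    t (\<Oplus>\<^bsub>A\<^esub>k\<in>UNIV. f k \<odot>\<^bsub>A\<^esub> a k) (\<Oplus>\<^bsub>B\<^esub>k\<in>UNIV. g k \<odot>\<^bsub>B\<^esub> b k)"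
    if "\<And>k. a k \<in> carrier A" "\<And>k. b k \<in> carrier B" for f g and a :: "'i \<Rightarrow> 'x" and b :: "'j \<Rightarrow> 'y"
  proof -
    have "(\<Oplus>\<^bsub>C\<^esub>z\<in>UNIV \<times> UNIV. (f (fst z) * g (snd z)) \<odot>\<^bsub>C\<^esub> t (a (fst z)) (b (snd z))) =
      (\<Oplus>\<^bsub>C\<^esub>k\<in>UNIV. \<Oplus>\<^bsub>C\<^esub>l\<in>UNIV. (f k * g l) \<odot>\<^bsub>C\<^esub> t (a k) (b l))"
      using that by (intro t.C.finsum_cartesian) auto
    also have "\<dots> = (\<Oplus>\<^bsub>C\<^esub>k\<in>UNIV. \<Oplus>\<^bsub>C\<^esub>l\<in>UNIV. t (f k \<odot>\<^bsub>A\<^esub> a k) (g l \<odot>\<^bsub>B\<^esub> b l))"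
      using that by (intro t.C.finsum_eq) (auto simp: t.t_scale_left t.t_scale_right mult.commute)
    also have "\<dots> = (\<Oplus>\<^bsub>C\<^esub>k\<in>UNIV. t (f k \<odot>\<^bsub>A\<^esub> a k) (\<Oplus>\<^bsub>B\<^esub>l\<in>UNIV. g l \<odot>\<^bsub>B\<^esub> b l))"
      using that by (intro t.C.finsum_eq t.t_finsum_right[symmetric]) auto
    also have "\<dots> = t (\<Oplus>\<^bsub>A\<^esub>k\<in>UNIV. f k \<odot>\<^bsub>A\<^esub> a k) (\<Oplus>\<^bsub>B\<^esub>k\<in>UNIV. g k \<odot>\<^bsub>B\<^esub> b k)"
      using that by (intro t.t_finsum_left[symmetric]) auto
    finally show ?thesis by simp
  qed
  fix x y
  show "(\<Oplus>\<^bsub>C\<^esub>z\<in>UNIV. (d (fst x) (fst z) * e (snd x) (snd z)) \<odot>\<^bsub>C\<^esub> t (u (fst z) (fst y)) (v (snd z) (snd y))) =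
    (\<Oplus>\<^bsub>C\<^esub>z\<in>UNIV. (d (fst z) (fst y) * e (snd z) (snd y)) \<odot>\<^bsub>C\<^esub> t (u (fst x) (fst z)) (v (snd x) (snd z)))"
    using ud ve
      sum[of "\<lambda>k. u k (fst y)" "\<lambda>k. v k (snd y)" "d (fst x)" "e (snd x)"]
      sum[of "u (fst x)" "v (snd x)" "\<lambda>k. d k (fst y)" "\<lambda>k. e k (snd y)"]
    by (simp add: intertwines_def)
qed

lemma intertwines_unit:
  assumes "magic A u" shows "intertwines A (\<lambda>i j. of_bool (i = j)) u"
proof -
  interpret magic A u by fact
  have "of_bool b \<odot>\<^bsub>A\<^esub> u k l = (if b then u k l else \<zero>\<^bsub>A\<^esub>)" for b k l by simp
  then show ?thesis by (simp add: intertwines_def finsum_delta finsum_delta' del: of_bool_eq_iff)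
qed

lemma intertwines_add:
  assumes "magic A u" "intertwines A d u" "intertwines A e u"
  shows "intertwines A (\<lambda>i j. d i j + e i j) u"
proof -
  interpret magic A u by fact
  show ?thesis using assms(2,3) by (simp add: intertwines_def scale_add_left finsum_add)
qed

section \<open>Matrices diagonal in products of eigenfunctions\<close>

lemma sum_pairing:
  fixes f :: "'a::finite \<Rightarrow> complex" and g :: "'b::finite \<Rightarrow> complex"
  shows "(\<Sum>x\<in>UNIV. (a (fst x) * b (snd x)) * (f (fst x) * g (snd x))) = (\<Sum>i\<in>UNIV. a i * f i) * (\<Sum>j\<in>UNIV. b j * g j)"
proof -
  have "(\<Sum>i\<in>UNIV. a i * f i) * (\<Sum>j\<in>UNIV. b j * g j) = (\<Sum>i\<in>UNIV. \<Sum>j\<in>UNIV. (a i * f i) * (b j * g j))"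
    by (rule sum_product)
  also have "\<dots> = (\<Sum>x\<in>UNIV \<times> UNIV. (a (fst x) * f (fst x)) * (b (snd x) * g (snd x)))"
    by (simp add: sum.cartesian_product split_def)
  finally show ?thesis by (simp add: mult_ac)
qed

text \<open>Instances take for \<open>d\<close> and \<open>e\<close> an adjacency matrix, the
  identity or the all-ones matrix; for the last, the scalar comes from
  \<open>eigenfunction_total\<close>.\<close>

lemma acts_by_pairing:
  assumes "\<And>i j. d i j = d j i" "\<And>a b. e a b = e b a"
    and "\<And>l f i. eigenfunction X l f \<Longrightarrow> (\<Sum>j\<in>UNIV. d i j * f j) = s l * f i"
    and "\<And>m g a. eigenfunction Y m g \<Longrightarrow> (\<Sum>b\<in>UNIV. e a b * g b) = t m * g a"
  shows "acts_by X Y (\<lambda>x y. d (fst x) (fst y) * e (snd x) (snd y)) (\<lambda>l m. s l * t m)"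
  unfolding acts_by_def
proof (intro conjI allI impI)
  show "d (fst x) (fst z) * e (snd x) (snd z) = d (fst z) (fst x) * e (snd z) (snd x)" for x z
    using assms(1,2) by metis
  fix l m f g z assume "eigenfunction X l f" "eigenfunction Y m g"
  then show "(\<Sum>x\<in>UNIV. d (fst z) (fst x) * e (snd z) (snd x) * (f (fst x) * g (snd x))) =
      s l * t m * (f (fst z) * g (snd z))"
    unfolding sum_pairing[of "d (fst z)" "e (snd z)" f g] by (simp add: assms(3,4))
qed

lemma acts_by_add:
  assumes "acts_by X Y D s" "acts_by X Y E t"
  shows "acts_by X Y (\<lambda>x y. D x y + E x y) (\<lambda>l m. s l m + t l m)"
  unfolding acts_by_def
proof (intro conjI allI impI)
  show "D x z + E x z = D z x + E z x" for x z
    using assms unfolding acts_by_def by metis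
  fix l m f g z assume "eigenfunction X l f" "eigenfunction Y m g"
  then have "(\<Sum>x\<in>UNIV. D z x * (f (fst x) * g (snd x))) = s l m * (f (fst z) * g (snd z))"
    "(\<Sum>x\<in>UNIV. E z x * (f (fst x) * g (snd x))) = t l m * (f (fst z) * g (snd z))"
    using assms unfolding acts_by_def by blast+
  then show "(\<Sum>x\<in>UNIV. (D z x + E z x) * (f (fst x) * g (snd x))) = (s l m + t l m) * (f (fst z) * g (snd z))"
    by (simp add: distrib_right sum.distrib)
qed

text \<open>Common to both products: \<open>P\<close> enters through the scalars of its adjacency
  matrix on products of eigenfunctions, which have to separate the pairs of eigenvalues, and through
  \<open>pairing\<close>, which gives the homomorphism from the algebra of \<open>P\<close> to the
  tensor product.\<close>

lemma graph_product_isomorphic: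
  fixes X :: "'a::finite \<Rightarrow> 'a \<Rightarrow> bool" and Y :: "'b::finite \<Rightarrow> 'b \<Rightarrow> bool"
    and P :: "'a \<times> 'b \<Rightarrow> 'a \<times> 'b \<Rightarrow> bool"
  assumes X: "simple_graph X" "connected_graph X" "regular_graph X"
    and Y: "simple_graph Y" "connected_graph Y" "regular_graph Y"
    and P: "acts_by X Y (adj P) s"
    and inj: "\<And>l m l' m'. l \<in> graph_spectrum X \<Longrightarrow> l' \<in> graph_spectrum X \<Longrightarrow> m \<in> graph_spectrum Y \<Longrightarrow>
      m' \<in> graph_spectrum Y \<Longrightarrow> s l m = s l' m' \<Longrightarrow> l = l' \<and> m = m'"
    and pairing: "intertwines (max_tensor (graph_cstar X) (graph_cstar Y)) (adj P)
      (\<lambda>x y. tensor (graph_cstar X) (graph_cstar Y) (graph_gen X (fst x) (fst y)) (graph_gen Y (snd x) (snd y)))"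
  shows "graph_hopf P \<cong>\<^sub>H graph_hopf X \<otimes>\<^sub>H graph_hopf Y"
proof -
  let ?A = "graph_cstar X" and ?B = "graph_cstar Y" and ?C = "graph_cstar P"
  have symp: "symp X" "symp Y" using X(1) Y(1) by (auto simp: simple_graph_def)
  have "symp P"
  proof (rule sympI)
    fix x y assume "P x y"
    moreover have "adj P x y = adj P y x" using P unfolding acts_by_def by blast
    ultimately show "P y x" by (simp add: of_bool_def split: if_splits)
  qed
  have adj_sym: "adj X i j = adj X j i" "adj Y a b = adj Y b a" for i j a b
    using symp by (auto dest: sympD)
  have alg: "alg (graph_hopf X) = ?A" "alg (graph_hopf Y) = ?B" "alg (graph_hopf P) = ?C"
    by (simp_all add: graph_hopf_def Let_def)
  interpret A: cstar_algebra ?A by (rule graph_cstar_algebra)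
  interpret B: cstar_algebra ?B by (rule graph_cstar_algebra)
  interpret C: cstar_algebra ?C by (rule graph_cstar_algebra)
  interpret u: magic ?A "graph_gen X" by (rule graph_gen_magic)
  interpret v: magic ?B "graph_gen Y" by (rule graph_gen_magic)
  interpret w: magic ?C "graph_gen P" by (rule graph_gen_magic)
  interpret t: tensor_rep ?A ?B "max_tensor ?A ?B" "tensor ?A ?B" by (intro tensor_tensor_rep A.cstar B.cstar)
  let ?uv = "\<lambda>x y. tensor ?A ?B (graph_gen X (fst x) (fst y)) (graph_gen Y (snd x) (snd y))"
  obtain f where f: "star_hom ?C (max_tensor ?A ?B) f" "\<And>x y. f (graph_gen P x y) = ?uv x y"
    using graph_hom_ex[OF t.C.cstar magic_pairing[OF t.tensor_rep_axioms u.magic_axioms v.magic_axioms] pairing]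
    by (auto simp: cstar_hom_iff)
  obtain sX where sX: "\<And>l f i. eigenfunction X l f \<Longrightarrow> (\<Sum>j\<in>UNIV. f j) = sX l * f i"
    using eigenfunction_total[OF symp(1) X(2,3)] by blast
  obtain sY where sY: "\<And>l f i. eigenfunction Y l f \<Longrightarrow> (\<Sum>j\<in>UNIV. f j) = sY l * f i"
    using eigenfunction_total[OF symp(2) Y(2,3)] by blast
  have transfer: "intertwines ?C T (graph_gen P)" if "acts_by X Y T t" for T t
    by (rule intertwines_transfer[OF C.star_algebra_axioms w.u_closed symp P that inj graph_gen_intertwines])
  \<comment> \<open>The matrix \<open>1 \<otimes> J\<close>: scalar \<open>1\<close> from the
    identity, \<open>sY m\<close> from the all-ones matrix.\<close>
  have fibres_fst: "intertwines ?C (\<lambda>x y. of_bool (fst x = fst y)) (graph_gen P)"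
    using transfer[OF acts_by_pairing[of "\<lambda>i j. of_bool (i = j)" "\<lambda>a b. 1" X "\<lambda>_. 1" Y sY]] sY by auto
  have fibres_snd: "intertwines ?C (\<lambda>x y. of_bool (snd x = snd y)) (graph_gen P)"
    using transfer[OF acts_by_pairing[of "\<lambda>i j. 1" "\<lambda>a b. of_bool (a = b)" X sX Y "\<lambda>_. 1"]] sX by auto
  interpret U: quotient_magic ?C "graph_gen P" fst
    by unfold_locales (use fibres_fst in auto)
  interpret V: quotient_magic ?C "graph_gen P" snd
    by unfold_locales (use fibres_snd in auto)
  \<comment> \<open>The matrix \<open>adj X \<otimes> J\<close>, which descends along
    \<open>fst\<close> to \<open>adj X\<close>.\<close>
  have "intertwines ?C (\<lambda>x y. adj X (fst x) (fst y)) (graph_gen P)"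
    using transfer[OF acts_by_pairing[of "adj X" "\<lambda>a b. 1" X "\<lambda>l. l" Y sY]] sY adj_sym
    by (simp add: eigenfunction_def)
  then have UX: "intertwines ?C (adj X) U.quotient" by (rule U.quotient_intertwines)
  have "intertwines ?C (\<lambda>x y. adj Y (snd x) (snd y)) (graph_gen P)"
    using transfer[OF acts_by_pairing[of "\<lambda>i j. 1" "adj Y" X sX Y "\<lambda>l. l"]] sX adj_sym
    by (simp add: eigenfunction_def)
  then have VY: "intertwines ?C (adj Y) V.quotient" by (rule V.quotient_intertwines)
  obtain g where g: "star_hom ?A ?C g" "\<And>i j. g (graph_gen X i j) = U.quotient i j"
    using graph_hom_ex[OF C.cstar U.quotient_magic UX] by (auto simp: cstar_hom_iff)
  obtain h where h: "star_hom ?B ?C h" "\<And>i j. h (graph_gen Y i j) = V.quotient i j"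
    using graph_hom_ex[OF C.cstar V.quotient_magic VY] by (auto simp: cstar_hom_iff)
  note prod = quotient_product[OF U.quotient_magic_axioms V.quotient_magic_axioms]
  \<comment> \<open>On generators, commutation is the agreement of the two products in
    \<open>quotient_product\<close>.\<close>
  have comm: "g a \<otimes>\<^bsub>?C\<^esub> h b = h b \<otimes>\<^bsub>?C\<^esub> g a" if "a \<in> carrier ?A" "b \<in> carrier ?B" for a b
    using that
  proof (rule commuting_homs[OF A.cstar B.cstar C.cstar g(1) h(1) graph_generates graph_generates, rotated 2])
    fix y assume "y \<in> range (case_prod (graph_gen Y))"
    moreover from this have "star ?B y = y" by (auto simp: v.u_star)
    ultimately show "star ?B y \<in> range (case_prod (graph_gen Y))" by simp
  next
    fix x y assume "x \<in> range (case_prod (graph_gen X))" "y \<in> range (case_prod (graph_gen Y))"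
    then obtain i j a b where "x = graph_gen X i j" "y = graph_gen Y a b" by auto
    then show "g x \<otimes>\<^bsub>?C\<^esub> h y = h y \<otimes>\<^bsub>?C\<^esub> g x"
      using prod[of "(i, a)" "(j, b)"] by (simp add: g h)
  qed
  obtain k where k: "star_hom (max_tensor ?A ?B) ?C k"
    "\<And>a b. a \<in> carrier ?A \<Longrightarrow> b \<in> carrier ?B \<Longrightarrow> k (tensor ?A ?B a b) = g a \<otimes>\<^bsub>?C\<^esub> h b"
    using max_tensor_lift_ex[OF tensor_rep_commuting[OF A.cstar B.cstar C.cstar g(1) h(1) comm]]
    by (auto simp: cstar_hom_iff)
  have "k (?uv x y) = graph_gen P x y" for x y
    using prod(1)[of x y] by (simp add: k g h)
  moreover have "matrix_hopf (graph_hopf X \<otimes>\<^sub>H graph_hopf Y) ?uv"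
    using hopf_tensor_matrix_hopf[OF graph_matrix_hopf[OF symp(1)] graph_matrix_hopf[OF symp(2)]]
      u.magic_axioms v.magic_axioms by (simp add: alg)
  moreover have "alg (graph_hopf X \<otimes>\<^sub>H graph_hopf Y) = max_tensor ?A ?B"
    by (simp add: hopf_tensor_def alg)
  ultimately show ?thesis
    using matrix_hopf_isomorphic[OF graph_matrix_hopf[OF \<open>symp P\<close>], of "graph_hopf X \<otimes>\<^sub>H graph_hopf Y" ?uv f k] f k(1)
    by (simp add: alg)
qed

theorem theorem4p1:
  fixes X :: "'a::finite \<Rightarrow> 'a \<Rightarrow> bool" and Y :: "'b::finite \<Rightarrow> 'b \<Rightarrow> bool"
  assumes "simple_graph X" and "connected_graph X" and "regular_graph X"
    and "simple_graph Y" and "connected_graph Y" and "regular_graph Y"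
  shows
    "(0 \<notin> graph_spectrum X \<and> 0 \<notin> graph_spectrum Y \<and>
        {a / b | a b. a \<in> graph_spectrum X \<and> b \<in> graph_spectrum X} \<inter>
        {a / b | a b. a \<in> graph_spectrum Y \<and> b \<in> graph_spectrum Y} = {1} \<longrightarrow>
        graph_hopf (direct_product X Y) \<cong>\<^sub>H graph_hopf X \<otimes>\<^sub>H graph_hopf Y) \<and>
     ({a - b | a b. a \<in> graph_spectrum X \<and> b \<in> graph_spectrum X} \<inter>
        {a - b | a b. a \<in> graph_spectrum Y \<and> b \<in> graph_spectrum Y} = {0} \<longrightarrow>
        graph_hopf (cartesian_product X Y) \<cong>\<^sub>H graph_hopf X \<otimes>\<^sub>H graph_hopf Y)"
proof (intro conjI impI)
  have symp: "symp X" "symp Y" and irrefl: "irreflp X" "irreflp Y"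
    using assms by (auto simp: simple_graph_def)
  have adj_sym: "adj X i j = adj X j i" "adj Y a b = adj Y b a" for i j a b
    using symp by (auto dest: sympD)
  let ?A = "graph_cstar X" and ?B = "graph_cstar Y"
  have t: "tensor_rep ?A ?B (max_tensor ?A ?B) (tensor ?A ?B)"
    by (intro tensor_tensor_rep graph_cstar_algebra)
  note uv = magic_pairing[OF t graph_gen_magic graph_gen_magic]
  note pair = intertwines_pairing[OF t graph_gen_magic graph_gen_magic]
  note unit = intertwines_unit[OF graph_gen_magic]
  have act_XY: "acts_by X Y (\<lambda>x y. adj X (fst x) (fst y) * adj Y (snd x) (snd y)) (\<lambda>l m. l * m)"
    using adj_sym by (intro acts_by_pairing) (simp_all add: eigenfunction_def)
  have act_X: "acts_by X Y (\<lambda>x y. adj X (fst x) (fst y) * of_bool (snd x = snd y)) (\<lambda>l m. l * 1)"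
    using adj_sym by (intro acts_by_pairing) (auto simp: eigenfunction_def)
  have act_Y: "acts_by X Y (\<lambda>x y. of_bool (fst x = fst y) * adj Y (snd x) (snd y)) (\<lambda>l m. 1 * m)"
    using adj_sym by (intro acts_by_pairing) (auto simp: eigenfunction_def)
  {
    assume *: "0 \<notin> graph_spectrum X \<and> 0 \<notin> graph_spectrum Y \<and>
        {a / b | a b. a \<in> graph_spectrum X \<and> b \<in> graph_spectrum X} \<inter>
        {a / b | a b. a \<in> graph_spectrum Y \<and> b \<in> graph_spectrum Y} = {1}"
    have adj: "adj (direct_product X Y) = (\<lambda>x y. adj X (fst x) (fst y) * adj Y (snd x) (snd y))"
      by (auto simp: direct_product_def fun_eq_iff)
    have inj: "l = l' \<and> m = m'"
      if "l \<in> graph_spectrum X" "l' \<in> graph_spectrum X" "m \<in> graph_spectrum Y" "m' \<in> graph_spectrum Y"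
        "l * m = l' * m'" for l l' m m'
    proof -
      have nz: "l \<noteq> 0" "l' \<noteq> 0" "m \<noteq> 0" "m' \<noteq> 0" using * that by auto
      \<comment> \<open>Division is possible as \<open>0\<close> lies in neither spectrum; the
        quotient belongs to both sets of ratios.\<close>
      then have eq: "l / l' = m' / m" using that(5) by (simp add: field_simps)
      have "l / l' \<in> {a / b | a b. a \<in> graph_spectrum X \<and> b \<in> graph_spectrum X}" using that by blast
      moreover have "l / l' \<in> {a / b | a b. a \<in> graph_spectrum Y \<and> b \<in> graph_spectrum Y}"
        unfolding eq using that by blast
      ultimately have "l / l' = 1" using * by blast
      then show ?thesis using nz eq by simp
    qed
    show "graph_hopf (direct_product X Y) \<cong>\<^sub>H graph_hopf X \<otimes>\<^sub>H graph_hopf Y"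
    proof (rule graph_product_isomorphic[OF assms])
      show "acts_by X Y (adj (direct_product X Y)) (\<lambda>l m. l * m)" unfolding adj by (rule act_XY)
      show "intertwines (max_tensor ?A ?B) (adj (direct_product X Y))
        (\<lambda>x y. tensor ?A ?B (graph_gen X (fst x) (fst y)) (graph_gen Y (snd x) (snd y)))"
        unfolding adj by (rule pair[OF graph_gen_intertwines graph_gen_intertwines])
    qed (rule inj)
  next
    assume *: "{a - b | a b. a \<in> graph_spectrum X \<and> b \<in> graph_spectrum X} \<inter>
        {a - b | a b. a \<in> graph_spectrum Y \<and> b \<in> graph_spectrum Y} = {0}"
    \<comment> \<open>The sum of the two indicators is again an indicator because \<open>X\<close>
      and \<open>Y\<close> are irreflexive, so that the two kinds of edges never occur at
      once.\<close>
    have adj: "adj (cartesian_product X Y) =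
      (\<lambda>x y. adj X (fst x) (fst y) * of_bool (snd x = snd y) + of_bool (fst x = fst y) * adj Y (snd x) (snd y))"
      using irrefl by (auto simp: cartesian_product_def fun_eq_iff irreflp_def)
    \<comment> \<open>The scalars keep the factors \<open>1\<close> of the two identity matrices,
      the form produced by \<open>acts_by_pairing\<close> and \<open>acts_by_add\<close>.\<close>
    have inj: "l = l' \<and> m = m'"
      if "l \<in> graph_spectrum X" "l' \<in> graph_spectrum X" "m \<in> graph_spectrum Y" "m' \<in> graph_spectrum Y"
        "l * 1 + 1 * m = l' * 1 + 1 * m'" for l l' m m'
    proof -
      have eq: "l - l' = m' - m" using that(5) by (simp add: algebra_simps)
      have "l - l' \<in> {a - b | a b. a \<in> graph_spectrum X \<and> b \<in> graph_spectrum X}" using that by blast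
      moreover have "l - l' \<in> {a - b | a b. a \<in> graph_spectrum Y \<and> b \<in> graph_spectrum Y}"
        unfolding eq using that by blast
      ultimately have "l - l' = 0" using * by blast
      then show ?thesis using eq by simp
    qed
    show "graph_hopf (cartesian_product X Y) \<cong>\<^sub>H graph_hopf X \<otimes>\<^sub>H graph_hopf Y"
    proof (rule graph_product_isomorphic[OF assms])
      show "acts_by X Y (adj (cartesian_product X Y)) (\<lambda>l m. l * 1 + 1 * m)"
        unfolding adj by (rule acts_by_add[OF act_X act_Y])
      show "intertwines (max_tensor ?A ?B) (adj (cartesian_product X Y))
        (\<lambda>x y. tensor ?A ?B (graph_gen X (fst x) (fst y)) (graph_gen Y (snd x) (snd y)))"
        unfolding adj
        by (rule intertwines_add[OF uv pair[OF graph_gen_intertwines unit] pair[OF unit graph_gen_intertwines]])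
    qed (rule inj)
  }
qed

end
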